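(* Let $x=(x_1,\dots,x_N)$ be a random vector in $\mathbb{R}^N$ distributed according to a density of the form $\prod_{i=1}^N f_i(x_i)$, where each $f_i$ is a probability density on $\mathbb{R}$ with $\|f_i\|_\infty\le 1$, and let $z$ be a random vector uniformly distributed in the cube $[-1/2,1/2]^N$. Then for every semi-norm $\|\cdot\|$ on $\mathbb{R}^N$ and every $\varepsilon>0$, $$\mathbb{P}(\|x\|\le\varepsilon)\ \le\ \mathbb{P}(\|z\|\le\varepsilon).$$ In particular, for every $k$-dimensional subspace $E$ of $\mathbb{R}^N$ (with $1\le k\le N$) and every $\varepsilon>0$, $$\mathbb{P}\big(\|P_Ex\|_2\le\varepsilon\sqrt{k}\big)\ \le\ \mathbb{P}\big(\|P_Ez\|_2\le\varepsilon\sqrt{k}\big)\ \le\ (2\sqrt{\pi e}\,\varepsilon)^k.$$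
   Context: $\|\cdot\|_2$ is the Euclidean norm on $\mathbb{R}^N$ and $P_E$ is the orthogonal projection onto $E$. *)

theory Defs
  imports "HOL-Probability.Probability"
begin

definition probability_density :: "(real \<Rightarrow> real) \<Rightarrow> bool"
  where "probability_density f \<longleftrightarrow>
    f \<in> borel_measurable borel \<and> (\<forall>t. 0 \<le> f t) \<and> (\<integral>\<^sup>+ t. ennreal (f t) \<partial>lborel) = 1"

text \<open>The \<open>L\<^sup>\<infinity>\<close> norm with respect to Lebesgue measure; it is \<open>\<infinity>\<close> for essentially unbounded functions.\<close>

definition Linfty_norm :: "(real \<Rightarrow> real) \<Rightarrow> ereal"
  where "Linfty_norm f = esssup lborel (\<lambda>t. ereal \<bar>f t\<bar>)"

text \<open>Nonnegativity follows from the two conditions: \<open>0 = p (x + (- x)) \<le> 2 * p x\<close>.\<close>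

definition is_seminorm :: "('a::real_vector \<Rightarrow> real) \<Rightarrow> bool"
  where "is_seminorm p \<longleftrightarrow>
    (\<forall>x y. p (x + y) \<le> p x + p y) \<and> (\<forall>c x. p (c *\<^sub>R x) = \<bar>c\<bar> * p x)"

definition unit_cube :: "(real ^ 'n) set"
  where "unit_cube = {v. \<forall>i. v $ i \<in> {- 1 / 2 .. 1 / 2}}"

definition orth_proj :: "'a::euclidean_space set \<Rightarrow> 'a \<Rightarrow> 'a"
  where "orth_proj E x = (THE y. y \<in> E \<and> (\<forall>e\<in>E. orthogonal (x - y) e))"

lemma orth_proj:
  assumes "subspace E"
  shows "orth_proj E x \<in> E \<and> (\<forall>e\<in>E. orthogonal (x - orth_proj E x) e)"
  unfolding orth_proj_def
proof (rule theI')
  show "\<exists>!y. y \<in> E \<and> (\<forall>e\<in>E. orthogonal (x - y) e)"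
  proof (rule ex_ex1I)
    obtain y z where "y \<in> span E" "\<And>w. w \<in> span E \<Longrightarrow> orthogonal z w" "x = y + z"
      using orthogonal_subspace_decomp_exists[of E x] by metis
    moreover have "span E = E"
      using assms by (simp add: span_eq_iff)
    ultimately show "\<exists>y. y \<in> E \<and> (\<forall>e\<in>E. orthogonal (x - y) e)"
      by (intro exI[of _ y]) auto
  next
    fix y z
    assume y: "y \<in> E \<and> (\<forall>e\<in>E. orthogonal (x - y) e)"
      and z: "z \<in> E \<and> (\<forall>e\<in>E. orthogonal (x - z) e)"
    have "z - y \<in> E"
      using assms y z by (simp add: subspace_diff)
    then have "(x - y) \<bullet> (z - y) = 0" "(x - z) \<bullet> (z - y) = 0"
      using y z by (auto simp: orthogonal_def)
    then have "(z - y) \<bullet> (z - y) = 0"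
      by (simp add: inner_diff_left)
    then show "y = z"
      by simp
  qed
qed

end

(* First inequality: after discretization, the product of the densities is maximized, one coordinate at a
   time, by uniform distributions on unions of cells of total length 1, because all marginals are bounded
   by 1 (bathtub principle). For such unions of intervals the sublevel set of the semi-norm, a symmetric
   convex set, captures most mass when the intervals are centred, by the contraction argument of Brascamp,
   Lieb and Luttinger, whose analytic input is Anderson's inequality (from Prekopa-Leindler).

   Second inequality: by Markov it suffices to bound the integral of exp (- t |P z|^2) over the cube by
   (2 pi / t)^(k/2). Let a_i be the norm of the projection of the i-th basis vector to E. If some a_i^2
   exceeds 1/2, integrating over z_i first lowers the dimension of E. Otherwise the Gaussian is written as
   a Fourier transform, which turns the cube into a product of sinc functions; the geometric
   Brascamp-Lieb inequality with exponents a_i^2 and Ball's estimate of the integral of |sinc|^p, with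
   p = 1 / a_i^2 >= 2, finish the proof. Brascamp-Lieb is proved by transporting each factor to a Gaussian. *)

theory Submission
  imports Defs "HOL-Real_Asymp.Real_Asymp"
begin

section \<open>Lebesgue measure in coordinates\<close>

text \<open>The law of the projection is never described on \<open>E\<close>, and no integral over a
  subspace occurs: everything is an integral over R^N of a function of the projection, with the
  identity acting on the orthogonal complement of \<open>E\<close>. The threshold 1/2 for a_i^2 is
  where two estimates meet. Ball's inequality, integral of |sinc|^p at most pi * sqrt (2 / p), is
  available for p = 1 / a_i^2 at least 2; and a coordinate with a_i^2 > 1/2, integrated over the
  whole line, costs sqrt (pi / (t * a_i^2)), which is below sqrt (2 * pi / t), the price of one
  dimension. In the Brascamp-Lieb product the factor sqrt (2 / p) cancels against the normalization
  of the Gaussian of deviation a_i, so every coordinate contributes the same base to the power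
  a_i^2, and the a_i^2 add up to k. Ball's inequality is delicate near p = 2, where it is an
  equality: between 2 and 3 it is interpolated from the second and third moments, and beyond 3
  |sinc|^p is compared with a Gaussian up to pi and with a multiple of sin^2 x / x^3
  afterwards.\<close>

lemma Basis_eq_range_axis: "(Basis :: (real ^ 'n) set) = range (\<lambda>i. axis i 1)"
  by (auto simp: Basis_vec_def)

lemma inj_axis_1: "inj (\<lambda>i::'n::finite. axis i (1::real))"
  by (auto intro!: injI simp: axis_eq_axis)

lemma prod_Basis_vec: "(\<Prod>b\<in>Basis. v \<bullet> b) = (\<Prod>i\<in>UNIV. v $ i)" for v :: "real ^ 'n"
  unfolding Basis_eq_range_axis by (subst prod.reindex[OF inj_axis_1]) (auto simp: inner_axis)

text \<open>Connects Lebesgue measure on vectors with \<open>PiM\<close>, where Fubini and the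
  product formulas are available. Both measures agree on boxes, which determine Lebesgue
  measure.\<close>

lemma lborel_vec_eq_distr_PiM:
  "(lborel :: (real ^ 'n) measure) = distr (PiM UNIV (\<lambda>_::'n::finite. lborel)) borel vec_lambda"
proof (rule lborel_eqI)
  interpret product_sigma_finite "\<lambda>_::'n. lborel :: real measure" ..
  have meas: "vec_lambda \<in> measurable (PiM UNIV (\<lambda>_::'n. lborel :: real measure)) borel"
    by (subst borel_measurable_euclidean_space) (auto simp: Basis_vec_def inner_axis)
  fix l u :: "real ^ 'n"
  assume lu: "\<And>b. b \<in> Basis \<Longrightarrow> l \<bullet> b \<le> u \<bullet> b"
  have le: "l $ i \<le> u $ i" for i
    using lu[of "axis i 1"] by (auto simp: inner_axis axis_in_Basis_iff)
  have eq: "vec_lambda -` box l u \<inter> space (PiM UNIV (\<lambda>_::'n. lborel :: real measure)) = Pi\<^sub>E UNIV (\<lambda>i. {l $ i <..< u $ i})"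
    by (auto simp: space_PiM mem_box_cart PiE_def Pi_def)
  have "emeasure (distr (PiM UNIV (\<lambda>_::'n. lborel)) borel vec_lambda) (box l u)
      = emeasure (PiM UNIV (\<lambda>_::'n. lborel)) (Pi\<^sub>E UNIV (\<lambda>i. {l $ i <..< u $ i}))"
    by (subst emeasure_distr[OF meas]) (auto simp: eq)
  also have "\<dots> = (\<Prod>i\<in>UNIV. emeasure lborel {l $ i <..< u $ i})"
    by (rule emeasure_PiM) auto
  also have "\<dots> = (\<Prod>i\<in>UNIV. ennreal (u $ i - l $ i))"
    using le by simp
  also have "\<dots> = ennreal (\<Prod>i\<in>UNIV. u $ i - l $ i)"
    using le by (subst prod_ennreal) auto
  also have "(\<Prod>i\<in>UNIV. u $ i - l $ i) = (\<Prod>b\<in>Basis. (u - l) \<bullet> b)"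
    by (simp add: prod_Basis_vec)
  finally show "emeasure (distr (PiM UNIV (\<lambda>_::'n. lborel)) borel vec_lambda) (box l u) = ennreal (\<Prod>b\<in>Basis. (u - l) \<bullet> b)" .
qed simp

lemma measurable_vec_lambda [measurable]:
  "vec_lambda \<in> measurable (PiM UNIV (\<lambda>_::'n::finite. lborel :: real measure)) borel"
  by (subst borel_measurable_euclidean_space) (auto simp: Basis_vec_def inner_axis)

lemma nn_integral_lborel_vec:
  fixes f :: "real ^ 'n \<Rightarrow> ennreal"
  assumes [measurable]: "f \<in> borel_measurable borel"
  shows "(\<integral>\<^sup>+x. f x \<partial>lborel) = (\<integral>\<^sup>+g. f (vec_lambda g) \<partial>PiM UNIV (\<lambda>_::'n::finite. lborel))"
  by (subst lborel_vec_eq_distr_PiM, subst nn_integral_distr) auto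

lemma measurable_vec_nth_real [measurable]: "(\<lambda>x::real ^ 'n::finite. x $ i) \<in> borel_measurable borel"
  by (intro borel_measurable_continuous_onI continuous_intros)

lemma unit_cube_borel [measurable]: "(unit_cube :: (real ^ 'n::finite) set) \<in> sets borel"
proof -
  have "(unit_cube :: (real ^ 'n) set) = (\<Inter>i. {x. - 1 / 2 \<le> x $ i} \<inter> {x. x $ i \<le> 1 / 2})"
    by (auto simp: unit_cube_def)
  also have "\<dots> \<in> sets borel"
    by (intro borel_closed closed_INT ballI closed_Int closed_Collect_le continuous_intros) auto
  finally show ?thesis .
qed

lemma emeasure_unit_cube: "emeasure lborel (unit_cube :: (real ^ 'n::finite) set) = 1"
proof -
  let ?l = "(\<chi> i. - 1 / 2) :: real ^ 'n" and ?u = "(\<chi> i. 1 / 2) :: real ^ 'n"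
  have "(unit_cube :: (real ^ 'n) set) = cbox ?l ?u"
    by (auto simp: unit_cube_def mem_box_cart)
  also have "emeasure lborel \<dots> = (\<Prod>b\<in>Basis. (?u - ?l) \<bullet> b)"
    by (rule emeasure_lborel_cbox) (auto simp: Basis_vec_def inner_axis)
  also have "(\<Prod>b\<in>Basis. (?u - ?l) \<bullet> b) = 1"
    by (rule prod.neutral) (auto simp: Basis_vec_def inner_axis)
  finally show ?thesis by simp
qed

section \<open>The Prekopa-Leindler inequality and Anderson's inequality\<close>

text \<open>The copy of l * A shifted by (1 - l) * \<open>b0\<close> ends where the copy of (1 - l)
  * B shifted by l * \<open>a1\<close> begins. Both lie in \<open>C\<close> and share at most that
  one point, so their lengths add up.\<close>

lemma brunn_minkowski_real_compact:
  fixes A B C :: "real set"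
  assumes "compact A" "compact B" "A \<noteq> {}" "B \<noteq> {}" and C: "C \<in> sets lborel"
    and l: "0 < l" "l < 1"
    and ABC: "\<And>a b. a \<in> A \<Longrightarrow> b \<in> B \<Longrightarrow> l * a + (1 - l) * b \<in> C"
  shows "ennreal l * emeasure lborel A + ennreal (1 - l) * emeasure lborel B \<le> emeasure lborel C"
proof -
  obtain a1 where a1: "a1 \<in> A" "\<And>a. a \<in> A \<Longrightarrow> a \<le> a1"
    using compact_attains_sup[OF assms(1,3)] by auto
  obtain b0 where b0: "b0 \<in> B" "\<And>b. b \<in> B \<Longrightarrow> b0 \<le> b"
    using compact_attains_inf[OF assms(2,4)] by auto
  let ?A = "(\<lambda>x. l *\<^sub>R x + (1 - l) * b0) ` A"
  let ?B = "(\<lambda>x. (1 - l) *\<^sub>R x + l * a1) ` B"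
  have AB: "compact ?A" "compact ?B"
    by (intro compact_continuous_image continuous_intros assms)+
  have sets: "?A \<in> sets lborel" "?B \<in> sets lborel" "A \<in> sets lborel" "B \<in> sets lborel"
    using AB assms(1,2) by (auto intro: borel_compact)
  have "?A \<inter> ?B \<subseteq> {l * a1 + (1 - l) * b0}"
  proof
    fix x assume "x \<in> ?A \<inter> ?B"
    then obtain a b where ab: "a \<in> A" "b \<in> B" and x: "x = l * a + (1 - l) * b0" "x = (1 - l) * b + l * a1"
      by auto
    have "l * a \<le> l * a1" "(1 - l) * b0 \<le> (1 - l) * b"
      using a1 b0 ab l by (auto intro!: mult_left_mono)
    then have "x = l * a1 + (1 - l) * b0"
      using x by linarith
    then show "x \<in> {l * a1 + (1 - l) * b0}" by simp
  qed
  then have null: "emeasure lborel (?A \<inter> ?B) = 0"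
    by (meson emeasure_lborel_countable countable_finite finite.intros finite_subset)
  have eA: "emeasure lborel ?A = ennreal l * emeasure lborel A"
    using emeasure_lebesgue_affine[of "l" "(1 - l) * b0" A] l sets by simp
  have eB: "emeasure lborel ?B = ennreal (1 - l) * emeasure lborel B"
    using emeasure_lebesgue_affine[of "1 - l" "l * a1" B] l sets by simp
  have "emeasure lborel ?A + emeasure lborel ?B = emeasure lborel (?A \<union> ?B)"
    using emeasure_Un_Int[OF sets(1,2)] null by simp
  also have "\<dots> \<le> emeasure lborel C"
    using ABC[OF _ b0(1)] ABC[OF a1(1)] by (intro emeasure_mono C) (auto simp: add.commute)
  finally show ?thesis
    using eA eB by simp
qed

text \<open>The closed set from inner regularity may be empty, for instance when \<open>A\<close> is
  a null set, while Brunn-Minkowski needs nonempty sets; hence the extra point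
  \<open>a\<close>.\<close>

lemma compact_inner_approx:
  fixes A :: "real set"
  assumes "bounded A" "A \<in> sets lborel" "A \<noteq> {}" "e > 0"
  obtains K where "compact K" "K \<noteq> {}" "K \<subseteq> A" "emeasure lborel A \<le> emeasure lborel K + ennreal e"
proof -
  obtain T where T: "closed T" "T \<subseteq> A" "emeasure lebesgue (A - T) < ennreal e"
    using sets_lebesgue_inner_closed[of A e] assms
    by (metis sets_completionI_sets)
  obtain a where a: "a \<in> A" using assms by auto
  have c: "compact (insert a T)"
    using T assms(1) bounded_subset by (auto simp: compact_eq_bounded_closed)
  then have K[measurable]: "insert a T \<in> sets lborel"
    by (auto intro: borel_compact)
  have "A = insert a T \<union> (A - insert a T)"
    using T a by auto
  then have "emeasure lborel A = emeasure lborel (insert a T \<union> (A - insert a T))"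
    by simp
  also have "\<dots> \<le> emeasure lborel (insert a T) + emeasure lborel (A - insert a T)"
    using assms K by (intro emeasure_subadditive) auto
  also have "emeasure lborel (A - insert a T) \<le> emeasure lebesgue (A - T)"
  proof -
    have "emeasure lborel (A - insert a T) = emeasure lebesgue (A - insert a T)"
      using assms K by simp
    also have "\<dots> \<le> emeasure lebesgue (A - T)"
      using T assms by (intro emeasure_mono) auto
    finally show ?thesis .
  qed
  finally have "emeasure lborel A \<le> emeasure lborel (insert a T) + ennreal e"
    using T(3) by (meson add_left_mono dual_order.trans less_imp_le)
  then show thesis
    using c T(2) a by (intro that[of "insert a T"]) auto
qed

text \<open>\<open>C\<close> is any measurable set that contains the weighted Minkowski sum, because
  that sum of two Borel sets need not be Borel. The compact case is applied to inner
  approximations.\<close>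

lemma brunn_minkowski_real:
  fixes A B C :: "real set"
  assumes "bounded A" "bounded B" "A \<noteq> {}" "B \<noteq> {}"
    and "A \<in> sets lborel" "B \<in> sets lborel" "C \<in> sets lborel"
    and l: "0 < l" "l < 1"
    and ABC: "\<And>a b. a \<in> A \<Longrightarrow> b \<in> B \<Longrightarrow> l * a + (1 - l) * b \<in> C"
  shows "ennreal l * emeasure lborel A + ennreal (1 - l) * emeasure lborel B \<le> emeasure lborel C"
proof (rule ennreal_le_epsilon)
  fix e :: real assume "0 < e"
  obtain K where K: "compact K" "K \<noteq> {}" "K \<subseteq> A" "emeasure lborel A \<le> emeasure lborel K + ennreal e"
    using compact_inner_approx[OF assms(1,5,3) \<open>0 < e\<close>] by metis
  obtain L where L: "compact L" "L \<noteq> {}" "L \<subseteq> B" "emeasure lborel B \<le> emeasure lborel L + ennreal e"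
    using compact_inner_approx[OF assms(2,6,4) \<open>0 < e\<close>] by metis
  have "ennreal l * emeasure lborel A + ennreal (1 - l) * emeasure lborel B
      \<le> ennreal l * (emeasure lborel K + ennreal e) + ennreal (1 - l) * (emeasure lborel L + ennreal e)"
    using K L by (intro add_mono mult_left_mono) auto
  also have "\<dots> = (ennreal l * emeasure lborel K + ennreal (1 - l) * emeasure lborel L)
      + (ennreal l * ennreal e + ennreal (1 - l) * ennreal e)"
    by (simp add: distrib_left add_ac)
  also have "ennreal l * ennreal e + ennreal (1 - l) * ennreal e = ennreal e"
    using l \<open>0 < e\<close> by (simp flip: ennreal_mult ennreal_plus add: algebra_simps)
  also have "ennreal l * emeasure lborel K + ennreal (1 - l) * emeasure lborel L \<le> emeasure lborel C"
    using K L assms by (intro brunn_minkowski_real_compact) auto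
  finally show "ennreal l * emeasure lborel A + ennreal (1 - l) * emeasure lborel B \<le> emeasure lborel C + ennreal e"
    by (simp add: add_right_mono)
qed

section \<open>The Prekopa-Leindler inequality on the line\<close>

lemma nn_integral_layer_cake:
  fixes f :: "real \<Rightarrow> real"
  assumes [measurable]: "f \<in> borel_measurable borel" and "\<And>x. 0 \<le> f x"
  shows "(\<integral>\<^sup>+x. ennreal (f x) \<partial>lborel) = (\<integral>\<^sup>+t. emeasure lborel {x. t < f x} * indicator {0..} t \<partial>lborel)"
proof -
  have "(\<integral>\<^sup>+x. ennreal (f x) \<partial>lborel) = (\<integral>\<^sup>+x. (\<integral>\<^sup>+t. indicator {0..} t * indicator {z. snd z < f (fst z)} (x, t) \<partial>lborel) \<partial>lborel)"
  proof (rule nn_integral_cong)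
    fix x
    have "(\<integral>\<^sup>+t. indicator {0..} t * indicator {z. snd z < f (fst z)} (x, t) \<partial>lborel)
        = (\<integral>\<^sup>+t. indicator {0..<f x} t \<partial>lborel)"
      by (intro nn_integral_cong) (auto split: split_indicator)
    then show "ennreal (f x) = (\<integral>\<^sup>+t. indicator {0..} t * indicator {z. snd z < f (fst z)} (x, t) \<partial>lborel)"
      using assms(2)[of x] by simp
  qed
  also have "\<dots> = (\<integral>\<^sup>+t. (\<integral>\<^sup>+x. indicator {0..} t * indicator {z. snd z < f (fst z)} (x, t) \<partial>lborel) \<partial>lborel)"
    by (rule lborel_pair.Fubini'[symmetric]) measurable
  also have "\<dots> = (\<integral>\<^sup>+t. emeasure lborel {x. t < f x} * indicator {0..} t \<partial>lborel)"
  proof (rule nn_integral_cong)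
    fix t
    have "(\<integral>\<^sup>+x. indicator {0..} t * indicator {z. snd z < f (fst z)} (x, t) \<partial>lborel)
       = (\<integral>\<^sup>+x. indicator {0..} t * indicator {x. t < f x} x \<partial>lborel)"
      by (intro nn_integral_cong) (auto split: split_indicator)
    also have "\<dots> = indicator {0..} t * emeasure lborel {x. t < f x}"
      by (subst nn_integral_cmult) auto
    finally show "(\<integral>\<^sup>+x. indicator {0..} t * indicator {z. snd z < f (fst z)} (x, t) \<partial>lborel) = emeasure lborel {x. t < f x} * indicator {0..} t"
      by (simp add: mult.commute)
  qed
  finally show ?thesis .
qed

lemma integrable_bounded_support_real:
  fixes f :: "real \<Rightarrow> real"
  assumes [measurable]: "f \<in> borel_measurable borel"
    and "\<And>x. 0 \<le> f x" "\<And>x. f x \<le> C" "\<And>x. R < \<bar>x\<bar> \<Longrightarrow> f x = 0"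
  shows "integrable lborel f"
proof (rule Bochner_Integration.integrable_bound)
  show "integrable lborel (\<lambda>x. C * indicator {-R..R} x)"
    by (intro integrable_mult_right) (auto simp: integrable_indicator_iff emeasure_lborel_Icc_eq)
  show "AE x in lborel. norm (f x) \<le> norm (C * indicator {- R..R} x :: real)"
  proof (rule AE_I2)
    fix x show "norm (f x) \<le> norm (C * indicator {- R..R} x :: real)"
    proof (cases "\<bar>x\<bar> \<le> R")
      case True
      have "f x \<le> C" by (rule assms)
      then show ?thesis using True assms(2)[of x] by (auto simp: indicator_def abs_le_iff)
    qed (use assms(4)[of x] in auto)
  qed
qed simp

text \<open>Turns the pointwise hypothesis of Prekopa-Leindler into the hypothesis of
  Brunn-Minkowski on superlevel sets.\<close>

lemma geometric_mean_ge_level: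
  fixes l :: real
  assumes "0 \<le> t" "t < x" "t < y" "0 < l" "l < 1"
  shows "t < x powr l * y powr (1 - l)"
proof -
  define m where "m = min x y"
  have m: "0 < m" "t < m" "m \<le> x" "m \<le> y"
    using assms by (auto simp: m_def)
  have "m = m powr l * m powr (1 - l)"
    using m by (simp flip: powr_add)
  also have "\<dots> \<le> x powr l * y powr (1 - l)"
    using m assms by (intro mult_mono powr_mono2) auto
  finally show ?thesis using m by simp
qed

text \<open>With both suprema equal to 1, the superlevel sets of \<open>F\<close> and
  \<open>G\<close> are nonempty for the same levels t in [0, 1) and empty above, so Brunn-Minkowski
  applies level by level. A level at which only one of them is empty would say nothing about
  \<open>H\<close>. Integration over t yields the arithmetic mean of the integrals, which is more
  than the geometric one.\<close>

lemma prekopa_leindler_normalized: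
  fixes F G H :: "real \<Rightarrow> real"
  assumes [measurable]: "F \<in> borel_measurable borel" "G \<in> borel_measurable borel" "H \<in> borel_measurable borel"
    and nn: "\<And>x. 0 \<le> F x" "\<And>x. 0 \<le> G x" "\<And>x. 0 \<le> H x"
    and le1: "\<And>x. F x \<le> 1" "\<And>x. G x \<le> 1"
    and sup1: "\<And>t. t < 1 \<Longrightarrow> \<exists>x. t < F x" "\<And>t. t < 1 \<Longrightarrow> \<exists>x. t < G x"
    and supp: "\<And>x. R < \<bar>x\<bar> \<Longrightarrow> F x = 0" "\<And>x. R < \<bar>x\<bar> \<Longrightarrow> G x = 0"
    and l: "0 < l" "l < 1"
    and FGH: "\<And>x y. F x powr l * G y powr (1 - l) \<le> H (l * x + (1 - l) * y)"
  shows "ennreal l * (\<integral>\<^sup>+x. F x \<partial>lborel) + ennreal (1 - l) * (\<integral>\<^sup>+x. G x \<partial>lborel) \<le> (\<integral>\<^sup>+x. H x \<partial>lborel)"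
proof -
  have *: "ennreal l * (emeasure lborel {x. t < F x} * indicator {0..} t)
         + ennreal (1 - l) * (emeasure lborel {x. t < G x} * indicator {0..} t)
     \<le> emeasure lborel {x. t < H x} * indicator {0..} t" for t
  proof (cases "0 \<le> t \<and> t < 1")
    case True
    have b: "bounded {x. t < F x}" "bounded {x. t < G x}"
      using True supp unfolding bounded_iff
      by (force intro!: exI[of _ R] simp: not_less[symmetric])+
    have "ennreal l * emeasure lborel {x. t < F x} + ennreal (1 - l) * emeasure lborel {x. t < G x}
        \<le> emeasure lborel {x. t < H x}"
    proof (rule brunn_minkowski_real[OF b])
      show "{x. t < F x} \<noteq> {}" "{x. t < G x} \<noteq> {}"
        using True sup1 by auto
      fix a b assume "a \<in> {x. t < F x}" "b \<in> {x. t < G x}"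
      then have "t < F a powr l * G b powr (1 - l)"
        using True l by (intro geometric_mean_ge_level) auto
      also note FGH
      finally show "l * a + (1 - l) * b \<in> {x. t < H x}" by simp
    qed (use l in auto)
    then show ?thesis using True by simp
  next
    case False
    then consider "t < 0" | "1 \<le> t" by linarith
    then show ?thesis
    proof cases
      case 2
      then have "{x. t < F x} = {}" "{x. t < G x} = {}"
        using le1 by (auto simp: not_less intro: order_trans)
      then show ?thesis by simp
    qed simp
  qed
  have "ennreal l * (\<integral>\<^sup>+x. F x \<partial>lborel) + ennreal (1 - l) * (\<integral>\<^sup>+x. G x \<partial>lborel)
      = ennreal l * (\<integral>\<^sup>+t. emeasure lborel {x. t < F x} * indicator {0..} t \<partial>lborel)
      + ennreal (1 - l) * (\<integral>\<^sup>+t. emeasure lborel {x. t < G x} * indicator {0..} t \<partial>lborel)"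
    using nn by (simp add: nn_integral_layer_cake)
  also have "\<dots> = (\<integral>\<^sup>+t. ennreal l * (emeasure lborel {x. t < F x} * indicator {0..} t)
         + ennreal (1 - l) * (emeasure lborel {x. t < G x} * indicator {0..} t) \<partial>lborel)"
    by (simp add: nn_integral_add nn_integral_cmult)
  also have "\<dots> \<le> (\<integral>\<^sup>+t. emeasure lborel {x. t < H x} * indicator {0..} t \<partial>lborel)"
    by (intro nn_integral_mono *)
  also have "\<dots> = (\<integral>\<^sup>+x. H x \<partial>lborel)"
    using nn by (simp add: nn_integral_layer_cake)
  finally show ?thesis .
qed

lemma prekopa_leindler_real:
  fixes f g h :: "real \<Rightarrow> real"
  assumes meas[measurable]: "f \<in> borel_measurable borel" "g \<in> borel_measurable borel" "h \<in> borel_measurable borel"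
    and nn: "\<And>x. 0 \<le> f x" "\<And>x. 0 \<le> g x" "\<And>x. 0 \<le> h x"
    and bdd: "\<And>x. f x \<le> C" "\<And>x. g x \<le> C" "\<And>x. h x \<le> C"
    and supp: "\<And>x. R < \<bar>x\<bar> \<Longrightarrow> f x = 0" "\<And>x. R < \<bar>x\<bar> \<Longrightarrow> g x = 0" "\<And>x. R < \<bar>x\<bar> \<Longrightarrow> h x = 0"
    and l: "0 < l" "l < 1"
    and fgh: "\<And>x y. f x powr l * g y powr (1 - l) \<le> h (l * x + (1 - l) * y)"
  shows "(\<integral>x. f x \<partial>lborel) powr l * (\<integral>x. g x \<partial>lborel) powr (1 - l) \<le> (\<integral>x. h x \<partial>lborel)"
proof (cases "(\<integral>x. f x \<partial>lborel) = 0 \<or> (\<integral>x. g x \<partial>lborel) = 0")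
  case True
  then show ?thesis using nn by (auto intro: integral_nonneg_AE)
next
  case False
  have int: "integrable lborel f" "integrable lborel g" "integrable lborel h"
    using meas nn bdd supp by (auto intro!: integrable_bounded_support_real[where C=C and R=R])
  define M where "M = (SUP x. f x)"
  define N where "N = (SUP x. g x)"
  have bd: "bdd_above (range f)" "bdd_above (range g)"
    using bdd by (auto intro!: bdd_aboveI[of _ C])
  have MN: "f x \<le> M" "g x \<le> N" for x
    using bd by (auto simp: M_def N_def intro: cSUP_upper)
  have "f \<noteq> (\<lambda>_. 0)" "g \<noteq> (\<lambda>_. 0)"
    using False by auto
  then obtain x y where "f x \<noteq> 0" "g y \<noteq> 0"
    by (metis ext)
  then have "0 < f x" "0 < g y"
    using nn(1)[of x] nn(2)[of y] by auto
  then have pos: "0 < M" "0 < N"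
    using MN(1)[of x] MN(2)[of y] by linarith+
  \<comment> \<open>The divisor of \<open>h\<close> that is compatible, in the hypothesis, with
    dividing \<open>f\<close> by \<open>M\<close> and \<open>g\<close> by \<open>N\<close>.\<close>
  define a where "a = M powr l * N powr (1 - l)"
  have a: "0 < a" using pos by (simp add: a_def)
  have "ennreal l * (\<integral>\<^sup>+x. f x / M \<partial>lborel) + ennreal (1 - l) * (\<integral>\<^sup>+x. g x / N \<partial>lborel) \<le> (\<integral>\<^sup>+x. h x / a \<partial>lborel)"
  proof (rule prekopa_leindler_normalized[where R=R])
    show "\<exists>x. t < f x / M" if "t < 1" for t
    proof -
      have "t * M < (SUP x. f x)" using that pos by (simp add: M_def)
      then obtain x where "t * M < f x"
        using bd by (auto simp: less_cSUP_iff)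
      then show ?thesis using pos by (auto simp: field_simps)
    qed
    show "\<exists>x. t < g x / N" if "t < 1" for t
    proof -
      have "t * N < (SUP x. g x)" using that pos by (simp add: N_def)
      then obtain x where "t * N < g x"
        using bd by (auto simp: less_cSUP_iff)
      then show ?thesis using pos by (auto simp: field_simps)
    qed
    fix x y
    have "(f x / M) powr l * (g y / N) powr (1 - l) = (f x powr l * g y powr (1 - l)) / a"
      using nn pos by (simp add: powr_divide a_def)
    also have "\<dots> \<le> h (l * x + (1 - l) * y) / a"
      using a fgh by (intro divide_right_mono) auto
    finally show "(f x / M) powr l * (g y / N) powr (1 - l) \<le> h (l * x + (1 - l) * y) / a" .
  qed (use nn pos a MN supp l in auto)
  also have "(\<integral>\<^sup>+x. f x / M \<partial>lborel) = ennreal ((\<integral>x. f x \<partial>lborel) / M)"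
    using int nn pos by (subst nn_integral_eq_integral) auto
  also have "(\<integral>\<^sup>+x. g x / N \<partial>lborel) = ennreal ((\<integral>x. g x \<partial>lborel) / N)"
    using int nn pos by (subst nn_integral_eq_integral) auto
  also have "(\<integral>\<^sup>+x. h x / a \<partial>lborel) = ennreal ((\<integral>x. h x \<partial>lborel) / a)"
    using int nn a by (subst nn_integral_eq_integral) auto
  finally have *: "l * ((\<integral>x. f x \<partial>lborel) / M) + (1 - l) * ((\<integral>x. g x \<partial>lborel) / N) \<le> (\<integral>x. h x \<partial>lborel) / a"
    using l pos a nn by (simp flip: ennreal_mult ennreal_plus add: integral_nonneg_AE divide_nonneg_pos)
  have fg: "0 < (\<integral>x. f x \<partial>lborel)" "0 < (\<integral>x. g x \<partial>lborel)"
    using False integral_nonneg_AE[where f=f and M=lborel] integral_nonneg_AE[where f=g and M=lborel] nn(1,2)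
    by (auto simp: less_le)
  have "((\<integral>x. f x \<partial>lborel) / M) powr l * ((\<integral>x. g x \<partial>lborel) / N) powr (1 - l)
      \<le> l * ((\<integral>x. f x \<partial>lborel) / M) + (1 - l) * ((\<integral>x. g x \<partial>lborel) / N)"
    using l fg pos by (intro Youngs_inequality_0) auto
  also note *
  also have "((\<integral>x. f x \<partial>lborel) / M) powr l * ((\<integral>x. g x \<partial>lborel) / N) powr (1 - l)
     = ((\<integral>x. f x \<partial>lborel) powr l * (\<integral>x. g x \<partial>lborel) powr (1 - l)) / a"
    using fg pos by (simp add: powr_divide a_def)
  finally show ?thesis
    using a by (simp add: divide_le_cancel)
qed

section \<open>The Prekopa-Leindler inequality in several variables\<close>

text \<open>A class that is stable under integrating out a coordinate: the bound \<open>C\<close>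
  only becomes \<open>C * (2 * R)\<close>. Boundedness and bounded support make all sections
  integrable, and the indicators needed for Anderson's inequality belong to it.\<close>

definition box_supported :: "'i set \<Rightarrow> real \<Rightarrow> real \<Rightarrow> (('i \<Rightarrow> real) \<Rightarrow> real) \<Rightarrow> bool" where
  "box_supported I C R f \<longleftrightarrow> f \<in> borel_measurable (PiM I (\<lambda>_. lborel)) \<and>
    (\<forall>x\<in>space (PiM I (\<lambda>_. lborel :: real measure)). 0 \<le> f x \<and> f x \<le> C \<and> (\<forall>i\<in>I. R < \<bar>x i\<bar> \<longrightarrow> f x = 0))"

lemma box_supported_integrable:
  assumes "finite I" "box_supported I C R f" "0 \<le> C"
  shows "integrable (PiM I (\<lambda>_. lborel)) f"
proof -
  interpret product_sigma_finite "\<lambda>_. lborel :: real measure" ..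
  have meas[measurable]: "f \<in> borel_measurable (PiM I (\<lambda>_. lborel))"
    using assms by (simp add: box_supported_def)
  have S: "Pi\<^sub>E I (\<lambda>_. {-R..R}) \<in> sets (PiM I (\<lambda>_. lborel))"
    using assms by (intro sets_PiM_I_finite) auto
  show ?thesis
  proof (rule Bochner_Integration.integrable_bound)
    have "emeasure (PiM I (\<lambda>_. lborel)) (Pi\<^sub>E I (\<lambda>_. {-R..R})) < \<infinity>"
      using assms(1) by (subst emeasure_PiM) (auto simp: emeasure_lborel_Icc_eq prod_ennreal ennreal_power)
    then show "integrable (PiM I (\<lambda>_. lborel)) (\<lambda>x. C * indicator (Pi\<^sub>E I (\<lambda>_. {-R..R})) x)"
      using S by (intro integrable_mult_right) auto
    show "AE x in PiM I (\<lambda>_. lborel). norm (f x) \<le> norm (C * indicator (Pi\<^sub>E I (\<lambda>_. {-R..R})) x :: real)"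
    proof (rule AE_I2)
      fix x assume x: "x \<in> space (PiM I (\<lambda>_. lborel :: real measure))"
      then have f: "0 \<le> f x" "f x \<le> C" "\<And>i. i \<in> I \<Longrightarrow> R < \<bar>x i\<bar> \<Longrightarrow> f x = 0"
        using assms by (auto simp: box_supported_def)
      show "norm (f x) \<le> norm (C * indicator (Pi\<^sub>E I (\<lambda>_. {-R..R})) x :: real)"
      proof (cases "x \<in> Pi\<^sub>E I (\<lambda>_. {-R..R})")
        case False
        then obtain i where i: "i \<in> I" "x i \<notin> {-R..R}"
          using x by (auto simp: space_PiM PiE_iff)
        then have "R < \<bar>x i\<bar>" by auto
        then show ?thesis using f(3)[OF i(1)] by simp
      qed (use f in auto)
    qed
  qed simp
qed

lemma fun_upd_in_space_PiM_lborel: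
  "x \<in> space (PiM I (\<lambda>_. lborel :: real measure)) \<Longrightarrow> x(i := t) \<in> space (PiM (insert i I) (\<lambda>_. lborel :: real measure))"
  by (auto simp: space_PiM PiE_iff extensional_def)

lemma box_supported_section:
  assumes "box_supported (insert i I) C R f" "i \<notin> I" and x: "x \<in> space (PiM I (\<lambda>_. lborel :: real measure))"
  shows "(\<lambda>t. f (x(i := t))) \<in> borel_measurable borel" "0 \<le> f (x(i := t))" "f (x(i := t)) \<le> C"
    "R < \<bar>t\<bar> \<Longrightarrow> f (x(i := t)) = 0"
proof -
  have f: "f \<in> borel_measurable (PiM (insert i I) (\<lambda>_. lborel))"
    using assms by (simp add: box_supported_def)
  have "(\<lambda>t. x(i := t)) \<in> measurable lborel (PiM (insert i I) (\<lambda>_. lborel))"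
    using x assms(2) by (rule measurable_component_update)
  from measurable_comp[OF this f] show "(\<lambda>t. f (x(i := t))) \<in> borel_measurable borel"
    by (simp add: comp_def)
  show "0 \<le> f (x(i := t))" "f (x(i := t)) \<le> C" "R < \<bar>t\<bar> \<Longrightarrow> f (x(i := t)) = 0"
    using assms(1) fun_upd_in_space_PiM_lborel[OF x, of i t] by (auto simp: box_supported_def)
qed

lemma box_supported_marginal:
  assumes f: "box_supported (insert i I) C R f" "i \<notin> I" and "0 \<le> C" "0 \<le> R"
  shows "box_supported I (C * (2 * R)) R (\<lambda>x. \<integral>t. f (x(i := t)) \<partial>lborel)"
  unfolding box_supported_def
proof (intro conjI ballI impI)
  have f'[measurable]: "f \<in> borel_measurable (PiM (insert i I) (\<lambda>_. lborel))"
    using f by (simp add: box_supported_def)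
  have "(\<lambda>p. f ((fst p)(i := snd p))) \<in> borel_measurable (PiM I (\<lambda>_. lborel) \<Otimes>\<^sub>M lborel)"
    by measurable
  then show "(\<lambda>x. \<integral>t. f (x(i := t)) \<partial>lborel) \<in> borel_measurable (PiM I (\<lambda>_. lborel))"
    by (intro lborel.borel_measurable_lebesgue_integral) (simp add: split_def)
  fix x assume x: "x \<in> space (PiM I (\<lambda>_. lborel :: real measure))"
  note s = box_supported_section[OF f x]
  show "0 \<le> (\<integral>t. f (x(i := t)) \<partial>lborel)"
    using s by (intro Bochner_Integration.integral_nonneg) auto
  have "(\<integral>t. f (x(i := t)) \<partial>lborel) \<le> (\<integral>t. C * indicator {-R..R} t \<partial>lborel)"
  proof (rule integral_mono)
    show "integrable lborel (\<lambda>t. f (x(i := t)))"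
      using s by (intro integrable_bounded_support_real[where C=C and R=R]) auto
    show "integrable lborel (\<lambda>t. C * indicator {-R..R} t)"
      by (intro integrable_mult_right) (auto simp: integrable_indicator_iff emeasure_lborel_Icc_eq)
    fix t show "f (x(i := t)) \<le> C * indicator {-R..R} t"
      using s(3)[of t] s(4)[of t] by (auto split: split_indicator)
  qed
  also have "\<dots> = C * (2 * R)"
    using assms by simp
  finally show "(\<integral>t. f (x(i := t)) \<partial>lborel) \<le> C * (2 * R)" .
  fix j assume j: "j \<in> I" "R < \<bar>x j\<bar>"
  have "f (x(i := t)) = 0" for t
    using f j fun_upd_in_space_PiM_lborel[OF x, of i t] unfolding box_supported_def
    by (metis fun_upd_other insertCI)
  then show "(\<integral>t. f (x(i := t)) \<partial>lborel) = 0"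
    by simp
qed

text \<open>The one-dimensional inequality in coordinate \<open>i\<close> says exactly that the
  marginals of \<open>f\<close>, \<open>g\<close> and \<open>h\<close> satisfy the hypothesis in the
  remaining coordinates. \<open>C\<close> varies in the induction because the marginals have another
  bound.\<close>

lemma prekopa_leindler_PiM:
  fixes f g h :: "('i \<Rightarrow> real) \<Rightarrow> real"
  assumes "finite I" "box_supported I C R f" "box_supported I C R g" "box_supported I C R h"
    and CR: "0 \<le> C" "0 \<le> R"
    and l: "0 < l" "l < 1"
    and fgh: "\<And>x y. x \<in> space (PiM I (\<lambda>_. lborel :: real measure)) \<Longrightarrow> y \<in> space (PiM I (\<lambda>_. lborel :: real measure)) \<Longrightarrow>
       f x powr l * g y powr (1 - l) \<le> h (\<lambda>i\<in>I. l * x i + (1 - l) * y i)"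
  shows "(\<integral>x. f x \<partial>PiM I (\<lambda>_. lborel)) powr l * (\<integral>x. g x \<partial>PiM I (\<lambda>_. lborel)) powr (1 - l)
    \<le> (\<integral>x. h x \<partial>PiM I (\<lambda>_. lborel))"
  using assms(1-4) CR(1) fgh
proof (induction I arbitrary: f g h C rule: finite_induct)
  case empty
  have "(\<integral>x. f x \<partial>PiM {} (\<lambda>_. lborel :: real measure)) = f (\<lambda>_. undefined)" for f :: "('i \<Rightarrow> real) \<Rightarrow> real"
    unfolding PiM_empty by (subst lebesgue_integral_count_space_finite) auto
  then show ?case
    using empty(5)[of "\<lambda>_. undefined" "\<lambda>_. undefined"] by (simp add: space_PiM restrict_def)
next
  case (insert i I)
  interpret product_sigma_finite "\<lambda>_. lborel :: real measure" ..
  let ?m = "\<lambda>f x. \<integral>t. f (x(i := t)) \<partial>(lborel :: real measure)"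
  have eq: "(\<integral>x. k x \<partial>PiM (insert i I) (\<lambda>_. lborel)) = (\<integral>x. ?m k x \<partial>PiM I (\<lambda>_. lborel))"
    if "box_supported (insert i I) C R k" for k :: "('i \<Rightarrow> real) \<Rightarrow> real"
    using insert(1,2) that insert.prems by (intro product_integral_insert box_supported_integrable) auto
  show ?case
    unfolding eq[OF insert.prems(1)] eq[OF insert.prems(2)] eq[OF insert.prems(3)]
  proof (rule insert.IH[where C="C * (2 * R)"])
    show "box_supported I (C * (2 * R)) R (?m f)" "box_supported I (C * (2 * R)) R (?m g)"
      "box_supported I (C * (2 * R)) R (?m h)"
      using insert.prems insert.hyps CR by (auto intro!: box_supported_marginal)
    show "0 \<le> C * (2 * R)" using insert.prems CR by simp
    fix x y assume x: "x \<in> space (PiM I (\<lambda>_. lborel :: real measure))" and y: "y \<in> space (PiM I (\<lambda>_. lborel :: real measure))"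
    let ?z = "\<lambda>i\<in>I. l * x i + (1 - l) * y i"
    have z: "?z \<in> space (PiM I (\<lambda>_. lborel :: real measure))"
      by (simp add: space_PiM)
    note s = box_supported_section[OF insert.prems(1) insert.hyps(2) x]
      box_supported_section[OF insert.prems(2) insert.hyps(2) y]
      box_supported_section[OF insert.prems(3) insert.hyps(2) z]
    show "?m f x powr l * ?m g y powr (1 - l) \<le> ?m h ?z"
    proof (rule prekopa_leindler_real[where C=C and R=R])
      fix s t
      have "f (x(i := s)) powr l * g (y(i := t)) powr (1 - l)
          \<le> h (\<lambda>j\<in>insert i I. l * (x(i := s)) j + (1 - l) * (y(i := t)) j)"
        by (rule insert.prems(5)[OF fun_upd_in_space_PiM_lborel[OF x, of i s] fun_upd_in_space_PiM_lborel[OF y, of i t]])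
      also have "(\<lambda>j\<in>insert i I. l * (x(i := s)) j + (1 - l) * (y(i := t)) j) = ?z(i := l * s + (1 - l) * t)"
        using insert.hyps by (auto simp: fun_eq_iff)
      finally show "f (x(i := s)) powr l * g (y(i := t)) powr (1 - l) \<le> h (?z(i := l * s + (1 - l) * t))" .
    qed (fact s l | (rule s(4) s(8) s(12), assumption))+
  qed
qed

section \<open>Anderson's inequality for boxes\<close>

text \<open>Centre and half-widths instead of corners, because the contraction moves only the
  centre. A half-width of zero or less gives the empty set.\<close>

definition cell :: "('n \<Rightarrow> real) \<Rightarrow> ('n \<Rightarrow> real) \<Rightarrow> (real ^ 'n) set" where
  "cell c r = {x. \<forall>i. \<bar>x $ i - c i\<bar> < r i}"

lemma cell_borel [measurable]: "cell c r \<in> sets borel"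
proof -
  have "cell c r = (\<Inter>i. {x. \<bar>x $ i - c i\<bar> < r i})"
    by (auto simp: cell_def)
  also have "\<dots> \<in> sets borel"
    by (intro borel_open open_INT ballI open_Collect_less continuous_intros) auto
  finally show ?thesis .
qed

lemma cell_coord_bound:
  fixes c r :: "'n::finite \<Rightarrow> real"
  assumes "x \<in> cell c r"
  shows "\<bar>x $ i\<bar> \<le> (\<Sum>i\<in>UNIV. \<bar>c i\<bar> + \<bar>r i\<bar>)"
proof -
  have "\<bar>x $ i\<bar> \<le> \<bar>c i\<bar> + \<bar>r i\<bar>"
    using assms by (auto simp: cell_def dest!: spec[of _ i])
  also have "\<dots> \<le> (\<Sum>i\<in>UNIV. \<bar>c i\<bar> + \<bar>r i\<bar>)"
    by (rule member_le_sum) auto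
  finally show ?thesis .
qed

lemma cell_bounded: "bounded (cell c r :: (real ^ 'a::finite) set)"
  unfolding bounded_iff
proof (intro exI ballI)
  fix x assume x: "x \<in> cell c r"
  have "norm x \<le> (\<Sum>j\<in>UNIV. \<bar>x $ j\<bar>)"
    by (rule norm_le_l1_cart)
  also have "\<dots> \<le> (\<Sum>j::'a\<in>UNIV. \<Sum>i\<in>UNIV. \<bar>c i\<bar> + \<bar>r i\<bar>)"
    by (intro sum_mono cell_coord_bound x)
  finally show "norm x \<le> (\<Sum>j::'a\<in>UNIV. \<Sum>i\<in>UNIV. \<bar>c i\<bar> + \<bar>r i\<bar>)" .
qed

lemma emeasure_cell_finite: "S \<subseteq> cell c r \<Longrightarrow> emeasure lborel S < \<infinity>"
  using bounded_subset[OF cell_bounded] by (intro emeasure_bounded_finite)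

text \<open>With \<open>l = (1 + s) / 2\<close> the centre s * c is the weighted mean of c and -c.
  By the symmetry of \<open>K\<close>, the boxes around c and -c meet \<open>K\<close> in reflected
  sets of equal volume, so Prekopa-Leindler for the three indicators bounds this common volume by
  the volume around s * c.\<close>

lemma anderson_cell:
  fixes K :: "(real ^ 'n) set"
  assumes K: "convex K" "K \<in> sets borel" and sym: "\<And>x. x \<in> K \<Longrightarrow> - x \<in> K"
    and s: "0 \<le> s" "s \<le> 1"
  shows "emeasure lborel (K \<inter> cell c r) \<le> emeasure lborel (K \<inter> cell (\<lambda>i. s * c i) r)"
proof (cases "s = 1")
  case False
  define l where "l = (1 + s) / 2"
  have l: "0 < l" "l < 1" "s = l - (1 - l)"
    using s False by (auto simp: l_def)
  define R where "R = (\<Sum>i\<in>UNIV. \<bar>c i\<bar> + \<bar>r i\<bar>)"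
  note K(2)[measurable]
  let ?f = "\<lambda>d x. indicator (K \<inter> cell d r) (vec_lambda x) :: real"
  let ?P = "PiM UNIV (\<lambda>_::'n. lborel :: real measure)"
  have supp: "box_supported UNIV 1 R (?f d)" if "\<And>i. \<bar>d i\<bar> \<le> \<bar>c i\<bar>" for d
  proof -
    have "(\<Sum>i\<in>UNIV. \<bar>d i\<bar> + \<bar>r i\<bar>) \<le> R"
      unfolding R_def using that by (intro sum_mono) auto
    then have "?f d x = 0" if "R < \<bar>x i\<bar>" for x i
      using that cell_coord_bound[of "vec_lambda x" d r i] by (auto split: split_indicator)
    then show ?thesis
      by (auto simp: box_supported_def)
  qed
  have int: "(\<integral>x. ?f d x \<partial>?P) = measure lborel (K \<inter> cell d r)" for d
  proof -
    have "measure lborel (K \<inter> cell d r) = (\<integral>x. indicator (K \<inter> cell d r) x \<partial>lborel)"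
      by simp
    also have "\<dots> = (\<integral>x. ?f d x \<partial>?P)"
      by (subst lborel_vec_eq_distr_PiM, subst integral_distr) auto
    finally show ?thesis by simp
  qed
  have "(\<integral>x. ?f c x \<partial>?P) powr l * (\<integral>x. ?f (\<lambda>i. - c i) x \<partial>?P) powr (1 - l) \<le> (\<integral>x. ?f (\<lambda>i. s * c i) x \<partial>?P)"
  proof (rule prekopa_leindler_PiM[where C=1 and R=R])
    show "box_supported UNIV 1 R (?f c)" "box_supported UNIV 1 R (?f (\<lambda>i. - c i))"
      by (auto intro!: supp)
    show "box_supported UNIV 1 R (?f (\<lambda>i. s * c i))"
      using s by (intro supp) (auto simp: abs_mult intro!: mult_left_le_one_le)
    show "0 \<le> R" by (auto simp: R_def intro!: sum_nonneg)
    fix x y :: "'n \<Rightarrow> real"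
    let ?z = "\<lambda>i\<in>UNIV. l * x i + (1 - l) * y i"
    show "?f c x powr l * ?f (\<lambda>i. - c i) y powr (1 - l) \<le> ?f (\<lambda>i. s * c i) ?z"
    proof (cases "vec_lambda x \<in> K \<inter> cell c r \<and> vec_lambda y \<in> K \<inter> cell (\<lambda>i. - c i) r")
      case True
      have "vec_lambda ?z = l *\<^sub>R vec_lambda x + (1 - l) *\<^sub>R vec_lambda y"
        by (simp add: vec_eq_iff)
      then have "vec_lambda ?z \<in> K"
        using True l K(1) by (auto intro!: convexD)
      moreover have "\<bar>?z i - s * c i\<bar> < r i" for i
      proof -
        have b: "\<bar>x i - c i\<bar> < r i" "\<bar>y i + c i\<bar> < r i"
          using True by (auto simp: cell_def)
        have "s * c i = l * c i - (1 - l) * c i"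
          using l(3) by (metis left_diff_distrib)
        then have "?z i - s * c i = l * (x i - c i) + (1 - l) * (y i + c i)"
          by (simp add: algebra_simps)
        also have "\<bar>\<dots>\<bar> \<le> l * \<bar>x i - c i\<bar> + (1 - l) * \<bar>y i + c i\<bar>"
          using l by (intro order_trans[OF abs_triangle_ineq]) (simp add: abs_mult)
        also have "\<dots> < l * r i + (1 - l) * r i"
          using l b by (intro add_strict_mono mult_strict_left_mono) auto
        finally show ?thesis by (simp add: algebra_simps)
      qed
      ultimately show ?thesis
        using True by (simp add: cell_def)
    next
      case False
      then show ?thesis by (auto simp: indicator_def)
    qed
  qed (use l in auto)
  moreover have "measure lborel (K \<inter> cell (\<lambda>i. - c i) r) = measure lborel (K \<inter> cell c r)"
  proof -
    have *: "K \<inter> cell (\<lambda>i. - c i) r = uminus ` (K \<inter> cell c r)"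
    proof safe
      fix x assume x: "x \<in> K" "x \<in> cell (\<lambda>i. - c i) r"
      have "\<bar>- x $ i - c i\<bar> = \<bar>x $ i + c i\<bar>" for i
        by linarith
      then have "- x \<in> K \<inter> cell c r"
        using sym[OF x(1)] x(2) by (simp add: cell_def)
      then show "x \<in> uminus ` (K \<inter> cell c r)"
        by (metis add.inverse_inverse image_eqI)
    next
      fix x assume x: "x \<in> cell c r"
      have "\<bar>- x $ i + c i\<bar> = \<bar>x $ i - c i\<bar>" for i
        by linarith
      then show "- x \<in> cell (\<lambda>i. - c i) r"
        using x by (simp add: cell_def)
    qed (use sym in auto)
    have "measure lborel (K \<inter> cell (\<lambda>i. - c i) r) = measure lebesgue (K \<inter> cell (\<lambda>i. - c i) r)"
      by simp
    also have "\<dots> = measure lebesgue ((\<lambda>x. (-1) *\<^sub>R x + 0) ` (K \<inter> cell c r))"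
      unfolding * by simp
    also have "\<dots> = \<bar>-1\<bar> ^ DIM(real ^ 'n) * measure lebesgue (K \<inter> cell c r)"
      by (rule measure_lebesgue_affine)
    finally show ?thesis
      by simp
  qed
  ultimately have "measure lborel (K \<inter> cell c r) \<le> measure lborel (K \<inter> cell (\<lambda>i. s * c i) r)"
    unfolding int by (simp flip: powr_add)
  then show ?thesis
    using emeasure_cell_finite[of "K \<inter> cell c r" c r] emeasure_cell_finite[of "K \<inter> cell (\<lambda>i. s * c i) r" "\<lambda>i. s * c i" r]
    by (simp add: emeasure_eq_ennreal_measure less_top[symmetric])
qed simp

section \<open>The rearrangement inequality for unions of intervals\<close>

text \<open>A pair holds the centre and the half-width of an open interval. The inequality makes the
  intervals disjoint but lets them touch.\<close>

definition separated :: "(real \<times> real) set \<Rightarrow> bool" where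
  "separated A \<longleftrightarrow> finite A \<and> (\<forall>a\<in>A. 0 < snd a) \<and>
     (\<forall>a\<in>A. \<forall>b\<in>A. a \<noteq> b \<longrightarrow> snd a + snd b \<le> \<bar>fst a - fst b\<bar>)"

text \<open>For disjoint intervals this is the volume of the points of \<open>K\<close> whose i-th
  coordinate lies in the union of the intervals in \<open>L i\<close>. It is written as a sum over
  one choice of interval per coordinate, so that Anderson's inequality applies to each
  summand.\<close>

definition intervals_mass :: "(real ^ 'n) set \<Rightarrow> ('n::finite \<Rightarrow> (real \<times> real) set) \<Rightarrow> ennreal" where
  "intervals_mass K L = (\<Sum>g\<in>Pi\<^sub>E UNIV L. emeasure lborel (K \<inter> cell (\<lambda>i. fst (g i)) (\<lambda>i. snd (g i))))"

text \<open>In this form the intervals of one coordinate occur in one factor only, which is what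
  merging two of them needs.\<close>

lemma intervals_mass_eq_integral:
  fixes K :: "(real ^ 'n) set"
  assumes [measurable]: "K \<in> sets borel" and fin: "\<And>i. finite (L i)"
  shows "intervals_mass K L = (\<integral>\<^sup>+x. indicator K x *
    (\<Prod>i\<in>UNIV. \<Sum>a\<in>L i. indicator {t. \<bar>t - fst a\<bar> < snd a} (x $ i)) \<partial>lborel)"
proof -
  have ind: "indicator K x * (\<Prod>i\<in>UNIV. indicator {t. \<bar>t - fst (g i)\<bar> < snd (g i)} (x $ i))
     = (indicator (K \<inter> cell (\<lambda>i. fst (g i)) (\<lambda>i. snd (g i))) x :: ennreal)" for x :: "real ^ 'n" and g
  proof (cases "x \<in> cell (\<lambda>i. fst (g i)) (\<lambda>i. snd (g i))")
    case True
    then show ?thesis by (simp add: cell_def indicator_def)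
  next
    case False
    then obtain i where "\<not> \<bar>x $ i - fst (g i)\<bar> < snd (g i)"
      by (auto simp: cell_def)
    then have "(\<Prod>i\<in>UNIV. indicator {t. \<bar>t - fst (g i)\<bar> < snd (g i)} (x $ i) :: ennreal) = 0"
      by (intro prod_zero bexI[of _ i]) auto
    then show ?thesis using False by simp
  qed
  have "intervals_mass K L = (\<Sum>g\<in>Pi\<^sub>E UNIV L. \<integral>\<^sup>+x. indicator (K \<inter> cell (\<lambda>i. fst (g i)) (\<lambda>i. snd (g i))) x \<partial>lborel)"
    by (simp add: intervals_mass_def)
  also have "\<dots> = (\<integral>\<^sup>+x. (\<Sum>g\<in>Pi\<^sub>E UNIV L. indicator (K \<inter> cell (\<lambda>i. fst (g i)) (\<lambda>i. snd (g i))) x) \<partial>lborel)"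
    by (rule nn_integral_sum[symmetric]) measurable
  also have "\<dots> = (\<integral>\<^sup>+x. indicator K x *
    (\<Prod>i\<in>UNIV. \<Sum>a\<in>L i. indicator {t. \<bar>t - fst a\<bar> < snd a} (x $ i)) \<partial>lborel)"
    using fin by (subst prod_sum_PiE) (auto simp: sum_distrib_left ind)
  finally show ?thesis .
qed

lemma sum_PiE_image:
  fixes h :: "'b \<Rightarrow> 'c" and L :: "'i::finite \<Rightarrow> 'b set"
  assumes "inj h"
  shows "(\<Sum>g\<in>Pi\<^sub>E UNIV (\<lambda>i. h ` L i). F g) = (\<Sum>g\<in>Pi\<^sub>E UNIV L. F (\<lambda>i. h (g i)))"
proof -
  have inj: "inj_on (\<lambda>g i. h (g i)) (Pi\<^sub>E UNIV L)"
    using assms by (auto simp: inj_on_def fun_eq_iff)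
  have "Pi\<^sub>E UNIV (\<lambda>i. h ` L i) = (\<lambda>g i. h (g i)) ` Pi\<^sub>E UNIV L"
  proof (intro equalityI subsetI)
    fix g assume "g \<in> Pi\<^sub>E UNIV (\<lambda>i. h ` L i)"
    then have "\<forall>i. \<exists>a\<in>L i. g i = h a"
      by (auto simp: PiE_iff)
    then obtain g' where "\<forall>i. g' i \<in> L i \<and> g i = h (g' i)"
      by metis
    then show "g \<in> (\<lambda>g i. h (g i)) ` Pi\<^sub>E UNIV L"
      by (intro image_eqI[of _ _ g']) auto
  qed auto
  then show ?thesis
    by (simp add: sum.reindex[OF inj])
qed

text \<open>One factor for all coordinates moves the centre of every cell along its ray to the
  origin, which is the situation of \<open>anderson_cell\<close>; the half-widths stay.
  \<open>0 < s\<close> keeps different intervals different, so no summand is lost.\<close>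

lemma intervals_mass_scale:
  fixes K :: "(real ^ 'n) set"
  assumes K: "convex K" "K \<in> sets borel" "\<And>x. x \<in> K \<Longrightarrow> - x \<in> K"
    and s: "0 < s" "s \<le> 1"
  shows "intervals_mass K L \<le> intervals_mass K (\<lambda>i. (\<lambda>a. (s * fst a, snd a)) ` L i)"
proof -
  have inj: "inj (\<lambda>a. (s * fst a, snd a :: real))"
    using s by (auto simp: inj_on_def prod_eq_iff)
  show ?thesis
    unfolding intervals_mass_def sum_PiE_image[OF inj] fst_conv snd_conv
    using s by (intro sum_mono anderson_cell K) auto
qed

text \<open>Two touching open intervals lie in the merged interval, which has only their common
  endpoint in addition, so the factor of coordinate \<open>j\<close> grows pointwise.\<close>

lemma intervals_mass_merge:
  fixes K :: "(real ^ 'n) set"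
  assumes K: "K \<in> sets borel" and fin: "\<And>i. finite (L i)"
    and ab: "a \<in> L j" "b \<in> L j" "a \<noteq> b" "fst b - fst a = snd a + snd b"
    and pos: "0 < snd a" "0 < snd b"
    and m: "m = ((fst a - snd a + fst b + snd b) / 2, snd a + snd b)" "m \<notin> L j"
  shows "intervals_mass K L \<le> intervals_mass K (L(j := insert m (L j - {a, b})))"
proof -
  let ?b = "\<lambda>a t. indicator {t. \<bar>t - fst a\<bar> < snd a} t :: ennreal"
  have le: "(\<Sum>c\<in>L i. ?b c t) \<le> (\<Sum>c\<in>(L(j := insert m (L j - {a, b}))) i. ?b c t)" for i t
  proof (cases "i = j")
    case True
    have "(\<Sum>c\<in>L j. ?b c t) = ?b a t + (?b b t + (\<Sum>c\<in>L j - {a, b}. ?b c t))"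
      using ab fin[of j] by (simp add: sum.remove[of _ a] sum.remove[of _ b] Diff_insert2[symmetric] insert_commute)
    also have "\<dots> \<le> ?b m t + (\<Sum>c\<in>L j - {a, b}. ?b c t)"
    proof -
      have "?b a t + ?b b t \<le> ?b m t"
        using ab pos by (auto simp: m indicator_def field_simps abs_if split: if_splits)
      then show ?thesis
        by (simp add: add.assoc[symmetric] add_right_mono)
    qed
    also have "\<dots> = (\<Sum>c\<in>insert m (L j - {a, b}). ?b c t)"
      using m(2) fin[of j] by (subst sum.insert) auto
    finally show ?thesis using True by simp
  qed simp
  have "intervals_mass K L = (\<integral>\<^sup>+x. indicator K x * (\<Prod>i\<in>UNIV. \<Sum>c\<in>L i. ?b c (x $ i)) \<partial>lborel)"
    using K fin by (rule intervals_mass_eq_integral)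
  also have "\<dots> \<le> (\<integral>\<^sup>+x. indicator K x * (\<Prod>i\<in>UNIV. \<Sum>c\<in>(L(j := insert m (L j - {a, b}))) i. ?b c (x $ i)) \<partial>lborel)"
    by (intro nn_integral_mono mult_left_mono prod_mono_ennreal le) auto
  also have "\<dots> = intervals_mass K (L(j := insert m (L j - {a, b})))"
    using K fin by (intro intervals_mass_eq_integral[symmetric]) auto
  finally show ?thesis .
qed

lemma separated_scale:
  assumes "separated A" "0 < s" and "\<And>a b. a \<in> A \<Longrightarrow> b \<in> A \<Longrightarrow> a \<noteq> b \<Longrightarrow> snd a + snd b \<le> s * \<bar>fst a - fst b\<bar>"
  shows "separated ((\<lambda>a. (s * fst a, snd a)) ` A)"
  unfolding separated_def
proof (intro conjI ballI impI)
  fix x y assume "x \<in> (\<lambda>a. (s * fst a, snd a)) ` A" "y \<in> (\<lambda>a. (s * fst a, snd a)) ` A" "x \<noteq> y"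
  then obtain a b where ab: "a \<in> A" "b \<in> A" "a \<noteq> b" "x = (s * fst a, snd a)" "y = (s * fst b, snd b)"
    by auto
  have "\<bar>s * fst a - s * fst b\<bar> = s * \<bar>fst a - fst b\<bar>"
    using assms(2) by (simp flip: right_diff_distrib add: abs_mult)
  then show "snd x + snd y \<le> \<bar>fst x - fst y\<bar>"
    using assms(3)[OF ab(1-3)] ab by simp
qed (use assms in \<open>auto simp: separated_def\<close>)

text \<open>The total half-width is the invariant of the contraction argument, the number of
  intervals its termination measure.\<close>

lemma separated_merge:
  assumes A: "separated A" and ab: "a \<in> A" "b \<in> A" "a \<noteq> b" "fst b - fst a = snd a + snd b"
    and m: "m = ((fst a - snd a + fst b + snd b) / 2, snd a + snd b)"
  shows "m \<notin> A" "separated (insert m (A - {a, b}))"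
    "(\<Sum>c\<in>insert m (A - {a, b}). snd c) = (\<Sum>c\<in>A. snd c)"
    "card (insert m (A - {a, b})) < card A"
proof -
  have fin: "finite A" using A by (simp add: separated_def)
  have pos: "0 < snd c" if "c \<in> A" for c
    using A that by (auto simp: separated_def)
  have m': "fst m = (fst a - snd a + fst b + snd b) / 2" "snd m = snd a + snd b"
    using m by auto
  have gap: "snd c + snd m \<le> \<bar>fst c - fst m\<bar>" if c: "c \<in> A" "c \<noteq> a" "c \<noteq> b" for c
  proof -
    have 1: "snd c + snd a \<le> \<bar>fst c - fst a\<bar>" "snd c + snd b \<le> \<bar>fst c - fst b\<bar>"
      using A c ab by (auto simp: separated_def)
    show ?thesis
      using 1 pos[OF c(1)] pos[OF ab(1)] pos[OF ab(2)] ab(4) m' by (simp add: abs_if split: if_splits; linarith)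
  qed
  show mA: "m \<notin> A"
  proof
    assume "m \<in> A"
    moreover have "m \<noteq> a" "m \<noteq> b"
      using m' pos[OF ab(1)] pos[OF ab(2)] by auto
    ultimately show False
      using gap[of m] pos[of m] by auto
  qed
  show "separated (insert m (A - {a, b}))"
  proof -
    have "0 < snd m" using pos[OF ab(1)] pos[OF ab(2)] m' by simp
    moreover have "snd m + snd c \<le> \<bar>fst m - fst c\<bar>" if "c \<in> A" "c \<noteq> a" "c \<noteq> b" for c
      using gap[OF that] by (simp add: add.commute abs_minus_commute)
    ultimately show ?thesis
      using A gap unfolding separated_def by blast
  qed
  have "(\<Sum>c\<in>A. snd c) = snd a + (snd b + (\<Sum>c\<in>A - {a, b}. snd c))"
    using ab fin by (simp add: sum.remove[of _ a] sum.remove[of _ b] Diff_insert2[symmetric] insert_commute)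
  then show "(\<Sum>c\<in>insert m (A - {a, b}). snd c) = (\<Sum>c\<in>A. snd c)"
    using mA fin m' by (subst sum.insert) auto
  have "card (A - {a, b}) = card A - 2"
    using ab fin by (subst card_Diff_subset) auto
  moreover have "2 \<le> card A"
    using ab fin card_mono[of A "{a, b}"] by auto
  ultimately show "card (insert m (A - {a, b})) < card A"
    using mA fin by simp
qed

text \<open>The contraction argument of Brascamp, Lieb and Luttinger: all centres are scaled towards the origin at
  the same relative speed until two intervals of the same coordinate touch; these are then merged.\<close>

lemma intervals_mass_le_centered:
  fixes K :: "(real ^ 'n) set"
  assumes K: "convex K" "K \<in> sets borel" "\<And>x. x \<in> K \<Longrightarrow> - x \<in> K"
    and "\<And>i. separated (L i)"
  shows "intervals_mass K L \<le> emeasure lborel (K \<inter> cell (\<lambda>_. 0) (\<lambda>i. \<Sum>a\<in>L i. snd a))"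
  using assms(4)
proof (induction "\<Sum>i\<in>UNIV. card (L i)" arbitrary: L rule: less_induct)
  case less
  have fin: "finite (L i)" for i
    using less.prems by (simp add: separated_def)
  define T where "T = {(a, b). a \<noteq> b \<and> (\<exists>i. a \<in> L i \<and> b \<in> L i)}"
  have "T \<subseteq> (\<Union>i. L i) \<times> (\<Union>i. L i)"
    by (auto simp: T_def)
  then have "finite T"
    using fin finite_subset by (metis finite_SigmaI finite_UN finite_class.finite_UNIV)
  have T: "0 < snd a" "0 < snd b" "snd a + snd b \<le> \<bar>fst a - fst b\<bar>" if "(a, b) \<in> T" for a b
    using that less.prems by (auto simp: T_def separated_def)
  show ?case
  proof (cases "T = {}")
    case True
    show ?thesis
    proof (cases "\<exists>i. L i = {}")
      case True
      then have "Pi\<^sub>E UNIV L = {}" by (auto simp: PiE_eq_empty_iff)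
      then show ?thesis by (simp add: intervals_mass_def)
    next
      case False
      then have "\<forall>i. \<exists>a. a \<in> L i"
        by blast
      then obtain g where gL: "\<And>i. g i \<in> L i"
        by metis
      have "a = b" if "a \<in> L i" "b \<in> L i" for a b i
      proof -
        have "(a, b) \<notin> T" using True by simp
        then show ?thesis using that by (auto simp: T_def)
      qed
      then have g: "L i = {g i}" for i
        using gL by blast
      then have "Pi\<^sub>E UNIV L = {g}"
        by (auto simp: PiE_iff fun_eq_iff)
      then have "intervals_mass K L = emeasure lborel (K \<inter> cell (\<lambda>i. fst (g i)) (\<lambda>i. snd (g i)))"
        by (simp add: intervals_mass_def)
      \<comment> \<open>With at most one interval per coordinate no collision is possible, so the
        contraction runs down to scale 0.\<close>
      also have "\<dots> \<le> emeasure lborel (K \<inter> cell (\<lambda>i. 0 * fst (g i)) (\<lambda>i. snd (g i)))"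
        by (intro anderson_cell K) auto
      finally show ?thesis by (simp add: g)
    qed
  next
    case False
    \<comment> \<open>\<open>q (a, b)\<close> is the scale at which the intervals \<open>a\<close>
      and \<open>b\<close> touch. The largest of these values is the first contact when the scale
      falls from 1.\<close>
    define q where "q = (\<lambda>(a, b). (snd a + snd b) / \<bar>fst a - fst b\<bar> :: real)"
    define s where "s = Max (q ` T)"
    have "s \<in> q ` T"
      using False \<open>finite T\<close> by (simp add: s_def)
    then obtain a b where ab: "(a, b) \<in> T" "s = q (a, b)"
      by auto
    have s: "0 < s" "s \<le> 1"
      using T[OF ab(1)] ab(2) by (auto simp: q_def)
    have sT: "snd x + snd y \<le> s * \<bar>fst x - fst y\<bar>" if "(x, y) \<in> T" for x y
    proof -
      have "q (x, y) \<le> s"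
        using that \<open>finite T\<close> by (auto simp: s_def)
      then show ?thesis
        using T[OF that] by (simp add: q_def divide_le_eq split: if_splits)
    qed
    have touch: "snd a + snd b = s * \<bar>fst a - fst b\<bar>"
      using T[OF ab(1)] ab(2) by (simp add: q_def)
    obtain j where j: "a \<in> L j" "b \<in> L j" "a \<noteq> b"
      using ab by (auto simp: T_def)
    let ?h = "\<lambda>a. (s * fst a, snd a)"
    define L' where "L' = (\<lambda>i. ?h ` L i)"
    have sep': "separated (L' i)" for i
      unfolding L'_def
    proof (rule separated_scale[OF less.prems s(1)])
      fix x y assume "x \<in> L i" "y \<in> L i" "x \<noteq> y"
      then have "(x, y) \<in> T" unfolding T_def by blast
      then show "snd x + snd y \<le> s * \<bar>fst x - fst y\<bar>" by (rule sT)
    qed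
    have fin': "finite (L' i)" for i
      using sep' by (simp add: separated_def)
    have inj: "inj_on ?h (L i)" for i
      using s by (auto simp: inj_on_def prod_eq_iff)
    have "\<exists>a b. a \<in> L' j \<and> b \<in> L' j \<and> a \<noteq> b \<and> fst b - fst a = snd a + snd b"
    proof (cases "fst a \<le> fst b")
      case True
      then have "fst (?h b) - fst (?h a) = snd (?h a) + snd (?h b)"
        using touch s by (simp add: algebra_simps)
      then show ?thesis
        using j inj[of j] by (intro exI[of _ "?h a"] exI[of _ "?h b"]) (auto simp: L'_def dest: inj_onD)
    next
      case False
      then have "fst (?h a) - fst (?h b) = snd (?h b) + snd (?h a)"
        using touch s by (simp add: algebra_simps)
      then show ?thesis
        using j inj[of j] by (intro exI[of _ "?h b"] exI[of _ "?h a"]) (auto simp: L'_def dest: inj_onD)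
    qed
    then obtain a' b' where ab': "a' \<in> L' j" "b' \<in> L' j" "a' \<noteq> b'" "fst b' - fst a' = snd a' + snd b'"
      by blast
    define m where "m = ((fst a' - snd a' + fst b' + snd b') / 2, snd a' + snd b')"
    note merge = separated_merge[OF sep' ab' m_def]
    define L'' where "L'' = L'(j := insert m (L' j - {a', b'}))"
    have "intervals_mass K L \<le> intervals_mass K L'"
      unfolding L'_def using K s by (rule intervals_mass_scale)
    also have "\<dots> \<le> intervals_mass K L''"
      unfolding L''_def using sep' ab'
      by (intro intervals_mass_merge K fin' ab' m_def merge(1)) (auto simp: separated_def)
    also have "\<dots> \<le> emeasure lborel (K \<inter> cell (\<lambda>_. 0) (\<lambda>i. \<Sum>a\<in>L'' i. snd a))"
    proof (rule less.hyps)
      have "(\<Sum>i\<in>UNIV. card (L'' i)) < (\<Sum>i\<in>UNIV. card (L' i))"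
        by (rule sum_strict_mono_ex1) (use merge(4) in \<open>auto simp: L''_def less_imp_le\<close>)
      also have "\<dots> = (\<Sum>i\<in>UNIV. card (L i))"
        by (simp add: L'_def card_image[OF inj])
      finally show "(\<Sum>i\<in>UNIV. card (L'' i)) < (\<Sum>i\<in>UNIV. card (L i))" .
      show "separated (L'' i)" for i
        using sep' merge(2) by (simp add: L''_def)
    qed
    also have "(\<lambda>i. \<Sum>a\<in>L'' i. snd a) = (\<lambda>i. \<Sum>a\<in>L i. snd a)"
    proof
      fix i
      have "(\<Sum>a\<in>L'' i. snd a) = (\<Sum>a\<in>L' i. snd a)"
        using merge(3) by (simp add: L''_def)
      also have "\<dots> = (\<Sum>a\<in>L i. snd a)"
        unfolding L'_def by (simp add: sum.reindex[OF inj])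
      finally show "(\<Sum>a\<in>L'' i. snd a) = (\<Sum>a\<in>L i. snd a)" .
    qed
    finally show ?thesis .
  qed
qed

section \<open>Comparison of a product density with the cube\<close>

lemma seminorm_nonneg: "is_seminorm p \<Longrightarrow> 0 \<le> p x"
proof -
  assume p: "is_seminorm p"
  have "p (x + (-1) *\<^sub>R x) \<le> p x + p ((-1) *\<^sub>R x)" "p ((-1) *\<^sub>R x) = \<bar>-1\<bar> * p x" "p (0 *\<^sub>R x) = \<bar>0\<bar> * p x"
    using p unfolding is_seminorm_def by blast+
  then show ?thesis by simp
qed

lemma seminorm_minus: "is_seminorm p \<Longrightarrow> p (- x) = p x"
proof -
  assume p: "is_seminorm p"
  have "p ((-1) *\<^sub>R x) = \<bar>-1\<bar> * p x"
    using p unfolding is_seminorm_def by blast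
  then show ?thesis by simp
qed

lemma seminorm_sum:
  assumes "is_seminorm p"
  shows "p (\<Sum>i\<in>A. g i) \<le> (\<Sum>i\<in>A. p (g i))"
proof (induction A rule: infinite_finite_induct)
  case (insert x F)
  have "p (g x + sum g F) \<le> p (g x) + p (sum g F)"
    using assms by (simp add: is_seminorm_def)
  then show ?case using insert by simp
next
  case empty
  have "p (0 *\<^sub>R 0) = \<bar>0\<bar> * p 0" using assms unfolding is_seminorm_def by blast
  then show ?case by simp
next
  case (infinite A)
  have "p (0 *\<^sub>R 0) = \<bar>0\<bar> * p 0" using assms unfolding is_seminorm_def by blast
  then show ?case using infinite by simp
qed

text \<open>Controls the error of replacing a point by a nearby grid point, and also gives the
  Lipschitz continuity of a semi-norm.\<close>

lemma seminorm_coordinate_bound: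
  fixes p :: "real ^ 'n \<Rightarrow> real"
  assumes p: "is_seminorm p" and d: "\<And>i. \<bar>x $ i - y $ i\<bar> \<le> d"
  shows "p x \<le> p y + d * (\<Sum>i\<in>UNIV. p (axis i 1))"
proof -
  have "p x = p (y + (x - y))" by simp
  also have "\<dots> \<le> p y + p (x - y)"
    using p unfolding is_seminorm_def by blast
  also have "x - y = (\<Sum>i\<in>UNIV. (x - y) $ i *\<^sub>R axis i 1)"
    using basis_expansion[of "x - y"] by (simp add: scalar_mult_eq_scaleR)
  also have "p \<dots> \<le> (\<Sum>i\<in>UNIV. p ((x - y) $ i *\<^sub>R axis i 1))"
    by (rule seminorm_sum[OF p])
  also have "\<dots> \<le> (\<Sum>i\<in>UNIV. d * p (axis i 1))"
  proof (rule sum_mono)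
    fix i
    have "p ((x - y) $ i *\<^sub>R axis i 1) = \<bar>x $ i - y $ i\<bar> * p (axis i 1)"
      using p by (simp add: is_seminorm_def)
    also have "\<dots> \<le> d * p (axis i 1)"
      using d seminorm_nonneg[OF p] by (intro mult_right_mono) auto
    finally show "p ((x - y) $ i *\<^sub>R axis i 1) \<le> d * p (axis i 1)" .
  qed
  also have "\<dots> = d * (\<Sum>i\<in>UNIV. p (axis i 1))"
    by (simp add: sum_distrib_left)
  finally show ?thesis by simp
qed

lemma seminorm_continuous:
  fixes p :: "real ^ 'n \<Rightarrow> real"
  assumes p: "is_seminorm p"
  shows "continuous_on UNIV p"
proof -
  define B where "B = (\<Sum>i\<in>UNIV. p (axis i 1))"
  have B: "0 \<le> B" using seminorm_nonneg[OF p] by (auto simp: B_def intro: sum_nonneg)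
  have le: "p x \<le> p y + B * dist x y" for x y
  proof -
    have "\<bar>x $ i - y $ i\<bar> \<le> dist x y" for i
      using component_le_norm_cart[of "x - y" i] by (simp add: dist_norm)
    from seminorm_coordinate_bound[OF p this] show ?thesis
      by (simp add: B_def mult.commute)
  qed
  have "B-lipschitz_on UNIV p"
  proof (intro lipschitz_onI B)
    fix x y show "dist (p x) (p y) \<le> B * dist x y"
      using le[of x y] le[of y x] by (simp add: dist_real_def abs_le_iff dist_commute)
  qed
  then show ?thesis
    by (rule lipschitz_on_continuous_on)
qed

lemma seminorm_borel:
  fixes p :: "real ^ 'n \<Rightarrow> real"
  shows "is_seminorm p \<Longrightarrow> p \<in> borel_measurable borel"
  by (intro borel_measurable_continuous_onI seminorm_continuous)

lemma seminorm_sublevel_convex: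
  assumes p: "is_seminorm p"
  shows "convex {x. p x \<le> e}"
proof (rule convexI)
  fix x y u v assume *: "x \<in> {x. p x \<le> e}" "y \<in> {x. p x \<le> e}" "0 \<le> u" "0 \<le> v" "u + v = (1::real)"
  have "p (u *\<^sub>R x + v *\<^sub>R y) \<le> p (u *\<^sub>R x) + p (v *\<^sub>R y)"
    using p unfolding is_seminorm_def by blast
  also have "\<dots> = u * p x + v * p y"
    using p * by (simp add: is_seminorm_def)
  also have "\<dots> \<le> u * e + v * e"
    using * by (intro add_mono mult_left_mono) auto
  also have "\<dots> = e"
    using * by (simp flip: distrib_right)
  finally show "u *\<^sub>R x + v *\<^sub>R y \<in> {x. p x \<le> e}" by simp
qed

section \<open>The bathtub principle\<close>

lemma top_subset_exists:
  fixes w :: "'k \<Rightarrow> real"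
  assumes "finite T" "m \<le> card T"
  shows "\<exists>S\<subseteq>T. card S = m \<and> (\<forall>x\<in>S. \<forall>y\<in>T - S. w y \<le> w x)"
  using assms(2)
proof (induction m)
  case (Suc m)
  then obtain S where S: "S \<subseteq> T" "card S = m" "\<forall>x\<in>S. \<forall>y\<in>T - S. w y \<le> w x" by auto
  have "T - S \<noteq> {}"
    using S Suc.prems by (metis Diff_eq_empty_iff Suc_n_not_le_n subset_antisym)
  moreover have "finite (T - S)" using assms by simp
  ultimately have "Max (w ` (T - S)) \<in> w ` (T - S)" "\<forall>y\<in>T - S. w y \<le> Max (w ` (T - S))"
    by auto
  then obtain z where z: "z \<in> T - S" "\<forall>y\<in>T - S. w y \<le> w z"
    by auto
  have "finite S" using S assms finite_subset by blast
  then show ?case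
    using S z by (intro exI[of _ "insert z S"]) auto
qed (intro exI[of _ "{}"], auto)

text \<open>The best choice fills the m largest weights up to the cap c. With \<theta> the smallest
  of these, each unit of mass outside \<open>S\<close> is worth at most \<theta> and each unit of
  room left inside \<open>S\<close> at least \<theta>. By the bound on the total, the room is at
  least the mass outside.\<close>

lemma bathtub_finite:
  fixes v w :: "'k \<Rightarrow> real"
  assumes T: "finite T" and v: "\<And>k. k \<in> T \<Longrightarrow> 0 \<le> v k" "\<And>k. k \<in> T \<Longrightarrow> v k \<le> c"
    and sum: "(\<Sum>k\<in>T. v k) \<le> c * real m" and m: "0 < m"
    and w: "\<And>k. k \<in> T \<Longrightarrow> 0 \<le> w k"
  shows "\<exists>S\<subseteq>T. card S \<le> m \<and> (\<Sum>k\<in>T. v k * w k) \<le> c * (\<Sum>k\<in>S. w k)"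
proof (cases "card T \<le> m")
  case True
  have "(\<Sum>k\<in>T. v k * w k) \<le> c * (\<Sum>k\<in>T. w k)"
    unfolding sum_distrib_left using v w by (intro sum_mono mult_right_mono) auto
  then show ?thesis using True by auto
next
  case False
  then obtain S where S: "S \<subseteq> T" "card S = m" "\<forall>x\<in>S. \<forall>y\<in>T - S. w y \<le> w x"
    using top_subset_exists[OF T, of m] by auto
  have fin: "finite S" using S T finite_subset by blast
  have ne: "S \<noteq> {}" using S m by auto
  define \<theta> where "\<theta> = Min (w ` S)"
  have "\<theta> \<in> w ` S" using fin ne by (simp add: \<theta>_def)
  then have \<theta>: "0 \<le> \<theta>" "\<And>x. x \<in> S \<Longrightarrow> \<theta> \<le> w x" "\<And>y. y \<in> T - S \<Longrightarrow> w y \<le> \<theta>"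
    using S w fin by (auto simp: \<theta>_def)
  have split: "(\<Sum>k\<in>T. g k) = (\<Sum>k\<in>S. g k) + (\<Sum>k\<in>T - S. g k)" for g :: "'k \<Rightarrow> real"
    using S T by (metis add.commute sum.subset_diff)
  have "(\<Sum>k\<in>T. v k * w k) = (\<Sum>k\<in>S. v k * w k) + (\<Sum>k\<in>T - S. v k * w k)"
    by (rule split)
  also have "(\<Sum>k\<in>T - S. v k * w k) \<le> (\<Sum>k\<in>T - S. v k * \<theta>)"
    using \<theta> v by (intro sum_mono mult_left_mono) auto
  also have "\<dots> = (\<Sum>k\<in>T - S. v k) * \<theta>"
    by (simp add: sum_distrib_right)
  also have "\<dots> \<le> (c * real m - (\<Sum>k\<in>S. v k)) * \<theta>"
    using sum \<theta>(1) unfolding split[of v] by (intro mult_right_mono) auto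
  also have "c * real m - (\<Sum>k\<in>S. v k) = (\<Sum>k\<in>S. c - v k)"
    by (simp add: S(2) sum_subtractf mult.commute)
  also have "\<dots> * \<theta> = (\<Sum>k\<in>S. (c - v k) * \<theta>)"
    by (rule sum_distrib_right)
  also have "\<dots> \<le> (\<Sum>k\<in>S. (c - v k) * w k)"
    using \<theta> v S by (intro sum_mono mult_left_mono) auto
  also have "(\<Sum>k\<in>S. v k * w k) + (\<Sum>k\<in>S. (c - v k) * w k) = c * (\<Sum>k\<in>S. w k)"
    by (simp add: sum.distrib[symmetric] sum_distrib_left algebra_simps)
  finally show ?thesis using S by auto
qed

text \<open>With the other coordinates frozen, the sum is linear in the vector of coordinate
  \<open>j\<close>, and its nonnegative weights do not depend on that vector: this is the setting of
  \<open>bathtub_finite\<close>.\<close>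

lemma multilinear_sum_section:
  fixes v :: "'i::finite \<Rightarrow> 'k \<Rightarrow> real" and W :: "('i \<Rightarrow> 'k) \<Rightarrow> real"
  assumes T: "finite T" and v: "\<forall>i. \<forall>k\<in>T. 0 \<le> v i k" and W: "\<And>a. 0 \<le> W a"
  shows "\<exists>w. (\<forall>k\<in>T. 0 \<le> w k) \<and>
    (\<forall>u. (\<Sum>a\<in>Pi\<^sub>E UNIV (\<lambda>_. T). (\<Prod>i\<in>UNIV. (v(j := u)) i (a i)) * W a) = (\<Sum>k\<in>T. u k * w k))"
proof -
  let ?A = "Pi\<^sub>E UNIV (\<lambda>_::'i. T)"
  define w where "w k = (\<Sum>a\<in>{a\<in>?A. a j = k}. (\<Prod>i\<in>UNIV - {j}. v i (a i)) * W a)" for k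
  have fin: "finite ?A" using T by (simp add: finite_PiE)
  have nonneg: "0 \<le> w k" if "k \<in> T" for k
    unfolding w_def using v W by (intro sum_nonneg mult_nonneg_nonneg prod_nonneg) (auto simp: PiE_iff)
  have "(\<Sum>a\<in>?A. (\<Prod>i\<in>UNIV. (v(j := u)) i (a i)) * W a) = (\<Sum>k\<in>T. u k * w k)" for u :: "'k \<Rightarrow> real"
  proof -
    have "(\<Sum>a\<in>?A. (\<Prod>i\<in>UNIV. (v(j := u)) i (a i)) * W a)
        = (\<Sum>a\<in>?A. u (a j) * ((\<Prod>i\<in>UNIV - {j}. v i (a i)) * W a))"
    proof (rule sum.cong[OF refl])
      fix a :: "'i \<Rightarrow> 'k"
      have "(\<Prod>i\<in>UNIV. (v(j := u)) i (a i)) = u (a j) * (\<Prod>i\<in>UNIV - {j}. (v(j := u)) i (a i))"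
        by (subst prod.remove[of _ j]) auto
      also have "(\<Prod>i\<in>UNIV - {j}. (v(j := u)) i (a i)) = (\<Prod>i\<in>UNIV - {j}. v i (a i))"
        by (intro prod.cong) auto
      finally show "(\<Prod>i\<in>UNIV. (v(j := u)) i (a i)) * W a = u (a j) * ((\<Prod>i\<in>UNIV - {j}. v i (a i)) * W a)"
        by simp
    qed
    also have "\<dots> = (\<Sum>k\<in>T. \<Sum>a\<in>{a\<in>?A. a j = k}. u (a j) * ((\<Prod>i\<in>UNIV - {j}. v i (a i)) * W a))"
      by (rule sum.group[symmetric]) (use T fin in \<open>auto simp: PiE_iff\<close>)
    also have "\<dots> = (\<Sum>k\<in>T. u k * w k)"
      unfolding w_def sum_distrib_left by (intro sum.cong) auto
    finally show ?thesis .
  qed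
  then show ?thesis
    using nonneg by (intro exI[of _ w]) auto
qed

text \<open>One coordinate after another is replaced by an extremal vector. Each replacement is a
  bathtub problem whose weights come from the current state of the other coordinates.\<close>

lemma bathtub_multilinear:
  fixes v :: "'i::finite \<Rightarrow> 'k \<Rightarrow> real" and W :: "('i \<Rightarrow> 'k) \<Rightarrow> real"
  assumes T: "finite T" and v: "\<And>i k. k \<in> T \<Longrightarrow> 0 \<le> v i k" "\<And>i k. k \<in> T \<Longrightarrow> v i k \<le> c"
    and sum: "\<And>i. (\<Sum>k\<in>T. v i k) \<le> c * real m" and m: "0 < m" and c: "0 \<le> c"
    and W: "\<And>a. 0 \<le> W a"
  obtains S where "\<And>i. S i \<subseteq> T" "\<And>i. card (S i) \<le> m"
    "(\<Sum>a\<in>Pi\<^sub>E UNIV (\<lambda>_. T). (\<Prod>i\<in>UNIV. v i (a i)) * W a)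
      \<le> (\<Sum>a\<in>Pi\<^sub>E UNIV (\<lambda>_. T). (\<Prod>i\<in>UNIV. c * indicator (S i) (a i)) * W a)"
proof -
  let ?F = "\<lambda>v. \<Sum>a\<in>Pi\<^sub>E UNIV (\<lambda>_. T). (\<Prod>i\<in>UNIV. v i (a i)) * W a"
  have "\<exists>S. (\<forall>i. S i \<subseteq> T \<and> card (S i) \<le> m) \<and> ?F v \<le> ?F (\<lambda>i. if i \<in> J then (\<lambda>k. c * indicator (S i) k) else v i)"
    if "finite J" for J
    using that
  proof (induction J)
    case empty
    show ?case by (intro exI[of _ "\<lambda>_. {}"]) auto
  next
    case (insert j J)
    let ?v = "\<lambda>S J i. if i \<in> J then (\<lambda>k. c * indicator (S i) k) else v i"
    let ?P = "\<lambda>S. \<forall>i. S i \<subseteq> T \<and> card (S i) \<le> m"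
    obtain S where S: "?P S" "?F v \<le> ?F (?v S J)"
      using insert.IH by (elim exE conjE) (rule that)
    have nn: "\<forall>i. \<forall>k\<in>T. 0 \<le> ?v S J i k"
      using v c by auto
    obtain w where w: "\<forall>k\<in>T. 0 \<le> w k" "\<forall>u. ?F ((?v S J)(j := u)) = (\<Sum>k\<in>T. u k * w k)"
      using multilinear_sum_section[where v = "?v S J" and W = W and j = j, OF T nn W] by (elim exE conjE) (rule that)
    obtain S' where S': "S' \<subseteq> T" "card S' \<le> m" "(\<Sum>k\<in>T. v j k * w k) \<le> c * (\<Sum>k\<in>S'. w k)"
      using bathtub_finite[OF T v sum m, of w] w(1) by blast
    have "?F v \<le> ?F (?v S J)" by fact
    \<comment> \<open>Written as an update at \<open>j\<close> by its present value, the state is an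
      instance of the linear form with weights \<open>w\<close>.\<close>
    also have "?v S J = (?v S J)(j := v j)"
      using insert.hyps by auto
    also have "?F ((?v S J)(j := v j)) = (\<Sum>k\<in>T. v j k * w k)"
      by (rule w(2)[rule_format])
    also have "\<dots> \<le> c * (\<Sum>k\<in>S'. w k)" by fact
    also have "\<dots> = (\<Sum>k\<in>T. (c * indicator S' k) * w k)"
      unfolding sum_distrib_left using T S'(1) by (intro sum.mono_neutral_cong_left) auto
    also have "\<dots> = ?F ((?v S J)(j := (\<lambda>k. c * indicator S' k)))"
      by (rule w(2)[rule_format, symmetric])
    also have "(?v S J)(j := (\<lambda>k. c * indicator S' k)) = ?v (S(j := S')) (insert j J)"
      using insert.hyps by (auto simp: fun_eq_iff)
    finally show ?case
      using S(1) S' by (intro exI[of _ "S(j := S')"]) auto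
  qed
  from this[of UNIV] obtain S where "\<forall>i. S i \<subseteq> T \<and> card (S i) \<le> m" "?F v \<le> ?F (\<lambda>i k. c * indicator (S i) k)"
    by auto
  then show thesis by (intro that[of S]) auto
qed

section \<open>Discretization and passage to the limit\<close>

lemma emeasure_cell_const:
  fixes c :: "'n::finite \<Rightarrow> real"
  assumes "0 \<le> r"
  shows "emeasure lborel (cell c (\<lambda>_. r)) = ennreal ((2 * r) ^ CARD('n))"
proof -
  let ?l = "(\<chi> i. c i - r) :: real ^ 'n" and ?u = "(\<chi> i. c i + r) :: real ^ 'n"
  have "cell c (\<lambda>_. r) = box ?l ?u"
    by (auto simp: cell_def mem_box_cart abs_less_iff algebra_simps)
  moreover have "?l \<bullet> b \<le> ?u \<bullet> b" "(?u - ?l) \<bullet> b = 2 * r" if "b \<in> Basis" for b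
    using that assms by (auto simp: Basis_vec_def inner_axis)
  ultimately show ?thesis
    by (simp add: emeasure_lborel_box)
qed

text \<open>Cells around different multiples of 1 / m do not overlap, and at most m of them, with
  half-width 1 / (2 * m), have total half-width at most 1 / 2. The centred box left by the
  contraction therefore lies in the cube.\<close>

lemma sum_cells_le_unit_cube:
  fixes p :: "real ^ 'n \<Rightarrow> real" and S :: "'n \<Rightarrow> int set"
  assumes p: "is_seminorm p" and m: "0 < m" and S: "\<And>i. finite (S i)" "\<And>i. card (S i) \<le> m"
  shows "(\<Sum>a\<in>Pi\<^sub>E UNIV S. emeasure lborel ({x. p x \<le> e} \<inter> cell (\<lambda>i. real_of_int (a i) / real m) (\<lambda>_. 1 / (2 * real m))))
     \<le> emeasure lborel ({x. p x \<le> e} \<inter> unit_cube)"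
proof -
  let ?K = "{x. p x \<le> e}"
  let ?h = "\<lambda>k::int. (real_of_int k / real m, 1 / (2 * real m))"
  have K: "convex ?K" "?K \<in> sets borel" "\<And>x. x \<in> ?K \<Longrightarrow> - x \<in> ?K"
    using seminorm_sublevel_convex[OF p] seminorm_borel[OF p] seminorm_minus[OF p] by auto
  have inj: "inj ?h"
    using m by (auto simp: inj_on_def)
  have sep: "separated (?h ` S i)" for i
    unfolding separated_def
  proof (intro conjI ballI impI)
    fix a b assume "a \<in> ?h ` S i" "b \<in> ?h ` S i" "a \<noteq> b"
    then obtain k l where kl: "a = ?h k" "b = ?h l" by blast
    with \<open>a \<noteq> b\<close> have "k \<noteq> l" by auto
    then have "1 \<le> \<bar>k - l\<bar>" by linarith
    then have "1 \<le> \<bar>real_of_int k - real_of_int l\<bar>" by linarith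
    then have "1 / real m \<le> \<bar>real_of_int k - real_of_int l\<bar> / real m"
      by (intro divide_right_mono) auto
    also have "\<dots> = \<bar>real_of_int k / real m - real_of_int l / real m\<bar>"
      using m by (simp add: diff_divide_distrib[symmetric])
    finally show "snd a + snd b \<le> \<bar>fst a - fst b\<bar>"
      using kl by simp
  qed (use m S in auto)
  have "(\<Sum>a\<in>Pi\<^sub>E UNIV S. emeasure lborel (?K \<inter> cell (\<lambda>i. real_of_int (a i) / real m) (\<lambda>_. 1 / (2 * real m))))
      = intervals_mass ?K (\<lambda>i. ?h ` S i)"
    unfolding intervals_mass_def by (subst sum_PiE_image[OF inj]) simp
  also have "\<dots> \<le> emeasure lborel (?K \<inter> cell (\<lambda>_. 0) (\<lambda>i. \<Sum>a\<in>?h ` S i. snd a))"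
    by (intro intervals_mass_le_centered K sep)
  also have "\<dots> \<le> emeasure lborel (?K \<inter> unit_cube)"
  proof (intro emeasure_mono Int_mono subset_refl)
    have half: "(\<Sum>a\<in>?h ` S i. snd a) \<le> 1 / 2" for i
    proof -
      have "(\<Sum>a\<in>?h ` S i. snd a) = real (card (S i)) * (1 / (2 * real m))"
        using inj by (subst sum.reindex) (auto intro: inj_on_subset)
      also have "\<dots> \<le> real m * (1 / (2 * real m))"
        using S(2)[of i] by (intro mult_right_mono) auto
      finally show ?thesis using m by simp
    qed
    show "cell (\<lambda>_. 0) (\<lambda>i. \<Sum>a\<in>?h ` S i. snd a) \<subseteq> unit_cube"
    proof
      fix x :: "real ^ 'n" assume x: "x \<in> cell (\<lambda>_. 0) (\<lambda>i. \<Sum>a\<in>?h ` S i. snd a)"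
      have "- 1 / 2 \<le> x $ i \<and> x $ i \<le> 1 / 2" for i
      proof -
        have "\<bar>x $ i\<bar> < (\<Sum>a\<in>?h ` S i. snd a)"
          using x by (simp add: cell_def)
        then show ?thesis using half[of i] by linarith
      qed
      then show "x \<in> unit_cube"
        by (simp add: unit_cube_def)
    qed
    show "?K \<inter> unit_cube \<in> sets lborel"
      using K by auto
  qed
  finally show ?thesis .
qed

text \<open>Each density enters only through its masses on cells of length 1 / m. These are at most
  1 / m and add up to at most 1: the constraints of the bathtub principle, whose solutions put mass
  1 / m on at most m cells. The cutoff \<open>N\<close> keeps the number of cells finite, and the
  price of the grid is the enlarged sublevel set on the right.\<close>

lemma discretized_mass_le_unit_cube:
  fixes p :: "real ^ 'n \<Rightarrow> real" and f :: "'n \<Rightarrow> real \<Rightarrow> real"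
  assumes p: "is_seminorm p" and m: "0 < (m::nat)"
    and f[measurable]: "\<And>i. f i \<in> borel_measurable borel" and nn: "\<And>i t. 0 \<le> f i t"
    and le1: "\<And>i. AE t in lborel. f i t \<le> 1" and int: "\<And>i. (\<integral>\<^sup>+t. f i t \<partial>lborel) \<le> 1"
  shows "(\<integral>\<^sup>+x. (\<Prod>i\<in>UNIV. ennreal (f i (x $ i))) * indicator {x. p x \<le> e \<and> (\<forall>i. \<lfloor>real m * x $ i + 1 / 2\<rfloor> \<in> {- int N..int N})} x \<partial>lborel)
    \<le> emeasure lborel ({x. p x \<le> e + (\<Sum>i\<in>UNIV. p (axis i 1)) / real m} \<inter> unit_cube)"
proof -
  define B where "B = (\<Sum>i\<in>UNIV. p (axis i 1))"
  define \<kappa> where "\<kappa> t = \<lfloor>real m * t + 1 / 2\<rfloor>" for t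
  define T where "T = {- int N..int N}"
  let ?A = "Pi\<^sub>E UNIV (\<lambda>_::'n. T)"
  define pt :: "('n \<Rightarrow> int) \<Rightarrow> real ^ 'n" where "pt a = (\<chi> i. real_of_int (a i) / real m)" for a
  \<comment> \<open>Half of the error \<open>B / real m\<close> pays for moving from a point to the
    centre of its cell, the other half for moving from the centre to any point of the cell.\<close>
  define W :: "('n \<Rightarrow> int) \<Rightarrow> real" where "W a = (if p (pt a) \<le> e + B / (2 * real m) then 1 else 0)" for a
  have \<kappa>[measurable]: "\<kappa> \<in> measurable borel (count_space UNIV)"
    unfolding \<kappa>_def by measurable
  have [measurable]: "{t. \<kappa> t = k} \<in> sets borel" for k
    by measurable
  have \<kappa>_near: "\<bar>t - real_of_int (\<kappa> t) / real m\<bar> \<le> 1 / (2 * real m)" for t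
  proof -
    have "real_of_int (\<kappa> t) \<le> real m * t + 1 / 2" "real m * t + 1 / 2 < real_of_int (\<kappa> t) + 1"
      unfolding \<kappa>_def by linarith+
    then have "\<bar>real m * t - real_of_int (\<kappa> t)\<bar> \<le> 1 / 2" by linarith
    then have "\<bar>real m * t - real_of_int (\<kappa> t)\<bar> / real m \<le> 1 / 2 / real m"
      by (intro divide_right_mono) auto
    also have "\<bar>real m * t - real_of_int (\<kappa> t)\<bar> / real m = \<bar>(real m * t - real_of_int (\<kappa> t)) / real m\<bar>"
      by simp
    also have "(real m * t - real_of_int (\<kappa> t)) / real m = t - real_of_int (\<kappa> t) / real m"
      using m by (simp add: diff_divide_distrib)
    finally show ?thesis by simp
  qed
  have finA: "finite ?A" by (simp add: T_def finite_PiE)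
  define V where "V i k = (\<integral>\<^sup>+t. ennreal (f i t) * indicator {t. \<kappa> t = k} t \<partial>lborel)" for i k
  \<comment> \<open>The bound on the densities enters here: a cell has length 1 / m.\<close>
  have V_le: "V i k \<le> ennreal (1 / real m)" for i k
  proof -
    have "V i k \<le> (\<integral>\<^sup>+t. indicator {(real_of_int k - 1 / 2) / real m ..< (real_of_int k + 1 / 2) / real m} t \<partial>lborel)"
      unfolding V_def
    proof (rule nn_integral_mono_AE, use le1[of i] in eventually_elim)
      fix t assume t: "f i t \<le> 1"
      show "ennreal (f i t) * indicator {t. \<kappa> t = k} t \<le> indicator {(real_of_int k - 1 / 2) / real m ..< (real_of_int k + 1 / 2) / real m} t"
      proof (cases "\<kappa> t = k")
        case True
        then have "real_of_int k \<le> real m * t + 1 / 2" "real m * t + 1 / 2 < real_of_int k + 1"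
          unfolding \<kappa>_def by linarith+
        then have "t \<in> {(real_of_int k - 1 / 2) / real m ..< (real_of_int k + 1 / 2) / real m}"
          using m by (simp add: field_simps)
        then show ?thesis using t True by (simp add: ennreal_le_1)
      qed simp
    qed
    also have "\<dots> = ennreal ((real_of_int k + 1 / 2) / real m - (real_of_int k - 1 / 2) / real m)"
      using m by (simp add: emeasure_lborel_Ico divide_right_mono)
    also have "(real_of_int k + 1 / 2) / real m - (real_of_int k - 1 / 2) / real m = 1 / real m"
      by (simp add: diff_divide_distrib[symmetric])
    finally show ?thesis .
  qed
  have V_sum: "(\<Sum>k\<in>T. V i k) \<le> 1" for i
  proof -
    have "(\<Sum>k\<in>T. V i k) = (\<integral>\<^sup>+t. (\<Sum>k\<in>T. ennreal (f i t) * indicator {t. \<kappa> t = k} t) \<partial>lborel)"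
      unfolding V_def by (subst nn_integral_sum) auto
    also have "\<dots> \<le> (\<integral>\<^sup>+t. f i t \<partial>lborel)"
    proof (rule nn_integral_mono)
      fix t
      have "(\<Sum>k\<in>T. ennreal (f i t) * indicator {t. \<kappa> t = k} t) = ennreal (f i t) * (\<Sum>k\<in>T. if k = \<kappa> t then 1 else 0)"
        unfolding sum_distrib_left by (intro sum.cong) (auto simp: indicator_def)
      also have "\<dots> \<le> ennreal (f i t)"
        by (simp add: T_def)
      finally show "(\<Sum>k\<in>T. ennreal (f i t) * indicator {t. \<kappa> t = k} t) \<le> ennreal (f i t)" .
    qed
    also note int
    finally show ?thesis .
  qed
  define v where "v i k = enn2real (V i k)" for i k
  have Vv: "V i k = ennreal (v i k)" for i k
    unfolding v_def using V_le[of i k] by (intro ennreal_enn2real[symmetric]) (auto simp: top_unique less_top[symmetric])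
  have v0: "0 \<le> v i k" for i k by (simp add: v_def)
  have "(\<integral>\<^sup>+x. (\<Prod>i\<in>UNIV. ennreal (f i (x $ i))) * indicator {x. p x \<le> e \<and> (\<forall>i. \<kappa> (x $ i) \<in> T)} x \<partial>lborel)
    \<le> (\<integral>\<^sup>+x. (\<Sum>a\<in>?A. ennreal (W a) * (\<Prod>i\<in>UNIV. ennreal (f i (x $ i)) * indicator {t. \<kappa> t = a i} (x $ i))) \<partial>lborel)"
  proof (rule nn_integral_mono)
    fix x :: "real ^ 'n"
    let ?t = "\<lambda>a. ennreal (W a) * (\<Prod>i\<in>UNIV. ennreal (f i (x $ i)) * indicator {t. \<kappa> t = a i} (x $ i))"
    show "(\<Prod>i\<in>UNIV. ennreal (f i (x $ i))) * indicator {x. p x \<le> e \<and> (\<forall>i. \<kappa> (x $ i) \<in> T)} x \<le> (\<Sum>a\<in>?A. ?t a)"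
    proof (cases "p x \<le> e \<and> (\<forall>i. \<kappa> (x $ i) \<in> T)")
      case True
      let ?a = "\<lambda>i. \<kappa> (x $ i)"
      have "p (pt ?a) \<le> p x + 1 / (2 * real m) * (\<Sum>i\<in>UNIV. p (axis i 1))"
        using \<kappa>_near by (intro seminorm_coordinate_bound[OF p]) (simp add: pt_def abs_minus_commute)
      then have "W ?a = 1" using True by (simp add: W_def B_def)
      then have "(\<Prod>i\<in>UNIV. ennreal (f i (x $ i))) * indicator {x. p x \<le> e \<and> (\<forall>i. \<kappa> (x $ i) \<in> T)} x = ?t ?a"
        using True by simp
      also have "\<dots> \<le> (\<Sum>a\<in>?A. ?t a)"
        using True finA by (intro member_le_sum) auto
      finally show ?thesis .
    qed simp
  qed
  also have "\<dots> = (\<Sum>a\<in>?A. \<integral>\<^sup>+x. ennreal (W a) * (\<Prod>i\<in>UNIV. ennreal (f i (x $ i)) * indicator {t. \<kappa> t = a i} (x $ i)) \<partial>lborel)"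
    by (rule nn_integral_sum) measurable
  also have "\<dots> = (\<Sum>a\<in>?A. ennreal (W a) * (\<Prod>i\<in>UNIV. V i (a i)))"
  proof (rule sum.cong[OF refl])
    fix a
    interpret product_sigma_finite "\<lambda>_::'n. lborel :: real measure" ..
    have "(\<integral>\<^sup>+x. ennreal (W a) * (\<Prod>i\<in>UNIV. ennreal (f i (x $ i)) * indicator {t. \<kappa> t = a i} (x $ i)) \<partial>lborel)
       = ennreal (W a) * (\<integral>\<^sup>+x. (\<Prod>i\<in>UNIV. ennreal (f i (x $ i)) * indicator {t. \<kappa> t = a i} (x $ i)) \<partial>lborel)"
      by (rule nn_integral_cmult) measurable
    also have "(\<integral>\<^sup>+x. (\<Prod>i\<in>UNIV. ennreal (f i (x $ i)) * indicator {t. \<kappa> t = a i} (x $ i)) \<partial>lborel)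
       = (\<integral>\<^sup>+g. (\<Prod>i\<in>UNIV. ennreal (f i (g i)) * indicator {t. \<kappa> t = a i} (g i)) \<partial>PiM UNIV (\<lambda>_::'n. lborel))"
      by (subst nn_integral_lborel_vec) auto
    also have "\<dots> = (\<Prod>i\<in>UNIV. V i (a i))"
      unfolding V_def by (rule product_nn_integral_prod) auto
    finally show "(\<integral>\<^sup>+x. ennreal (W a) * (\<Prod>i\<in>UNIV. ennreal (f i (x $ i)) * indicator {t. \<kappa> t = a i} (x $ i)) \<partial>lborel)
      = ennreal (W a) * (\<Prod>i\<in>UNIV. V i (a i))" .
  qed
  also have "\<dots> = ennreal (\<Sum>a\<in>?A. (\<Prod>i\<in>UNIV. v i (a i)) * W a)"
  proof -
    have "ennreal (W a) * (\<Prod>i\<in>UNIV. V i (a i)) = ennreal ((\<Prod>i\<in>UNIV. v i (a i)) * W a)" for a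
      using v0 by (simp add: Vv prod_ennreal prod_nonneg ennreal_mult W_def)
    then show ?thesis
      using v0 by (simp add: sum_ennreal prod_nonneg W_def)
  qed
  finally have 1: "(\<integral>\<^sup>+x. (\<Prod>i\<in>UNIV. ennreal (f i (x $ i))) * indicator {x. p x \<le> e \<and> (\<forall>i. \<kappa> (x $ i) \<in> T)} x \<partial>lborel)
    \<le> ennreal (\<Sum>a\<in>?A. (\<Prod>i\<in>UNIV. v i (a i)) * W a)" .
  obtain S where S: "\<And>i. S i \<subseteq> T" "\<And>i. card (S i) \<le> m"
    "(\<Sum>a\<in>?A. (\<Prod>i\<in>UNIV. v i (a i)) * W a) \<le> (\<Sum>a\<in>?A. (\<Prod>i\<in>UNIV. 1 / real m * indicator (S i) (a i)) * W a)"
  proof (rule bathtub_multilinear[of T v "1 / real m" m W])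
    show "finite T" by (simp add: T_def)
    show "v i k \<le> 1 / real m" for i k
      using V_le[of i k] unfolding Vv by simp
    show "(\<Sum>k\<in>T. v i k) \<le> 1 / real m * real m" for i
      using V_sum[of i] m unfolding Vv by (simp add: sum_ennreal v0 ennreal_le_1)
    show "0 \<le> W a" for a by (simp add: W_def)
  qed (use v0 m in auto)
  have finS: "finite (S i)" for i
    using S(1)[of i] by (rule finite_subset) (simp add: T_def)
  let ?c = "\<lambda>a. {x. p x \<le> e + B / real m} \<inter> cell (\<lambda>i. real_of_int (a i) / real m) (\<lambda>_. 1 / (2 * real m))"
  \<comment> \<open>Where \<open>W a = 1\<close> the whole cell lies in the enlarged sublevel set,
    so its weight is its volume there.\<close>
  have cell: "ennreal ((1 / real m) ^ CARD('n) * W a) \<le> emeasure lborel (?c a)" for a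
  proof (cases "W a = 0")
    case False
    then have W: "p (pt a) \<le> e + B / (2 * real m)" "W a = 1"
      by (auto simp: W_def split: if_splits)
    have "cell (\<lambda>i. real_of_int (a i) / real m) (\<lambda>_. 1 / (2 * real m)) \<subseteq> {x. p x \<le> e + B / real m}"
    proof
      fix x :: "real ^ 'n" assume "x \<in> cell (\<lambda>i. real_of_int (a i) / real m) (\<lambda>_. 1 / (2 * real m))"
      then have "\<bar>x $ i - pt a $ i\<bar> \<le> 1 / (2 * real m)" for i
        by (auto simp: cell_def pt_def less_imp_le)
      from seminorm_coordinate_bound[OF p this] W
      have "p x \<le> e + B / (2 * real m) + B / (2 * real m)"
        by (simp add: B_def)
      then show "x \<in> {x. p x \<le> e + B / real m}"
        using m by (simp add: field_simps)
    qed
    then have "?c a = cell (\<lambda>i. real_of_int (a i) / real m) (\<lambda>_. 1 / (2 * real m))"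
      by auto
    then show ?thesis
      using W by (simp add: emeasure_cell_const)
  qed simp
  have "(\<Sum>a\<in>?A. (\<Prod>i\<in>UNIV. 1 / real m * indicator (S i) (a i)) * W a) = (\<Sum>a\<in>Pi\<^sub>E UNIV S. (1 / real m) ^ CARD('n) * W a)"
  proof (rule sum.mono_neutral_cong_right[OF finA])
    show "Pi\<^sub>E UNIV S \<subseteq> ?A" using S(1) by (intro PiE_mono)
    show "\<forall>a\<in>?A - Pi\<^sub>E UNIV S. (\<Prod>i\<in>UNIV. 1 / real m * indicator (S i) (a i)) * W a = 0"
      by (auto simp: PiE_iff prod_zero_iff indicator_def split: if_splits)
    show "(\<Prod>i\<in>UNIV. 1 / real m * indicator (S i) (a i)) * W a = (1 / real m) ^ CARD('n) * W a" if "a \<in> Pi\<^sub>E UNIV S" for a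
    proof -
      have "a i \<in> S i" for i using that by auto
      then show ?thesis by simp
    qed
  qed
  then have "ennreal (\<Sum>a\<in>?A. (\<Prod>i\<in>UNIV. v i (a i)) * W a) \<le> ennreal (\<Sum>a\<in>Pi\<^sub>E UNIV S. (1 / real m) ^ CARD('n) * W a)"
    using S(3) by (intro ennreal_leI) simp
  also have "\<dots> = (\<Sum>a\<in>Pi\<^sub>E UNIV S. ennreal ((1 / real m) ^ CARD('n) * W a))"
    by (intro sum_ennreal[symmetric]) (auto simp: W_def)
  also have "\<dots> \<le> (\<Sum>a\<in>Pi\<^sub>E UNIV S. emeasure lborel (?c a))"
    by (intro sum_mono cell)
  also have "\<dots> \<le> emeasure lborel ({x. p x \<le> e + B / real m} \<inter> unit_cube)"
    using p m finS S(2) by (rule sum_cells_le_unit_cube)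
  finally show ?thesis
    using 1 unfolding \<kappa>_def T_def B_def by (rule order_trans[rotated])
qed

lemma bounded_unit_cube: "bounded (unit_cube :: (real ^ 'n::finite) set)"
proof -
  have "(unit_cube :: (real ^ 'n) set) \<subseteq> cell (\<lambda>_. 0) (\<lambda>_. 1)"
  proof
    fix x :: "real ^ 'n" assume "x \<in> unit_cube"
    then have "- 1 / 2 \<le> x $ i \<and> x $ i \<le> 1 / 2" for i
      by (simp add: unit_cube_def)
    then have "\<bar>x $ i\<bar> < 1" for i
      by (smt (verit) field_sum_of_halves)
    then show "x \<in> cell (\<lambda>_. 0) (\<lambda>_. 1)"
      by (simp add: cell_def)
  qed
  then show ?thesis
    using cell_bounded bounded_subset by blast
qed

text \<open>First the cutoff tends to infinity, by monotone convergence, then the mesh tends to 0: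
  the enlarged sublevel sets decrease exactly to the closed one, and the cube has finite
  volume.\<close>

lemma product_density_seminorm_le_unit_cube:
  fixes p :: "real ^ 'n \<Rightarrow> real" and f :: "'n \<Rightarrow> real \<Rightarrow> real"
  assumes p: "is_seminorm p"
    and f[measurable]: "\<And>i. f i \<in> borel_measurable borel" and nn: "\<And>i t. 0 \<le> f i t"
    and le1: "\<And>i. AE t in lborel. f i t \<le> 1" and int: "\<And>i. (\<integral>\<^sup>+t. f i t \<partial>lborel) \<le> 1"
  shows "(\<integral>\<^sup>+x. (\<Prod>i\<in>UNIV. ennreal (f i (x $ i))) * indicator {x. p x \<le> e} x \<partial>lborel)
    \<le> emeasure lborel ({x. p x \<le> e} \<inter> unit_cube)"
proof -
  note seminorm_borel[OF p, measurable]
  define B where "B = (\<Sum>i\<in>UNIV. p (axis i 1))"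
  have B: "0 \<le> B" using seminorm_nonneg[OF p] by (auto simp: B_def intro: sum_nonneg)
  define I where "I = (\<integral>\<^sup>+x. (\<Prod>i\<in>UNIV. ennreal (f i (x $ i))) * indicator {x. p x \<le> e} x \<partial>lborel)"
  have I_le: "I \<le> emeasure lborel ({x. p x \<le> e + B / real m} \<inter> unit_cube)" if m: "0 < m" for m :: nat
  proof -
    let ?k = "\<lambda>x i. \<lfloor>real m * x $ i + 1 / 2\<rfloor>"
    let ?g = "\<lambda>N x. (\<Prod>i\<in>UNIV. ennreal (f i (x $ i))) * indicator {x :: real ^ 'n. p x \<le> e \<and> (\<forall>i. ?k x i \<in> {- int N..int N})} x"
    have "(\<lambda>N. \<integral>\<^sup>+x. ?g N x \<partial>lborel) \<longlonglongrightarrow> (\<integral>\<^sup>+x. (\<Prod>i\<in>UNIV. ennreal (f i (x $ i))) * indicator {x. p x \<le> e} x \<partial>lborel)"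
    proof (rule nn_integral_LIMSEQ)
      show "incseq ?g"
        by (intro incseq_SucI le_funI mult_left_mono) (auto simp: indicator_def, (smt (verit))+)
      have k: "(\<lambda>x. ?k x i) \<in> measurable borel (count_space UNIV)" for i
        by measurable
      have [measurable]: "{x :: real ^ 'n. p x \<le> e \<and> (\<forall>i. ?k x i \<in> S)} \<in> sets borel" for S
      proof -
        have "(\<lambda>x. ?k x i) -` S \<in> sets borel" for i
          using measurable_sets[OF k, of S] by simp
        then have "{x. p x \<le> e} \<inter> (\<Inter>i. (\<lambda>x. ?k x i) -` S) \<in> sets borel"
          by (intro sets.Int sets.finite_INT) auto
        also have "{x. p x \<le> e} \<inter> (\<Inter>i. (\<lambda>x. ?k x i) -` S) = {x. p x \<le> e \<and> (\<forall>i. ?k x i \<in> S)}"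
          by auto
        finally show ?thesis .
      qed
      show "?g N \<in> borel_measurable lborel" for N
        by measurable
      fix x :: "real ^ 'n"
      have "\<forall>i. ?k x i \<in> {- int N..int N}" if N: "nat (\<Sum>i\<in>UNIV. \<bar>?k x i\<bar>) \<le> N" for N
      proof
        fix i
        have "\<bar>?k x i\<bar> \<le> (\<Sum>i\<in>UNIV. \<bar>?k x i\<bar>)"
          by (rule member_le_sum) auto
        then have "\<bar>?k x i\<bar> \<le> int N" using N by linarith
        then show "?k x i \<in> {- int N..int N}" by auto
      qed
      then have "\<forall>\<^sub>F N in sequentially. ?g N x = (\<Prod>i\<in>UNIV. ennreal (f i (x $ i))) * indicator {x. p x \<le> e} x"
        by (intro eventually_sequentiallyI[of "nat (\<Sum>i\<in>UNIV. \<bar>?k x i\<bar>)"]) (simp add: indicator_def)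
      then show "(\<lambda>N. ?g N x) \<longlonglongrightarrow> (\<Prod>i\<in>UNIV. ennreal (f i (x $ i))) * indicator {x. p x \<le> e} x"
        by (rule tendsto_eventually)
    qed
    then show ?thesis
      unfolding I_def B_def
      by (rule LIMSEQ_le_const2) (intro exI allI impI discretized_mass_le_unit_cube p m f nn le1 int)
  qed
  let ?A = "\<lambda>m. {x. p x \<le> e + B / real (Suc m)} \<inter> unit_cube"
  have "(\<lambda>m. emeasure lborel (?A m)) \<longlonglongrightarrow> emeasure lborel (\<Inter>m. ?A m)"
  proof (rule Lim_emeasure_decseq)
    show "decseq ?A"
    proof (rule decseq_SucI)
      fix m
      have "B / real (Suc (Suc m)) \<le> B / real (Suc m)"
        using B by (intro divide_left_mono) auto
      then show "?A (Suc m) \<subseteq> ?A m" by auto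
    qed
    show "emeasure lborel (?A m) \<noteq> \<infinity>" for m
      using emeasure_bounded_finite[OF bounded_subset[OF bounded_unit_cube]] by (metis Int_lower2 less_irrefl infinity_ennreal_def)
    show "range ?A \<subseteq> sets lborel"
      by auto
  qed
  moreover have "(\<Inter>m. ?A m) = {x. p x \<le> e} \<inter> unit_cube"
  proof (intro equalityI subsetI)
    fix x assume x: "x \<in> (\<Inter>m. ?A m)"
    have "(\<lambda>m. e + B / real (Suc m)) \<longlonglongrightarrow> e + 0"
      by (intro tendsto_add tendsto_const LIMSEQ_Suc[OF lim_const_over_n])
    then have "p x \<le> e + 0"
      by (rule LIMSEQ_le_const) (use x in auto)
    then show "x \<in> {x. p x \<le> e} \<inter> unit_cube" using x by auto
  next
    fix x assume x: "x \<in> {x. p x \<le> e} \<inter> unit_cube"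
    have "p x \<le> e + B / real (Suc m)" for m
      using x B by (simp add: add_increasing2)
    then show "x \<in> (\<Inter>m. ?A m)" using x by auto
  qed
  ultimately have "(\<lambda>m. emeasure lborel (?A m)) \<longlonglongrightarrow> emeasure lborel ({x. p x \<le> e} \<inter> unit_cube)"
    by simp
  then show ?thesis
    unfolding I_def[symmetric] by (rule LIMSEQ_le_const) (intro exI allI impI I_le, simp)
qed

section \<open>From volumes to probabilities\<close>

lemma Linfty_norm_le_1_AE:
  assumes "f \<in> borel_measurable borel" "Linfty_norm f \<le> 1"
  shows "AE t in lborel. f t \<le> 1"
proof -
  have "AE t in lborel. ereal \<bar>f t\<bar> \<le> esssup lborel (\<lambda>t. ereal \<bar>f t\<bar>)"
    by (rule esssup_AE)
  then show ?thesis
  proof eventually_elim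
    case (elim t)
    then have "ereal \<bar>f t\<bar> \<le> 1"
      using assms(2) unfolding Linfty_norm_def by (rule order_trans)
    then show ?case by (simp add: one_ereal_def)
  qed
qed

lemma prob_unit_cube_density:
  fixes Z :: "'b \<Rightarrow> real ^ 'n::finite"
  assumes "distributed M lborel Z (\<lambda>v. ennreal (indicator unit_cube v / measure lborel (unit_cube :: (real ^ 'n) set)))"
    and A[measurable]: "A \<in> sets borel"
  shows "emeasure M {w \<in> space M. Z w \<in> A} = emeasure lborel (A \<inter> unit_cube)"
proof -
  have "emeasure M {w \<in> space M. Z w \<in> A} = emeasure M (Z -` A \<inter> space M)"
    by (intro arg_cong[where f="emeasure M"]) auto
  also have "\<dots> = (\<integral>\<^sup>+v. ennreal (indicator unit_cube v / measure lborel (unit_cube :: (real ^ 'n) set)) * indicator A v \<partial>lborel)"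
    using assms by (intro distributed_emeasure) auto
  also have "\<dots> = (\<integral>\<^sup>+v. indicator (A \<inter> unit_cube) v \<partial>lborel)"
    by (intro nn_integral_cong) (auto simp: measure_def emeasure_unit_cube split: split_indicator)
  finally show ?thesis by simp
qed

lemma prob_seminorm_le_unit_cube:
  fixes X :: "'a \<Rightarrow> real ^ 'n" and Z :: "'b \<Rightarrow> real ^ 'n" and f :: "'n::finite \<Rightarrow> real \<Rightarrow> real"
  assumes "prob_space M" "prob_space M'"
    and f: "\<And>i. probability_density (f i)" "\<And>i. Linfty_norm (f i) \<le> 1"
    and X: "distributed M lborel X (\<lambda>v. ennreal (\<Prod>i\<in>UNIV. f i (v $ i)))"
    and Z: "distributed M' lborel Z (\<lambda>v. ennreal (indicator unit_cube v / measure lborel (unit_cube :: (real ^ 'n) set)))"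
    and p: "is_seminorm p"
  shows "\<P>(\<omega> in M. p (X \<omega>) \<le> e) \<le> \<P>(\<omega> in M'. p (Z \<omega>) \<le> e)"
proof -
  interpret M: prob_space M by fact
  interpret M': prob_space M' by fact
  note seminorm_borel[OF p, measurable]
  have f': "f i \<in> borel_measurable borel" "0 \<le> f i t" "(\<integral>\<^sup>+t. f i t \<partial>lborel) \<le> 1" for i t
    using f(1)[of i] by (auto simp: probability_density_def)
  have "emeasure M {w \<in> space M. p (X w) \<le> e} = emeasure M (X -` {x. p x \<le> e} \<inter> space M)"
    by (intro arg_cong[where f="emeasure M"]) auto
  also have "\<dots> = (\<integral>\<^sup>+v. ennreal (\<Prod>i\<in>UNIV. f i (v $ i)) * indicator {x. p x \<le> e} v \<partial>lborel)"
    using X by (intro distributed_emeasure) auto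
  also have "\<dots> = (\<integral>\<^sup>+v. (\<Prod>i\<in>UNIV. ennreal (f i (v $ i))) * indicator {x. p x \<le> e} v \<partial>lborel)"
    using f' by (simp add: prod_ennreal)
  also have "\<dots> \<le> emeasure lborel ({x. p x \<le> e} \<inter> unit_cube)"
    using p f' Linfty_norm_le_1_AE[OF f'(1) f(2)] by (intro product_density_seminorm_le_unit_cube) auto
  also have "\<dots> = emeasure M' {w \<in> space M'. Z w \<in> {x. p x \<le> e}}"
    using Z by (intro prob_unit_cube_density[symmetric]) auto
  finally show ?thesis
    by (simp add: M.emeasure_eq_measure M'.emeasure_eq_measure)
qed

section \<open>Ball's integral inequality\<close>

text \<open>For products whose second factor, a polynomial in \<open>sinc\<close> and
  \<open>cos\<close>, is only known to be continuous at 0: the vanishing of \<open>sin\<close> makes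
  up for it.\<close>

lemma DERIV_sin_mult_at_0:
  assumes "isCont k 0"
  shows "((\<lambda>x::real. sin x * k x) has_real_derivative k 0) (at 0)"
  unfolding DERIV_def
proof (rule Lim_transform_eventually)
  have "((\<lambda>h. sinc h * k h) \<longlongrightarrow> sinc 0 * k 0) (at 0)"
    using isCont_sinc[of 0] assms by (intro tendsto_mult) (auto simp: isCont_def)
  then show "((\<lambda>h. sinc h * k h) \<longlongrightarrow> k 0) (at 0)" by simp
  show "\<forall>\<^sub>F h in at 0. sinc h * k h = (sin (0 + h) * k (0 + h) - sin 0 * k 0) / h"
    by (auto simp: eventually_at intro!: exI[of _ 1])
qed

lemma DERIV_sinc: "x \<noteq> 0 \<Longrightarrow> (sinc has_real_derivative (x * cos x - sin x) / x\<^sup>2) (at x)"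
proof -
  assume x: "x \<noteq> 0"
  have "((\<lambda>x. sin x / x) has_real_derivative (x * cos x - sin x) / x\<^sup>2) (at x)"
    using x by (auto intro!: derivative_eq_intros simp: power2_eq_square field_simps)
  then show ?thesis
  proof (rule DERIV_cong_ev[THEN iffD1, OF refl _ refl, rotated])
    show "\<forall>\<^sub>F y in nhds x. sin y / y = sinc y"
      using t1_space_nhds[OF x] by (auto elim: eventually_mono)
  qed
qed

lemma abs_sinc_le_1: "\<bar>sinc x\<bar> \<le> 1"
  using abs_sin_x_le_abs_x[of x] by (auto simp: divide_le_eq)

text \<open>From an integration by parts: an antiderivative of sin^2 x / x^2 is - sin^2 x / x plus
  one of sin (2 * x) / x.\<close>

definition sinc_sq_prim :: "real \<Rightarrow> real" where
  "sinc_sq_prim x = Si (2 * x) - sin x * sinc x"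

text \<open>Two integrations by parts of sin^3 x / x^3 leave 3 / 2 times the integral of (2 * sin x
  * cos^2 x - sin^3 x) / x, and this numerator is 3 / 4 * sin (3 * x) - 1 / 4 * sin x.\<close>

definition sinc_cube_prim :: "real \<Rightarrow> real" where
  "sinc_cube_prim x = 3 / 2 * (3 / 4 * Si (3 * x) - Si x / 4) - sin x * ((sinc x)\<^sup>2 / 2 + 3 / 2 * cos x * sinc x)"

lemma DERIV_Si_scaled: "((\<lambda>x. Si (c * x)) has_real_derivative c * sinc (c * x)) (at x)"
proof -
  have "((\<lambda>x. c * x) has_real_derivative c) (at x)"
    by (auto intro!: derivative_eq_intros)
  from DERIV_chain2[OF DERIV_Si this] show ?thesis
    by (simp only: mult.commute)
qed

lemma DERIV_sinc_sq_prim: "(sinc_sq_prim has_real_derivative (sinc x)\<^sup>2) (at x)"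
proof (cases "x = 0")
  case True
  have "(sinc_sq_prim has_real_derivative 2 * sinc (2 * 0) - sinc 0) (at 0)"
    unfolding sinc_sq_prim_def [abs_def] by (intro DERIV_diff DERIV_Si_scaled DERIV_sin_mult_at_0 isCont_sinc)
  then show ?thesis using True by simp
next
  case False
  have "(sinc_sq_prim has_real_derivative 2 * sinc (2 * x) - (cos x * sinc x + (x * cos x - sin x) / x\<^sup>2 * sin x)) (at x)"
    unfolding sinc_sq_prim_def [abs_def] using False by (intro DERIV_diff DERIV_Si_scaled DERIV_mult DERIV_sin DERIV_sinc)
  moreover have "2 * sinc (2 * x) - (cos x * sinc x + (x * cos x - sin x) / x\<^sup>2 * sin x) = (sinc x)\<^sup>2"
    using False sin_double[of x] by (simp add: field_simps power2_eq_square)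
  ultimately show ?thesis by simp
qed

lemma DERIV_sinc_cube_prim: "(sinc_cube_prim has_real_derivative (sinc x) ^ 3) (at x)"
proof (cases "x = 0")
  case True
  have "(sinc_cube_prim has_real_derivative 3 / 2 * (3 / 4 * (3 * sinc (3 * 0)) - sinc 0 / 4) - ((sinc 0)\<^sup>2 / 2 + 3 / 2 * cos 0 * sinc 0)) (at 0)"
    unfolding sinc_cube_prim_def [abs_def]
    by (intro DERIV_diff DERIV_cmult DERIV_cdivide DERIV_Si DERIV_Si_scaled DERIV_sin_mult_at_0 continuous_intros isCont_sinc) auto
  then show ?thesis using True by simp
next
  case False
  let ?s = "(x * cos x - sin x) / x\<^sup>2"
  have "((\<lambda>x. (g x)\<^sup>2 / 2 + 3 / 2 * cos x * g x) has_real_derivative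
      g x * s + (3 / 2 * (- sin x) * g x + s * (3 / 2 * cos x))) (at x)"
    if "(g has_real_derivative s) (at x)" for g s
    using that by (auto intro!: derivative_eq_intros simp: power2_eq_square)
  from this[OF DERIV_sinc[OF False]]
  have "(sinc_cube_prim has_real_derivative 3 / 2 * (3 / 4 * (3 * sinc (3 * x)) - sinc x / 4)
      - (cos x * ((sinc x)\<^sup>2 / 2 + 3 / 2 * cos x * sinc x)
         + (sinc x * ?s + (3 / 2 * (- sin x) * sinc x + ?s * (3 / 2 * cos x))) * sin x)) (at x)"
    unfolding sinc_cube_prim_def [abs_def]
    by (intro DERIV_diff DERIV_cmult DERIV_cdivide DERIV_Si DERIV_Si_scaled DERIV_mult DERIV_sin)
  moreover have "3 / 2 * (3 / 4 * (3 * sinc (3 * x)) - sinc x / 4)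
      - (cos x * ((sinc x)\<^sup>2 / 2 + 3 / 2 * cos x * sinc x)
         + (sinc x * ?s + (3 / 2 * (- sin x) * sinc x + ?s * (3 / 2 * cos x))) * sin x) = (sinc x) ^ 3"
  proof -
    have s3: "sin (3 * x) = 3 * sin x * (cos x)\<^sup>2 - sin x ^ 3"
    proof -
      have "sin (3 * x) = sin (2 * x + x)" by simp
      also have "\<dots> = 3 * sin x * (cos x)\<^sup>2 - sin x ^ 3"
        unfolding sin_add sin_double cos_double by (simp add: power2_eq_square power3_eq_cube algebra_simps)
      finally show ?thesis .
    qed
    \<comment> \<open>In terms of y = 1 / x the claim is a polynomial identity modulo cos^2 x +
      sin^2 x = 1.\<close>
    define y where "y = 1 / x"
    have *: "sinc x = sin x * y" "sinc (3 * x) = (3 * sin x * (cos x)\<^sup>2 - sin x ^ 3) * y / 3" "?s = cos x * y - sin x * y\<^sup>2"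
      using False s3 by (auto simp: y_def field_simps power2_eq_square)
    have "(cos x)\<^sup>2 + (sin x)\<^sup>2 = 1"
      by simp
    then show ?thesis
      unfolding * by algebra
  qed
  ultimately show ?thesis by simp
qed

lemma tendsto_sin_sinc_at_top: "((\<lambda>x. sin x * sinc x) \<longlongrightarrow> 0) at_top"
proof (rule Lim_null_comparison)
  show "((\<lambda>x::real. 1 / x) \<longlongrightarrow> 0) at_top"
    by real_asymp
  show "\<forall>\<^sub>F x in at_top. norm (sin x * sinc x) \<le> 1 / x"
    using eventually_gt_at_top[of 0]
  proof eventually_elim
    case (elim x)
    have "\<bar>sin x\<bar> * \<bar>sin x\<bar> \<le> 1 * 1" by (intro mult_mono) auto
    then show ?case using elim by (simp add: abs_mult divide_right_mono)
  qed
qed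

lemma tendsto_Si_scaled: "0 < c \<Longrightarrow> ((\<lambda>x. Si (c * x)) \<longlongrightarrow> pi / 2) at_top"
  by (rule filterlim_compose[OF Si_at_top]) real_asymp

lemma tendsto_sinc_sq_prim: "(sinc_sq_prim \<longlongrightarrow> pi / 2) at_top"
  unfolding sinc_sq_prim_def [abs_def]
  using tendsto_diff[OF tendsto_Si_scaled tendsto_sin_sinc_at_top, of 2] by simp

lemma tendsto_sinc_cube_prim: "(sinc_cube_prim \<longlongrightarrow> 3 * pi / 8) at_top"
proof -
  have "((\<lambda>x. sin x * ((sinc x)\<^sup>2 / 2 + 3 / 2 * cos x * sinc x)) \<longlongrightarrow> 0) at_top"
  proof (rule Lim_null_comparison)
    show "((\<lambda>x. 2 * \<bar>sin x * sinc x\<bar>) \<longlongrightarrow> 0) at_top"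
      using tendsto_mult[OF tendsto_const tendsto_rabs[OF tendsto_sin_sinc_at_top], of 2] by simp
    have bound: "\<bar>a * (s\<^sup>2 / 2 + 3 / 2 * c * s)\<bar> \<le> 2 * \<bar>a * s\<bar>" if "\<bar>s\<bar> \<le> 1" "\<bar>c\<bar> \<le> 1" for a s c :: real
    proof -
      have "a * (s\<^sup>2 / 2 + 3 / 2 * c * s) = (a * s) * (s / 2 + 3 / 2 * c)"
        by (simp add: power2_eq_square algebra_simps)
      then have "\<bar>a * (s\<^sup>2 / 2 + 3 / 2 * c * s)\<bar> = \<bar>a * s\<bar> * \<bar>s / 2 + 3 / 2 * c\<bar>"
        by (simp only: abs_mult)
      also have "\<dots> \<le> \<bar>a * s\<bar> * 2"
        using that by (intro mult_left_mono) linarith+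
      finally show ?thesis by simp
    qed
    have "norm (sin x * ((sinc x)\<^sup>2 / 2 + 3 / 2 * cos x * sinc x)) \<le> 2 * \<bar>sin x * sinc x\<bar>" for x
      unfolding real_norm_def by (rule bound[OF abs_sinc_le_1 abs_cos_le_one])
    then show "\<forall>\<^sub>F x in at_top. norm (sin x * ((sinc x)\<^sup>2 / 2 + 3 / 2 * cos x * sinc x)) \<le> 2 * \<bar>sin x * sinc x\<bar>"
      by (rule always_eventually[OF allI])
  qed
  then have "(sinc_cube_prim \<longlongrightarrow> 3 / 2 * (3 / 4 * (pi / 2) - (pi / 2) / 4) - 0) at_top"
    unfolding sinc_cube_prim_def [abs_def]
    by (intro tendsto_diff tendsto_mult tendsto_divide tendsto_const tendsto_Si_scaled Si_at_top) auto
  then show ?thesis by simp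
qed

lemma Si_0: "Si 0 = 0"
  by (simp add: Si_def zero_ereal_def[symmetric])

lemma sinc_prim_0: "sinc_sq_prim 0 = 0" "sinc_cube_prim 0 = 0"
  by (simp_all add: sinc_sq_prim_def sinc_cube_prim_def Si_0)

lemma nn_integral_sinc_sq_half: "(\<integral>\<^sup>+x. ennreal ((sinc x)\<^sup>2) * indicator {0..} x \<partial>lborel) = ennreal (pi / 2)"
proof -
  have "(\<integral>\<^sup>+x. ennreal ((sinc x)\<^sup>2) * indicator {0..} x \<partial>lborel) = ennreal (pi / 2 - sinc_sq_prim 0)"
    by (rule nn_integral_FTC_atLeast[OF _ DERIV_sinc_sq_prim _ tendsto_sinc_sq_prim]) (auto intro!: borel_measurable_power borel_measurable_sinc)
  then show ?thesis by (simp add: sinc_prim_0)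
qed

text \<open>The cube changes sign. Since |sinc| is at most 1, adding the square makes the integrand
  nonnegative, as an integral of this kind requires.\<close>

lemma nn_integral_sinc_cube_plus_sq_half:
  "(\<integral>\<^sup>+x. ennreal ((sinc x) ^ 3 + (sinc x)\<^sup>2) * indicator {0..} x \<partial>lborel) = ennreal (3 * pi / 8 + pi / 2)"
proof -
  have "(\<integral>\<^sup>+x. ennreal ((sinc x) ^ 3 + (sinc x)\<^sup>2) * indicator {0..} x \<partial>lborel)
      = ennreal (3 * pi / 8 + pi / 2 - (sinc_cube_prim 0 + sinc_sq_prim 0))"
  proof (rule nn_integral_FTC_atLeast)
    show "(\<lambda>x. (sinc x) ^ 3 + (sinc x)\<^sup>2) \<in> borel_measurable borel"
      by (intro borel_measurable_add borel_measurable_power borel_measurable_sinc)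
    show "((\<lambda>x. sinc_cube_prim x + sinc_sq_prim x) has_real_derivative (sinc x) ^ 3 + (sinc x)\<^sup>2) (at x)" for x
      by (intro DERIV_add DERIV_sinc_cube_prim DERIV_sinc_sq_prim)
    show "((\<lambda>x. sinc_cube_prim x + sinc_sq_prim x) \<longlongrightarrow> 3 * pi / 8 + pi / 2) at_top"
      by (intro tendsto_add tendsto_sinc_cube_prim tendsto_sinc_sq_prim)
    fix x :: real
    have "(sinc x) ^ 3 + (sinc x)\<^sup>2 = (sinc x)\<^sup>2 * (1 + sinc x)"
      by (simp add: power2_eq_square power3_eq_cube algebra_simps)
    also have "\<dots> \<ge> 0"
      using abs_sinc_le_1[of x] by (intro mult_nonneg_nonneg) (auto simp: abs_le_iff)
    finally show "0 \<le> (sinc x) ^ 3 + (sinc x)\<^sup>2" .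
  qed
  then show ?thesis by (simp add: sinc_prim_0)
qed

text \<open>An antiderivative of a function slightly above \<open>sin\<^sup>2 x / x\<^sup>3\<close> which at the multiples of \<open>pi\<close> equals
  \<open>- 1 / (4 * x\<^sup>2)\<close>. This is half of what the estimate \<open>sin\<^sup>2 x \<le> 1\<close> would give.\<close>

definition sin_sq_tail_prim :: "real \<Rightarrow> real" where
  "sin_sq_tail_prim x = - (1 / (4 * x\<^sup>2)) - sin x * cos x / (2 * x ^ 3) - 3 * (sin x)\<^sup>2 / (4 * x ^ 4)"

text \<open>Writing sin^2 x as (1 - cos (2 * x)) / 2, the constant part gives - 1 / (4 * x^2), and
  two integrations by parts of the oscillating part leave the term 3 * sin^2 x / x^5. Being
  nonnegative, it may stay in an upper bound, and the boundary terms vanish wherever sin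
  does.\<close>

lemma DERIV_sin_sq_tail_prim:
  assumes "0 < x"
  shows "(sin_sq_tail_prim has_real_derivative (sin x)\<^sup>2 / x ^ 3 + 3 * (sin x)\<^sup>2 / x ^ 5) (at x)"
proof -
  have 1: "((\<lambda>x::real. 1 / (4 * x\<^sup>2)) has_real_derivative - 1 / (2 * x ^ 3)) (at x)"
    using assms by (auto intro!: derivative_eq_intros simp: field_simps power2_eq_square power3_eq_cube eval_nat_numeral)
  have 2: "((\<lambda>x::real. sin x * cos x / (2 * x ^ 3)) has_real_derivative ((cos x)\<^sup>2 - (sin x)\<^sup>2) / (2 * x ^ 3) - 3 * sin x * cos x / (2 * x ^ 4)) (at x)"
    using assms by (auto intro!: derivative_eq_intros simp: field_simps eval_nat_numeral)
  have 3: "((\<lambda>x::real. 3 * (sin x)\<^sup>2 / (4 * x ^ 4)) has_real_derivative 3 * sin x * cos x / (2 * x ^ 4) - 3 * (sin x)\<^sup>2 / x ^ 5) (at x)"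
    using assms by (auto intro!: derivative_eq_intros simp: field_simps eval_nat_numeral)
  have "(sin_sq_tail_prim has_real_derivative - (- 1 / (2 * x ^ 3)) - (((cos x)\<^sup>2 - (sin x)\<^sup>2) / (2 * x ^ 3) - 3 * sin x * cos x / (2 * x ^ 4))
     - (3 * sin x * cos x / (2 * x ^ 4) - 3 * (sin x)\<^sup>2 / x ^ 5)) (at x)"
    unfolding sin_sq_tail_prim_def [abs_def] by (intro DERIV_diff DERIV_minus 1 2 3)
  moreover have "- (- 1 / (2 * x ^ 3)) - (((cos x)\<^sup>2 - (sin x)\<^sup>2) / (2 * x ^ 3) - 3 * sin x * cos x / (2 * x ^ 4))
     - (3 * sin x * cos x / (2 * x ^ 4) - 3 * (sin x)\<^sup>2 / x ^ 5) = (sin x)\<^sup>2 / x ^ 3 + 3 * (sin x)\<^sup>2 / x ^ 5"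
  proof -
    have "1 / (2 * a) - ((1 - s - s) / (2 * a) - T) - (T - U) = s / a + U" if "a \<noteq> 0" for s a T U :: real
      using that by (simp add: field_simps)
    from this[of "x ^ 3" "(sin x)\<^sup>2"] show ?thesis
      using assms by (simp add: cos_squared_eq)
  qed
  ultimately show ?thesis by (rule DERIV_cong)
qed

lemma nn_integral_sin_sq_cube_tail:
  assumes "0 < a" "sin a = 0"
  shows "(\<integral>\<^sup>+x. ennreal ((sin x)\<^sup>2 / x ^ 3) * indicator {a..} x \<partial>lborel) \<le> ennreal (1 / (4 * a\<^sup>2))"
proof -
  have "(\<integral>\<^sup>+x. ennreal ((sin x)\<^sup>2 / x ^ 3) * indicator {a..} x \<partial>lborel)
     \<le> (\<integral>\<^sup>+x. ennreal ((sin x)\<^sup>2 / x ^ 3 + 3 * (sin x)\<^sup>2 / x ^ 5) * indicator {a..} x \<partial>lborel)"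
    using assms by (intro nn_integral_mono) (auto split: split_indicator intro!: ennreal_leI)
  also have "\<dots> = ennreal (0 - sin_sq_tail_prim a)"
  proof (rule nn_integral_FTC_atLeast)
    show "(sin_sq_tail_prim \<longlongrightarrow> 0) at_top"
      unfolding sin_sq_tail_prim_def by real_asymp
  qed (use assms in \<open>auto intro!: DERIV_sin_sq_tail_prim\<close>)
  also have "0 - sin_sq_tail_prim a = 1 / (4 * a\<^sup>2)"
    using assms by (simp add: sin_sq_tail_prim_def)
  finally show ?thesis .
qed

lemma nn_integral_sin_sq_cube_Icc:
  assumes "0 < a" "a \<le> b" "sin a = 0" "sin b = 0"
  shows "(\<integral>\<^sup>+x. ennreal ((sin x)\<^sup>2 / x ^ 3) * indicator {a..b} x \<partial>lborel) \<le> ennreal (1 / (4 * a\<^sup>2) - 1 / (4 * b\<^sup>2))"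
proof -
  have "(\<integral>\<^sup>+x. ennreal ((sin x)\<^sup>2 / x ^ 3) * indicator {a..b} x \<partial>lborel)
     \<le> (\<integral>\<^sup>+x. ennreal ((sin x)\<^sup>2 / x ^ 3 + 3 * (sin x)\<^sup>2 / x ^ 5) * indicator {a..b} x \<partial>lborel)"
    using assms by (intro nn_integral_mono) (auto split: split_indicator intro!: ennreal_leI)
  also have "\<dots> = ennreal (sin_sq_tail_prim b - sin_sq_tail_prim a)"
    by (rule nn_integral_FTC_Icc)
      (use assms in \<open>auto intro!: has_field_derivative_at_within[OF DERIV_sin_sq_tail_prim]\<close>)
  also have "sin_sq_tail_prim b - sin_sq_tail_prim a = 1 / (4 * a\<^sup>2) - 1 / (4 * b\<^sup>2)"
    using assms by (simp add: sin_sq_tail_prim_def)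
  finally show ?thesis .
qed

text \<open>One factor |sin x| \<le> 1 is given up, because sin^2 x / x^3 has a good bound for its
  integral between zeros of sin.\<close>

lemma abs_sinc_cube_le_tail:
  assumes "0 < x"
  shows "\<bar>sinc x\<bar> ^ 3 \<le> (sin x)\<^sup>2 / x ^ 3"
proof -
  have "\<bar>sin x\<bar> ^ 3 \<le> \<bar>sin x\<bar>\<^sup>2"
    by (rule power_decreasing) auto
  then show ?thesis
    using assms by (simp add: power_divide divide_right_mono)
qed

text \<open>The signed integral is \<open>3 * pi / 8\<close>, and \<open>sinc\<close> is negative only within \<open>[pi, 2 * pi]\<close> and \<open>[3 * pi, \<infinity>)\<close>;
  twice the integral of \<open>sin\<^sup>2 x / x\<^sup>3\<close> over these is at most \<open>31 / (72 * pi\<^sup>2)\<close>. The integral of \<open>sinc\<^sup>2\<close> is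
  added on both sides to keep the integrands nonnegative.\<close>

lemma nn_integral_abs_sinc_cube_half:
  "(\<integral>\<^sup>+x. ennreal (\<bar>sinc x\<bar> ^ 3) * indicator {0..} x \<partial>lborel) \<le> ennreal (3 * pi / 8 + 31 / (72 * pi\<^sup>2))"
proof -
  note borel_measurable_sinc[measurable]
  let ?t = "\<lambda>x::real. ennreal ((sin x)\<^sup>2 / x ^ 3)"
  let ?I = "\<integral>\<^sup>+x. ennreal (\<bar>sinc x\<bar> ^ 3) * indicator {0..} x \<partial>lborel"
  have pt: "ennreal (\<bar>sinc x\<bar> ^ 3) * indicator {0..} x + ennreal ((sinc x)\<^sup>2) * indicator {0..} x
    \<le> ennreal ((sinc x) ^ 3 + (sinc x)\<^sup>2) * indicator {0..} x
      + 2 * (?t x * indicator {pi..2*pi} x + ?t x * indicator {3*pi..} x)" (is "_ \<le> _ + 2 * ?r") for x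
  proof (cases "0 \<le> x")
    case True
    show ?thesis
    proof (cases "0 \<le> sinc x")
      case True
      then have "\<bar>sinc x\<bar> ^ 3 = sinc x ^ 3" by simp
      then have "ennreal (\<bar>sinc x\<bar> ^ 3) * indicator {0..} x + ennreal ((sinc x)\<^sup>2) * indicator {0..} x
        = ennreal ((sinc x) ^ 3 + (sinc x)\<^sup>2) * indicator {0..} x"
        using \<open>0 \<le> x\<close> True by (simp only: ennreal_plus[symmetric] zero_le_power zero_le_power2 indicator_simps atLeast_iff mult_1_right)
      then show ?thesis by simp
    next
      case False
      then have x: "0 < x" "sin x < 0"
        using \<open>0 \<le> x\<close> by (auto simp: zero_le_divide_iff split: if_splits)
      have mem: "x \<in> {pi..2*pi} \<or> x \<in> {3*pi..}"
      proof (rule ccontr)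
        assume "\<not> ?thesis"
        then consider "x < pi" | "2 * pi < x" "x < 3 * pi" by fastforce
        then show False
        proof cases
          case 1
          then show False using x sin_gt_zero[of x] by simp
        next
          case 2
          then have "0 < sin (x - 2 * pi)" by (intro sin_gt_zero) auto
          also have "sin (x - 2 * pi) = sin x" by (simp add: sin_diff)
          finally show False using x by simp
        qed
      qed
      have neg: "sinc x \<le> 0" using False by simp
      have *: "\<bar>s\<bar> ^ 3 + s\<^sup>2 = (s ^ 3 + s\<^sup>2) + 2 * \<bar>s\<bar> ^ 3" if "s \<le> 0" for s :: real
        using that by (simp add: power3_eq_cube abs_if)
      have **: "0 \<le> s ^ 3 + s\<^sup>2" if "\<bar>s\<bar> \<le> 1" for s :: real
      proof -
        have "s ^ 3 + s\<^sup>2 = s\<^sup>2 * (s + 1)" by (simp add: power3_eq_cube power2_eq_square algebra_simps)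
        also have "\<dots> \<ge> 0" using that by (intro mult_nonneg_nonneg) auto
        finally show ?thesis .
      qed
      have "ennreal (\<bar>sinc x\<bar> ^ 3) + ennreal ((sinc x)\<^sup>2) = ennreal (\<bar>sinc x\<bar> ^ 3 + (sinc x)\<^sup>2)"
        by (intro ennreal_plus[symmetric]) (intro zero_le_power abs_ge_zero zero_le_power2)+
      also have "\<bar>sinc x\<bar> ^ 3 + (sinc x)\<^sup>2 = ((sinc x) ^ 3 + (sinc x)\<^sup>2) + 2 * \<bar>sinc x\<bar> ^ 3"
        by (rule *[OF neg])
      also have "ennreal \<dots> = ennreal ((sinc x) ^ 3 + (sinc x)\<^sup>2) + ennreal (2 * \<bar>sinc x\<bar> ^ 3)"
        by (intro ennreal_plus **[OF abs_sinc_le_1] mult_nonneg_nonneg zero_le_power abs_ge_zero) simp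
      also have "ennreal (2 * \<bar>sinc x\<bar> ^ 3) = 2 * ennreal (\<bar>sinc x\<bar> ^ 3)"
        by (subst ennreal_mult) (simp_all only: zero_le_power abs_ge_zero zero_le_numeral ennreal_numeral)
      also have "ennreal (\<bar>sinc x\<bar> ^ 3) \<le> ?t x"
        by (rule ennreal_leI[OF abs_sinc_cube_le_tail[of x]]) (use x in auto)
      also have "?t x \<le> ?r"
        using mem by (auto split: split_indicator)
      finally have "ennreal (\<bar>sinc x\<bar> ^ 3) + ennreal ((sinc x)\<^sup>2) \<le> ennreal ((sinc x) ^ 3 + (sinc x)\<^sup>2) + 2 * ?r"
        by (simp only: add_left_mono mult_left_mono zero_le)
      then show ?thesis
        using \<open>0 \<le> x\<close> by (simp only: indicator_simps atLeast_iff mult_1_right)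
    qed
  qed simp
  have "?I + ennreal (pi / 2) = (\<integral>\<^sup>+x. ennreal (\<bar>sinc x\<bar> ^ 3) * indicator {0..} x + ennreal ((sinc x)\<^sup>2) * indicator {0..} x \<partial>lborel)"
    unfolding nn_integral_sinc_sq_half[symmetric] by (subst nn_integral_add) measurable
  also have "\<dots> \<le> (\<integral>\<^sup>+x. ennreal ((sinc x) ^ 3 + (sinc x)\<^sup>2) * indicator {0..} x
      + 2 * (?t x * indicator {pi..2*pi} x + ?t x * indicator {3*pi..} x) \<partial>lborel)"
    by (rule nn_integral_mono[OF pt])
  also have "\<dots> = (\<integral>\<^sup>+x. ennreal ((sinc x) ^ 3 + (sinc x)\<^sup>2) * indicator {0..} x \<partial>lborel)
      + 2 * ((\<integral>\<^sup>+x. ?t x * indicator {pi..2*pi} x \<partial>lborel) + (\<integral>\<^sup>+x. ?t x * indicator {3*pi..} x \<partial>lborel))"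
  proof -
    have "(\<integral>\<^sup>+x. g1 x + 2 * (g2 x + g3 x) \<partial>lborel) = (\<integral>\<^sup>+x. g1 x \<partial>lborel) + 2 * ((\<integral>\<^sup>+x. g2 x \<partial>lborel) + (\<integral>\<^sup>+x. g3 x \<partial>lborel))"
      if [measurable]: "g1 \<in> borel_measurable borel" "g2 \<in> borel_measurable borel" "g3 \<in> borel_measurable borel" for g1 g2 g3 :: "real \<Rightarrow> ennreal"
      by (simp add: nn_integral_add nn_integral_cmult)
    then show ?thesis
      by this measurable
  qed
  also have "\<dots> \<le> ennreal (3 * pi / 8 + pi / 2) + 2 * (ennreal (1 / (4 * pi\<^sup>2) - 1 / (4 * (2*pi)\<^sup>2)) + ennreal (1 / (4 * (3*pi)\<^sup>2)))"
    unfolding nn_integral_sinc_cube_plus_sq_half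
    by (intro add_mono mult_left_mono nn_integral_sin_sq_cube_tail nn_integral_sin_sq_cube_Icc order_refl) auto
  also have "\<dots> = ennreal (3 * pi / 8 + 31 / (72 * pi\<^sup>2)) + ennreal (pi / 2)"
  proof -
    have 1: "0 \<le> 1 / (4 * pi\<^sup>2) - 1 / (4 * (2*pi)\<^sup>2)"
      by (simp add: field_simps)
    have "ennreal (3 * pi / 8 + pi / 2) + 2 * (ennreal (1 / (4 * pi\<^sup>2) - 1 / (4 * (2*pi)\<^sup>2)) + ennreal (1 / (4 * (3*pi)\<^sup>2)))
       = ennreal ((3 * pi / 8 + pi / 2) + 2 * ((1 / (4 * pi\<^sup>2) - 1 / (4 * (2*pi)\<^sup>2)) + 1 / (4 * (3*pi)\<^sup>2)))"
    proof -
      have "ennreal a + 2 * (ennreal b + ennreal c) = ennreal (a + 2 * (b + c))" if "0 \<le> a" "0 \<le> b" "0 \<le> c" for a b c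
        using that by (simp add: ennreal_mult)
      then show ?thesis by this (use 1 in auto)
    qed
    \<comment> \<open>The new constant is 2 * (1 / 4 - 1 / 16 + 1 / 36) = 31 / 72.\<close>
    also have "(3 * pi / 8 + pi / 2) + 2 * ((1 / (4 * pi\<^sup>2) - 1 / (4 * (2*pi)\<^sup>2)) + 1 / (4 * (3*pi)\<^sup>2)) = (3 * pi / 8 + 31 / (72 * pi\<^sup>2)) + pi / 2"
      by (simp add: field_simps)
    also have "ennreal \<dots> = ennreal (3 * pi / 8 + 31 / (72 * pi\<^sup>2)) + ennreal (pi / 2)"
      by (intro ennreal_plus) auto
    finally show ?thesis .
  qed
  finally show ?thesis
    by (simp add: ennreal_add_left_cancel_le add.commute)
qed

section \<open>A Gaussian bound for sinc, and numerical constants\<close>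

lemma sin_minus_x_cos_nonneg:
  assumes "0 \<le> x" "x \<le> pi"
  shows "0 \<le> sin x - x * cos x"
proof -
  have "sin 0 - 0 * cos 0 \<le> sin x - x * cos x"
  proof (rule DERIV_nonneg_imp_nondecreasing[OF assms(1)])
    fix y assume y: "0 \<le> y" "y \<le> x"
    have "((\<lambda>x. sin x - x * cos x) has_real_derivative y * sin y) (at y)"
      by (auto intro!: derivative_eq_intros)
    moreover have "0 \<le> y * sin y"
      using y assms by (intro mult_nonneg_nonneg sin_ge_zero) auto
    ultimately show "\<exists>d. ((\<lambda>x. sin x - x * cos x) has_real_derivative d) (at y) \<and> 0 \<le> d" by blast
  qed
  then show ?thesis by simp
qed

text \<open>Multiplied by - exp (x^2 / 6) / x^2, this expression is the derivative of sinc x * exp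
  (x^2 / 6). Its own derivative is x / 3 times the quantity in
  \<open>sin_minus_x_cos_nonneg\<close>.\<close>

lemma sin_minus_x_cos_ge:
  assumes "0 \<le> x" "x \<le> pi"
  shows "0 \<le> sin x - x * cos x - x\<^sup>2 / 3 * sin x"
proof -
  have "sin 0 - 0 * cos 0 - 0\<^sup>2 / 3 * sin 0 \<le> sin x - x * cos x - x\<^sup>2 / 3 * sin x"
  proof (rule DERIV_nonneg_imp_nondecreasing[OF assms(1)])
    fix y assume y: "0 \<le> y" "y \<le> x"
    have "((\<lambda>x. sin x - x * cos x - x\<^sup>2 / 3 * sin x) has_real_derivative y / 3 * (sin y - y * cos y)) (at y)"
      by (auto intro!: derivative_eq_intros simp: field_simps power2_eq_square)
    moreover have "0 \<le> y / 3 * (sin y - y * cos y)"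
      using y assms by (intro mult_nonneg_nonneg sin_minus_x_cos_nonneg) auto
    ultimately show "\<exists>d. ((\<lambda>x. sin x - x * cos x - x\<^sup>2 / 3 * sin x) has_real_derivative d) (at y) \<and> 0 \<le> d" by blast
  qed
  then show ?thesis by simp
qed

text \<open>The quotient of the two sides decreases from its value 1 at 0. The exponent is dictated
  by the expansion 1 - x^2 / 6 of \<open>sinc\<close>.\<close>

lemma sinc_le_gaussian:
  assumes "0 \<le> x" "x \<le> pi"
  shows "sinc x \<le> exp (- x\<^sup>2 / 6)"
proof -
  have "sinc x * exp (x\<^sup>2 / 6) \<le> sinc 0 * exp (0\<^sup>2 / 6)"
  proof (rule DERIV_nonpos_imp_decreasing_open[OF assms(1)])
    show "continuous_on {0..x} (\<lambda>x. sinc x * exp (x\<^sup>2 / 6))"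
      by (intro continuous_on_mult continuous_on_sinc continuous_intros) auto
    fix y assume y: "0 < y" "y < x"
    have "((\<lambda>y. exp (y\<^sup>2 / 6)) has_real_derivative (exp (y\<^sup>2 / 6) * (y / 3))) (at y)"
      by (auto intro!: derivative_eq_intros)
    from DERIV_mult[OF DERIV_sinc this] y
    have "((\<lambda>x. sinc x * exp (x\<^sup>2 / 6)) has_real_derivative
        (y * cos y - sin y) / y\<^sup>2 * exp (y\<^sup>2 / 6) + exp (y\<^sup>2 / 6) * (y / 3) * sinc y) (at y)"
      by blast
    moreover have "(y * cos y - sin y) / y\<^sup>2 * exp (y\<^sup>2 / 6) + exp (y\<^sup>2 / 6) * (y / 3) * sinc y \<le> 0"
    proof -
      have "(y * cos y - sin y) / y\<^sup>2 * exp (y\<^sup>2 / 6) + exp (y\<^sup>2 / 6) * (y / 3) * sinc y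
         = - ((sin y - y * cos y - y\<^sup>2 / 3 * sin y) * (exp (y\<^sup>2 / 6) / y\<^sup>2))"
        using y by (simp add: field_simps power2_eq_square)
      moreover have "0 \<le> (sin y - y * cos y - y\<^sup>2 / 3 * sin y) * (exp (y\<^sup>2 / 6) / y\<^sup>2)"
        using y assms by (intro mult_nonneg_nonneg sin_minus_x_cos_ge) auto
      ultimately show ?thesis by (simp only: neg_le_0_iff_le)
    qed
    ultimately show "\<exists>d. ((\<lambda>x. sinc x * exp (x\<^sup>2 / 6)) has_real_derivative d) (at y) \<and> d \<le> 0"
      by (intro exI conjI)
  qed
  then have "sinc x * exp (x\<^sup>2 / 6) \<le> 1" by simp
  then have "sinc x \<le> 1 / exp (x\<^sup>2 / 6)"
    by (simp add: pos_le_divide_eq del: if_split)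
  then show ?thesis
    by (simp add: exp_minus field_simps)
qed

lemma nn_integral_gaussian_half:
  assumes "0 < p"
  shows "(\<integral>\<^sup>+x. ennreal (exp (- p * x\<^sup>2 / 6)) * indicator {0..} x \<partial>lborel) = ennreal (sqrt (6 * pi / p) / 2)"
proof -
  define c where "c = sqrt (6 / p)"
  have c: "0 < c" "c\<^sup>2 = 6 / p" using assms by (auto simp: c_def)
  have "(\<integral>\<^sup>+x. ennreal (exp (- p * x\<^sup>2 / 6)) * indicator {0..} x \<partial>lborel)
      = \<bar>c\<bar> * (\<integral>\<^sup>+x. ennreal (exp (- p * (0 + c * x)\<^sup>2 / 6)) * indicator {0..} (0 + c * x) \<partial>lborel)"
    using c by (intro nn_integral_real_affine) auto
  also have "(\<integral>\<^sup>+x. ennreal (exp (- p * (0 + c * x)\<^sup>2 / 6)) * indicator {0..} (0 + c * x) \<partial>lborel)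
     = (\<integral>\<^sup>+x. ennreal (indicator {0..} x *\<^sub>R exp (- x\<^sup>2)) \<partial>lborel)"
  proof (rule nn_integral_cong)
    fix x :: real
    have "- p * (0 + c * x)\<^sup>2 / 6 = - x\<^sup>2"
      using assms c by (simp add: power_mult_distrib)
    then show "ennreal (exp (- p * (0 + c * x)\<^sup>2 / 6)) * indicator {0..} (0 + c * x) = ennreal (indicator {0..} x *\<^sub>R exp (- x\<^sup>2))"
      using c(1) by (auto simp: zero_le_mult_iff split: split_indicator)
  qed
  also have "\<dots> = ennreal (sqrt pi / 2)"
    using gaussian_moment_0 by (intro nn_integral_eq_integral[THEN trans])
      (auto simp: has_bochner_integral_iff split: split_indicator)
  also have "\<bar>c\<bar> * ennreal (sqrt pi / 2) = ennreal (sqrt (6 * pi / p) / 2)"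
    using c(1) assms by (simp flip: ennreal_mult add: c_def real_sqrt_mult real_sqrt_divide)
  finally show ?thesis .
qed

text \<open>The case p = 3 of the bound for large exponents, multiplied by 2 * sqrt 3. Only about
  0.013 is to spare, so the difference pi * sqrt 2 - sqrt (6 * pi) is factored before it is
  estimated.\<close>

lemma pi_sqrt_bound: "sqrt (6 * pi) + sqrt 3 / (2 * pi\<^sup>2) \<le> pi * sqrt 2"
proof -
  have pi: "3.14 \<le> pi" using pi_approx by simp
  have s: "1.414 \<le> sqrt 2" "sqrt 3 \<le> 1.7321" "1.771 \<le> sqrt pi"
    using pi by (intro real_le_rsqrt real_le_lsqrt; simp add: power2_eq_square)+
  have "sqrt 3 / (2 * pi\<^sup>2) \<le> 1.7321 / (2 * 3.14\<^sup>2)"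
    using s pi by (intro frac_le mult_mono power_mono) auto
  also have "\<dots> \<le> 1.414 * 1.771 * (1.771 - 1.7321)"
    by (simp add: power2_eq_square)
  also have "\<dots> \<le> sqrt 2 * sqrt pi * (sqrt pi - sqrt 3)"
    using s by (intro mult_mono diff_mono mult_nonneg_nonneg) auto
  also have "\<dots> = pi * sqrt 2 - sqrt (6 * pi)"
  proof -
    have "sqrt 2 * sqrt pi * sqrt 3 = sqrt (6 * pi)"
      by (simp flip: real_sqrt_mult)
    moreover have "sqrt 2 * sqrt pi * sqrt pi = pi * sqrt 2"
      by simp
    ultimately show ?thesis by (simp add: right_diff_distrib)
  qed
  finally show ?thesis by simp
qed

text \<open>The left side of 1 + y \<le> exp y is close enough at y = - 1 / 256; the 64-th power
  then gives the exponent - 1 / 4.\<close>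

lemma exp_minus_quarter_ge: "0.7784 \<le> exp (- 1 / 4 :: real)"
proof -
  have "(0.7784::real) \<le> (255 / 256) ^ 64"
    by (simp add: power_divide)
  also have "\<dots> \<le> exp (- 1 / 256) ^ 64"
    using exp_ge_add_one_self[of "- 1 / 256"] by (intro power_mono) auto
  also have "\<dots> = exp (- 1 / 4)"
    by (simp flip: exp_of_nat_mult)
  finally show ?thesis .
qed

text \<open>exp (- 1 / 4) is the value at p = 3 of exp (- (p - 2) / 4), which touches sqrt (2 / p)
  at p = 2 and stays below it. Ball's inequality at p = 3 alone would only ask for sqrt (2 / 3); the
  interpolation down to p = 2 uses this smaller value.\<close>

lemma pi_cube_bound: "3 * pi / 8 + 31 / (72 * pi\<^sup>2) \<le> pi / 2 * exp (- 1 / 4)"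
proof -
  have pi: "3.14 \<le> pi" using pi_approx by simp
  have "31 / (72 * pi\<^sup>2) \<le> 31 / (72 * 3.14\<^sup>2)"
    using pi by (intro divide_left_mono mult_left_mono power_mono) auto
  also have "\<dots> \<le> 3.14 * (0.7784 / 2 - 3 / 8)"
    by (simp add: power2_eq_square)
  also have "\<dots> \<le> pi * (exp (- 1 / 4) / 2 - 3 / 8)"
    using pi exp_minus_quarter_ge by (intro mult_mono) auto
  finally show ?thesis by (simp add: algebra_simps)
qed

section \<open>Ball's inequality for all exponents from 2 on\<close>

lemma ennreal_lincomb:
  "0 \<le> a \<Longrightarrow> 0 \<le> b \<Longrightarrow> 0 \<le> u \<Longrightarrow> 0 \<le> v \<Longrightarrow>
    ennreal (a * u + b * v) = ennreal a * ennreal u + ennreal b * ennreal v"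
  by (simp add: ennreal_mult)

text \<open>Hoelder interpolation between the moments 2 and 3: s^p is (s^2)^(3 - p) * (s^3)^(p - 2),
  and Young's inequality is applied after both powers are divided by the bounds \<open>A\<close> and
  \<open>B\<close> of their integrals. The result A^(3 - p) * B^(p - 2) is pi / 2 * exp (- (p - 2) /
  4), which is below the claim because ln (p / 2) is at most p / 2 - 1.\<close>

lemma nn_integral_sinc_powr_half_small:
  assumes p: "2 \<le> p" "p \<le> 3"
  shows "(\<integral>\<^sup>+x. ennreal (\<bar>sinc x\<bar> powr p) * indicator {0..} x \<partial>lborel) \<le> ennreal (pi / 2 * sqrt (2 / p))"
proof -
  define A B where "A = pi / 2" and "B = pi / 2 * exp (- 1 / 4)"
  have AB: "0 < A" "0 < B" by (simp_all add: A_def B_def)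
  define D where "D = A powr (3 - p) * B powr (p - 2)"
  have D: "0 < D" using AB by (simp add: D_def)
  have pt: "s powr p \<le> D * ((3 - p) * (s\<^sup>2 / A) + (p - 2) * (s ^ 3 / B))" if s: "0 \<le> s" for s :: real
  proof (cases "s = 0")
    case False
    then have "0 < s" using s by simp
    have "(s\<^sup>2 / A) powr (3 - p) * (s ^ 3 / B) powr (p - 2) \<le> (3 - p) * (s\<^sup>2 / A) + (p - 2) * (s ^ 3 / B)"
      using p AB \<open>0 < s\<close> by (intro Youngs_inequality_0) auto
    moreover have "(s\<^sup>2 / A) powr (3 - p) * (s ^ 3 / B) powr (p - 2) = s powr p / D"
    proof -
      have "(s\<^sup>2) powr (3 - p) * (s ^ 3) powr (p - 2) = s powr p"
      proof -
        have pw: "s\<^sup>2 = s powr 2" "s ^ 3 = s powr 3"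
          using \<open>0 < s\<close> by simp_all
        have "(s\<^sup>2) powr (3 - p) * (s ^ 3) powr (p - 2) = s powr (2 * (3 - p)) * s powr (3 * (p - 2))"
          unfolding pw powr_powr ..
        also have "\<dots> = s powr (2 * (3 - p) + 3 * (p - 2))"
          by (rule powr_add[symmetric])
        also have "2 * (3 - p) + 3 * (p - 2) = p" by simp
        finally show ?thesis .
      qed
      then show ?thesis
        using AB \<open>0 < s\<close> by (simp add: powr_divide D_def)
    qed
    ultimately show ?thesis
      using D by (simp add: divide_le_eq mult.commute)
  qed (use p in simp)
  have I2: "(\<integral>\<^sup>+x. ennreal (\<bar>sinc x\<bar>\<^sup>2) * indicator {0..} x \<partial>lborel) = ennreal A"
    unfolding power2_abs A_def by (rule nn_integral_sinc_sq_half)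
  have I3: "(\<integral>\<^sup>+x. ennreal (\<bar>sinc x\<bar> ^ 3) * indicator {0..} x \<partial>lborel) \<le> ennreal B"
    using order_trans[OF nn_integral_abs_sinc_cube_half ennreal_leI[OF pi_cube_bound]] by (simp add: B_def)
  have gen: "(\<integral>\<^sup>+x. ennreal (g x powr p) * indicator {0..} x \<partial>lborel) \<le> ennreal D"
    if [measurable]: "g \<in> borel_measurable borel" and g: "\<And>x. 0 \<le> g x"
      and I2: "(\<integral>\<^sup>+x. ennreal ((g x)\<^sup>2) * indicator {0..} x \<partial>lborel) = ennreal A"
      and I3: "(\<integral>\<^sup>+x. ennreal (g x ^ 3) * indicator {0..} x \<partial>lborel) \<le> ennreal B" for g :: "real \<Rightarrow> real"
  proof -
    have "(\<integral>\<^sup>+x. ennreal (g x powr p) * indicator {0..} x \<partial>lborel)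
       \<le> (\<integral>\<^sup>+x. ennreal (D * (3 - p) / A) * (ennreal ((g x)\<^sup>2) * indicator {0..} x)
            + ennreal (D * (p - 2) / B) * (ennreal (g x ^ 3) * indicator {0..} x) \<partial>lborel)"
    proof (rule nn_integral_mono)
      fix x
      have "ennreal (g x powr p) \<le> ennreal (D * ((3 - p) * ((g x)\<^sup>2 / A) + (p - 2) * (g x ^ 3 / B)))"
        by (intro ennreal_leI pt g)
      also have "D * ((3 - p) * ((g x)\<^sup>2 / A) + (p - 2) * (g x ^ 3 / B)) = D * (3 - p) / A * (g x)\<^sup>2 + D * (p - 2) / B * (g x ^ 3)"
        by (simp add: field_simps)
      also have "ennreal \<dots> = ennreal (D * (3 - p) / A) * ennreal ((g x)\<^sup>2) + ennreal (D * (p - 2) / B) * ennreal (g x ^ 3)"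
        by (rule ennreal_lincomb) (use D p AB g[of x] in auto)
      finally show "ennreal (g x powr p) * indicator {0..} x
        \<le> ennreal (D * (3 - p) / A) * (ennreal ((g x)\<^sup>2) * indicator {0..} x)
            + ennreal (D * (p - 2) / B) * (ennreal (g x ^ 3) * indicator {0..} x)"
        by (auto split: split_indicator)
    qed
    also have "\<dots> = ennreal (D * (3 - p) / A) * (\<integral>\<^sup>+x. ennreal ((g x)\<^sup>2) * indicator {0..} x \<partial>lborel)
            + ennreal (D * (p - 2) / B) * (\<integral>\<^sup>+x. ennreal (g x ^ 3) * indicator {0..} x \<partial>lborel)"
      by (simp add: nn_integral_add nn_integral_cmult)
    also have "\<dots> \<le> ennreal (D * (3 - p) / A) * ennreal A + ennreal (D * (p - 2) / B) * ennreal B"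
      using I2 I3 by (intro add_mono mult_left_mono) auto
    also have "\<dots> = ennreal (D * (3 - p) / A * A + D * (p - 2) / B * B)"
      by (rule ennreal_lincomb[symmetric]) (use D p AB in auto)
    also have "D * (3 - p) / A * A + D * (p - 2) / B * B = D * (3 - p) + D * (p - 2)"
      using AB by simp
    also have "\<dots> = D"
      by (simp add: algebra_simps)
    finally show ?thesis .
  qed
  have "(\<integral>\<^sup>+x. ennreal (\<bar>sinc x\<bar> powr p) * indicator {0..} x \<partial>lborel) \<le> ennreal D"
    by (rule gen[OF _ abs_ge_zero I2 I3]) (intro borel_measurable_abs borel_measurable_sinc)
  also have "D \<le> pi / 2 * sqrt (2 / p)"
  proof -
    have "D = pi / 2 * exp (- ((p - 2) / 4))"
    proof -
      have "B powr (p - 2) = A powr (p - 2) * exp (- 1 / 4) powr (p - 2)"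
        unfolding A_def B_def by (rule powr_mult)
      also have "exp (- 1 / 4) powr (p - 2) = exp (- ((p - 2) / 4))"
        by (simp add: exp_powr_real)
      finally have "D = (A powr (3 - p) * A powr (p - 2)) * exp (- ((p - 2) / 4))"
        by (simp add: D_def)
      also have "A powr (3 - p) * A powr (p - 2) = A powr 1"
        unfolding powr_add[symmetric] by simp
      finally show ?thesis using AB by (simp add: A_def)
    qed
    moreover have "exp (- ((p - 2) / 4)) \<le> sqrt (2 / p)"
    proof -
      have "ln (p / 2) \<le> p / 2 - 1" using p by (intro ln_le_minus_one) auto
      then have "p / 2 \<le> exp ((p - 2) / 2)"
        using p by (metis diff_divide_distrib div_self exp_le_cancel_iff exp_ln half_gt_zero_iff less_le_trans zero_less_numeral zero_neq_numeral)
      then have "exp (- ((p - 2) / 2)) \<le> 2 / p"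
        using p by (simp add: exp_minus field_simps)
      moreover have "exp (- ((p - 2) / 4)) = sqrt (exp (- ((p - 2) / 2)))"
        by (rule real_sqrt_unique[symmetric]) (auto simp flip: exp_double)
      ultimately show ?thesis by simp
    qed
    ultimately show ?thesis by simp
  qed
  finally show ?thesis by (simp add: ennreal_leI)
qed

text \<open>Beyond pi, |sinc| is at most 1 / pi, so the p - 3 powers in excess of the third
  contribute a factor of at most pi^(3 - p).\<close>

lemma abs_sinc_powr_tail:
  assumes "pi \<le> x" "3 \<le> p"
  shows "\<bar>sinc x\<bar> powr p \<le> pi powr (3 - p) * ((sin x)\<^sup>2 / x ^ 3)"
proof -
  have x: "0 < x" using assms pi_gt_zero by linarith
  define s where "s = \<bar>sinc x\<bar>"
  have s0: "0 \<le> s" by (simp add: s_def)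
  have s1: "s \<le> 1 / pi"
  proof -
    have "s \<le> 1 / x"
      using x by (simp add: s_def divide_right_mono)
    also have "\<dots> \<le> 1 / pi"
      using assms x by (intro divide_left_mono) auto
    finally show ?thesis .
  qed
  have "s powr p \<le> pi powr (3 - p) * s ^ 3"
  proof (cases "s = 0")
    case False
    then have "0 < s" using s0 by simp
    have "s powr p = s powr (p - 3) * s powr 3"
      by (simp flip: powr_add)
    also have "s powr 3 = s ^ 3"
      using \<open>0 < s\<close> by simp
    also have "s powr (p - 3) \<le> (1 / pi) powr (p - 3)"
      using s0 s1 assms by (intro powr_mono2) auto
    also have "(1 / pi) powr (p - 3) = pi powr (3 - p)"
      using powr_minus_divide[of pi "p - 3"] by (simp add: powr_divide)
    finally show ?thesis
      using s0 by (simp add: mult_right_mono)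
  qed (use assms in simp)
  also have "s ^ 3 \<le> (sin x)\<^sup>2 / x ^ 3"
    unfolding s_def by (rule abs_sinc_cube_le_tail[OF x])
  finally show ?thesis
    by (simp only: s_def mult_left_mono powr_ge_zero)
qed

text \<open>The Gaussian bound is integrated over the whole half-line, the tail bound from pi on.
  Multiplied by 2 * sqrt p, the inequality that remains depends on p only through sqrt p * pi^(3 -
  p). This is at most its value at p = 3, where \<open>pi_sqrt_bound\<close> applies.\<close>

lemma nn_integral_sinc_powr_half_large:
  assumes p: "3 \<le> p"
  shows "(\<integral>\<^sup>+x. ennreal (\<bar>sinc x\<bar> powr p) * indicator {0..} x \<partial>lborel) \<le> ennreal (pi / 2 * sqrt (2 / p))"
proof -
  have pt: "ennreal (\<bar>sinc x\<bar> powr p) * indicator {0..} x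
     \<le> ennreal (exp (- p * x\<^sup>2 / 6)) * indicator {0..} x
       + ennreal (pi powr (3 - p)) * (ennreal ((sin x)\<^sup>2 / x ^ 3) * indicator {pi..} x)" for x
  proof -
    consider "x < 0" | "0 \<le> x" "x \<le> pi" | "pi < x" by linarith
    then show ?thesis
    proof cases
      case 2
      have "0 \<le> sinc x" using 2 sin_ge_zero[of x] by auto
      then have "\<bar>sinc x\<bar> \<le> exp (- x\<^sup>2 / 6)"
        using sinc_le_gaussian[OF 2] by (simp only: abs_of_nonneg)
      then have "\<bar>sinc x\<bar> powr p \<le> exp (- x\<^sup>2 / 6) powr p"
        by (intro powr_mono2 abs_ge_zero) (use p in simp)
      also have "\<dots> = exp (- p * x\<^sup>2 / 6)"
        by (simp add: exp_powr_real)
      finally have "ennreal (\<bar>sinc x\<bar> powr p) \<le> ennreal (exp (- p * x\<^sup>2 / 6))"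
        by (rule ennreal_leI)
      then have "ennreal (\<bar>sinc x\<bar> powr p) * indicator {0..} x \<le> ennreal (exp (- p * x\<^sup>2 / 6)) * indicator {0..} x"
        by (rule mult_right_mono) simp
      then show ?thesis
        by (rule order_trans) simp
    next
      case 3
      have x: "0 \<le> x" using 3 pi_gt_zero by linarith
      have "ennreal (\<bar>sinc x\<bar> powr p) \<le> ennreal (pi powr (3 - p) * ((sin x)\<^sup>2 / x ^ 3))"
        using 3 p by (intro ennreal_leI abs_sinc_powr_tail) auto
      also have "\<dots> = ennreal (pi powr (3 - p)) * ennreal ((sin x)\<^sup>2 / x ^ 3)"
        using x by (intro ennreal_mult) auto
      finally have "ennreal (\<bar>sinc x\<bar> powr p) \<le> ennreal (pi powr (3 - p)) * ennreal ((sin x)\<^sup>2 / x ^ 3)" .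
      then show ?thesis
        using 3 x by (simp only: indicator_simps atLeast_iff mult_1_right less_imp_le add_increasing zero_le)
    qed simp
  qed
  have "(\<integral>\<^sup>+x. ennreal (\<bar>sinc x\<bar> powr p) * indicator {0..} x \<partial>lborel)
     \<le> (\<integral>\<^sup>+x. ennreal (exp (- p * x\<^sup>2 / 6)) * indicator {0..} x
       + ennreal (pi powr (3 - p)) * (ennreal ((sin x)\<^sup>2 / x ^ 3) * indicator {pi..} x) \<partial>lborel)"
    by (rule nn_integral_mono[OF pt])
  also have "\<dots> = (\<integral>\<^sup>+x. ennreal (exp (- p * x\<^sup>2 / 6)) * indicator {0..} x \<partial>lborel)
      + ennreal (pi powr (3 - p)) * (\<integral>\<^sup>+x. ennreal ((sin x)\<^sup>2 / x ^ 3) * indicator {pi..} x \<partial>lborel)"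
    by (subst nn_integral_add) (auto simp: nn_integral_cmult)
  also have "\<dots> \<le> ennreal (sqrt (6 * pi / p) / 2) + ennreal (pi powr (3 - p)) * ennreal (1 / (4 * pi\<^sup>2))"
    using p by (intro add_mono mult_left_mono nn_integral_sin_sq_cube_tail order_eq_refl[OF nn_integral_gaussian_half]) auto
  also have "\<dots> = ennreal (sqrt (6 * pi / p) / 2 + pi powr (3 - p) * (1 / (4 * pi\<^sup>2)))"
    using p by (simp flip: ennreal_mult)
  also have "sqrt (6 * pi / p) / 2 + pi powr (3 - p) * (1 / (4 * pi\<^sup>2)) \<le> pi / 2 * sqrt (2 / p)"
  proof -
    have ln: "1 \<le> ln pi"
      using exp_le pi_gt3 by (subst ln_ge_iff) auto
    have "1 + (p - 3) \<le> exp (p - 3)" by (rule exp_ge_add_one_self)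
    also have "\<dots> \<le> exp ((p - 3) * ln pi)"
      using p mult_left_mono[OF ln, of "p - 3"] by simp
    also have "\<dots> = pi powr (p - 3)" by (simp add: powr_def)
    finally have q: "1 + (p - 3) \<le> pi powr (p - 3)" .
    \<comment> \<open>Equality holds at p = 3; the base 1 + (p - 3) is then replaced by the larger
      pi^(p - 3).\<close>
    have "p \<le> 3 * (1 + (p - 3))\<^sup>2"
      using p by (sos | simp add: power2_eq_square algebra_simps)
    also have "\<dots> \<le> 3 * (pi powr (p - 3))\<^sup>2"
      using q p by (intro mult_left_mono power_mono) auto
    finally have "sqrt p \<le> sqrt (3 * (pi powr (p - 3))\<^sup>2)"
      by (rule real_sqrt_le_mono)
    then have "sqrt p \<le> sqrt 3 * pi powr (p - 3)"
      by (simp add: real_sqrt_mult)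
    then have "sqrt p * pi powr (3 - p) \<le> (sqrt 3 * pi powr (p - 3)) * pi powr (3 - p)"
      by (intro mult_right_mono) auto
    also have "\<dots> = sqrt 3"
      by (simp add: mult.assoc flip: powr_add)
    finally have "sqrt p * pi powr (3 - p) / (2 * pi\<^sup>2) \<le> sqrt 3 / (2 * pi\<^sup>2)"
      by (intro divide_right_mono) auto
    then have "sqrt (6 * pi) + sqrt p * pi powr (3 - p) / (2 * pi\<^sup>2) \<le> pi * sqrt 2"
      using pi_sqrt_bound by linarith
    then have "(sqrt (6 * pi) + sqrt p * pi powr (3 - p) / (2 * pi\<^sup>2)) / (2 * sqrt p) \<le> pi * sqrt 2 / (2 * sqrt p)"
      using p by (intro divide_right_mono) auto
    moreover have "(sqrt (6 * pi) + sqrt p * pi powr (3 - p) / (2 * pi\<^sup>2)) / (2 * sqrt p)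
       = sqrt (6 * pi / p) / 2 + pi powr (3 - p) * (1 / (4 * pi\<^sup>2))"
      using p by (simp add: add_divide_distrib real_sqrt_divide)
    ultimately show ?thesis
      by (simp add: real_sqrt_divide)
  qed
  finally show ?thesis by (simp add: ennreal_leI)
qed

lemma nn_integral_even_le:
  fixes f :: "real \<Rightarrow> ennreal"
  assumes [measurable]: "f \<in> borel_measurable borel" and even: "\<And>x. f (- x) = f x"
  shows "(\<integral>\<^sup>+x. f x \<partial>lborel) \<le> 2 * (\<integral>\<^sup>+x. f x * indicator {0..} x \<partial>lborel)"
proof -
  have "(\<integral>\<^sup>+x. f x \<partial>lborel) \<le> (\<integral>\<^sup>+x. f x * indicator {0..} x + f x * indicator {..0} x \<partial>lborel)"
    by (intro nn_integral_mono) (auto split: split_indicator)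
  also have "\<dots> = (\<integral>\<^sup>+x. f x * indicator {0..} x \<partial>lborel) + (\<integral>\<^sup>+x. f x * indicator {..0} x \<partial>lborel)"
    by (rule nn_integral_add) auto
  also have "(\<integral>\<^sup>+x. f x * indicator {..0} x \<partial>lborel) = (\<integral>\<^sup>+x. f (0 + (-1) * x) * indicator {..0} (0 + (-1) * x) \<partial>lborel)"
    using nn_integral_real_affine[of "\<lambda>x. f x * indicator {..0} x" "-1" 0] by simp
  also have "\<dots> = (\<integral>\<^sup>+x. f x * indicator {0..} x \<partial>lborel)"
    by (intro nn_integral_cong) (auto simp: even split: split_indicator)
  finally show ?thesis by (simp add: mult_2)
qed

text \<open>Ball's integral inequality in the normalization sin x / x, an equality at p = 2.\<close>

lemma nn_integral_sinc_powr:
  assumes p: "2 \<le> p"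
  shows "(\<integral>\<^sup>+x. ennreal (\<bar>sinc x\<bar> powr p) \<partial>lborel) \<le> ennreal (pi * sqrt (2 / p))"
proof -
  have meas: "(\<lambda>x. ennreal (\<bar>g x\<bar> powr p)) \<in> borel_measurable borel" if [measurable]: "g \<in> borel_measurable borel" for g :: "real \<Rightarrow> real"
    by measurable
  have "(\<integral>\<^sup>+x. ennreal (\<bar>sinc x\<bar> powr p) \<partial>lborel) \<le> 2 * (\<integral>\<^sup>+x. ennreal (\<bar>sinc x\<bar> powr p) * indicator {0..} x \<partial>lborel)"
    by (rule nn_integral_even_le[OF meas[OF borel_measurable_sinc]]) (simp only: sinc_neg)
  also have "(\<integral>\<^sup>+x. ennreal (\<bar>sinc x\<bar> powr p) * indicator {0..} x \<partial>lborel) \<le> ennreal (pi / 2 * sqrt (2 / p))"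
  proof (cases "p \<le> 3")
    case True
    then show ?thesis by (intro nn_integral_sinc_powr_half_small p)
  next
    case False
    then show ?thesis by (intro nn_integral_sinc_powr_half_large) simp
  qed
  also have "2 * ennreal (pi / 2 * sqrt (2 / p)) = ennreal (2 * (pi / 2 * sqrt (2 / p)))"
    using p by (subst ennreal_mult) auto
  finally show ?thesis by (simp only: mult_left_mono zero_le times_divide_eq_left mult.assoc nonzero_mult_div_cancel_left) simp
qed

section \<open>Orthogonal projections and a determinant inequality\<close>

context
  fixes E :: "'a::euclidean_space set"
  assumes E: "subspace E"
begin

lemma orth_proj_in: "orth_proj E x \<in> E"
  using orth_proj[OF E] by blast

lemma inner_orth_proj_diff: "e \<in> E \<Longrightarrow> (x - orth_proj E x) \<bullet> e = 0"
  using orth_proj[OF E] by (auto simp: orthogonal_def)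

lemma orth_proj_unique:
  assumes "y \<in> E" "\<And>e. e \<in> E \<Longrightarrow> (x - y) \<bullet> e = 0"
  shows "orth_proj E x = y"
proof -
  have d: "orth_proj E x - y \<in> E"
    using E assms(1) orth_proj_in by (simp add: subspace_diff)
  have "(orth_proj E x - y) \<bullet> (orth_proj E x - y) = (x - y) \<bullet> (orth_proj E x - y) - (x - orth_proj E x) \<bullet> (orth_proj E x - y)"
    by (simp add: inner_diff_left)
  also have "\<dots> = 0"
    using assms(2)[OF d] inner_orth_proj_diff[OF d] by simp
  finally show ?thesis by simp
qed

lemma orth_proj_fixed: "x \<in> E \<Longrightarrow> orth_proj E x = x"
  by (rule orth_proj_unique) auto

lemma orth_proj_linear: "linear (orth_proj E)"
proof (rule linearI)
  fix x y
  show "orth_proj E (x + y) = orth_proj E x + orth_proj E y"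
  proof (rule orth_proj_unique)
    fix e assume "e \<in> E"
    then show "(x + y - (orth_proj E x + orth_proj E y)) \<bullet> e = 0"
      using inner_orth_proj_diff[of e x] inner_orth_proj_diff[of e y] by (simp add: inner_diff_left inner_add_left)
  qed (simp add: subspace_add[OF E] orth_proj_in)
next
  fix c x
  show "orth_proj E (c *\<^sub>R x) = c *\<^sub>R orth_proj E x"
  proof (rule orth_proj_unique)
    fix e assume "e \<in> E"
    then show "(c *\<^sub>R x - c *\<^sub>R orth_proj E x) \<bullet> e = 0"
      using inner_orth_proj_diff[of e x] by (simp flip: scaleR_diff_right)
  qed (simp add: subspace_scale[OF E] orth_proj_in)
qed

lemma orth_proj_inner_left: "orth_proj E x \<bullet> y = orth_proj E x \<bullet> orth_proj E y"
  using inner_orth_proj_diff[OF orth_proj_in, of y x] by (simp add: inner_diff_left inner_diff_right inner_commute)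

lemma orth_proj_selfadjoint: "orth_proj E x \<bullet> y = x \<bullet> orth_proj E y"
  using orth_proj_inner_left[of x y] orth_proj_inner_left[of y x] by (simp add: inner_commute)

lemma norm_orth_proj_decomp: "(norm x)\<^sup>2 = (norm (orth_proj E x))\<^sup>2 + (norm (x - orth_proj E x))\<^sup>2"
proof -
  have "orth_proj E x \<bullet> (x - orth_proj E x) = 0"
    using inner_orth_proj_diff[OF orth_proj_in, of x x] by (simp add: inner_commute)
  then show ?thesis
    using norm_add_Pythagorean[of "orth_proj E x" "x - orth_proj E x"] by (simp add: orthogonal_def)
qed

lemma norm_orth_proj_le: "norm (orth_proj E x) \<le> norm x"
  using norm_orth_proj_decomp[of x] by (intro power2_le_imp_le[of "norm (orth_proj E x)"]) auto

text \<open>Both sides are the trace of the projection: the double sum over \<open>Basis\<close> and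
  an orthonormal basis of \<open>E\<close> is evaluated in both orders.\<close>

lemma sum_norm_orth_proj_Basis: "(\<Sum>b\<in>Basis. (norm (orth_proj E b))\<^sup>2) = real (dim E)"
proof -
  obtain B where B: "B \<subseteq> E" "pairwise orthogonal B" "\<And>x. x \<in> B \<Longrightarrow> norm x = 1" "independent B" "card B = dim E" "span B = E"
    using orthonormal_basis_subspace[OF E] by metis
  have fin: "finite B" using B(4) independent_imp_finite by blast
  have "(norm (orth_proj E x))\<^sup>2 = (\<Sum>b\<in>B. (x \<bullet> b)\<^sup>2)" for x
  proof -
    have "orth_proj E x = (\<Sum>b\<in>B. (b \<bullet> orth_proj E x) *\<^sub>R b)"
      using orthonormal_basis_expand[OF B(2) B(3) _ fin, of "orth_proj E x"] B(6) orth_proj_in[of x] by (simp add: inner_commute)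
    then have "orth_proj E x \<bullet> orth_proj E x = (\<Sum>b\<in>B. (b \<bullet> orth_proj E x) *\<^sub>R b) \<bullet> orth_proj E x"
      by simp
    also have "\<dots> = (\<Sum>b\<in>B. (x \<bullet> b)\<^sup>2)"
      unfolding inner_sum_left
    proof (rule sum.cong[OF refl])
      fix b assume "b \<in> B"
      then have "b \<bullet> orth_proj E x = x \<bullet> b"
        using B(1) orth_proj_fixed[of b] orth_proj_selfadjoint[of x b] by (auto simp: inner_commute)
      then show "((b \<bullet> orth_proj E x) *\<^sub>R b) \<bullet> orth_proj E x = (x \<bullet> b)\<^sup>2"
        by (simp add: power2_eq_square)
    qed
    finally show ?thesis by (simp add: power2_norm_eq_inner)
  qed
  then have "(\<Sum>b\<in>Basis. (norm (orth_proj E b))\<^sup>2) = (\<Sum>c\<in>Basis. \<Sum>b\<in>B. (c \<bullet> b)\<^sup>2)"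
    by simp
  also have "\<dots> = (\<Sum>b\<in>B. \<Sum>c\<in>Basis. (c \<bullet> b)\<^sup>2)"
    by (rule sum.swap)
  also have "\<dots> = (\<Sum>b\<in>B. (norm b)\<^sup>2)"
  proof (rule sum.cong[OF refl])
    fix b assume "b \<in> B"
    show "(\<Sum>c\<in>Basis. (c \<bullet> b)\<^sup>2) = (norm b)\<^sup>2"
      unfolding power2_norm_eq_inner by (subst euclidean_inner) (simp add: power2_eq_square inner_commute)
  qed
  also have "\<dots> = real (dim E)"
    using B by simp
  finally show ?thesis .
qed

end

section \<open>The spectral theorem and the determinant inequality\<close>

text \<open>A maximizer v of the quadratic form on the unit sphere of \<open>V\<close> is an
  eigenvector. Moving it by t * u along the residue u = A v - \<mu> v changes x \<bullet> A x -
  \<mu> * (x \<bullet> x) to first order by 2 * t * (u \<bullet> u), which maximality forbids unless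
  u = 0.\<close>

lemma selfadjoint_eigenvector_exists:
  fixes A :: "'a::euclidean_space \<Rightarrow> 'a"
  assumes V: "subspace V" "V \<noteq> {0}" and A: "linear A" "\<And>x y. A x \<bullet> y = x \<bullet> A y" "\<And>x. x \<in> V \<Longrightarrow> A x \<in> V"
  obtains v \<mu> where "v \<in> V" "norm v = 1" "A v = \<mu> *\<^sub>R v"
proof -
  interpret A: linear A by fact
  let ?S = "V \<inter> sphere 0 1"
  have "0 \<in> V" using V by (simp add: subspace_0)
  then obtain w where w: "w \<in> V" "w \<noteq> 0" using V by blast
  then have "w /\<^sub>R norm w \<in> ?S"
    using V by (simp add: subspace_scale)
  then have ne: "?S \<noteq> {}" by blast
  have comp: "compact ?S"
    using closed_subspace[OF V(1)] by (intro closed_Int_compact) auto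
  have "continuous_on ?S (\<lambda>x. x \<bullet> A x)"
    using linear_continuous_on[OF A(1)[unfolded linear_conv_bounded_linear], of ?S] by (intro continuous_intros)
  then obtain v where v: "v \<in> ?S" "\<And>x. x \<in> ?S \<Longrightarrow> x \<bullet> A x \<le> v \<bullet> A v"
    using continuous_attains_sup[OF comp ne] by blast
  define \<mu> where "\<mu> = v \<bullet> A v"
  have nv: "norm v = 1" "v \<bullet> v = 1" using v(1) by (auto simp: norm_eq_1)
  have le: "x \<bullet> A x \<le> \<mu> * (x \<bullet> x)" if "x \<in> V" for x
  proof (cases "x = 0")
    case False
    then have "x /\<^sub>R norm x \<in> ?S" using that V by (simp add: subspace_scale)
    from v(2)[OF this] have "(x \<bullet> A x) / (norm x)\<^sup>2 \<le> \<mu>"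
      by (simp add: \<mu>_def A.scaleR divide_inverse power2_eq_square mult_ac)
    then show ?thesis
      using False by (simp add: divide_le_eq power2_norm_eq_inner)
  qed simp
  define u where "u = A v - \<mu> *\<^sub>R v"
  have u: "u \<in> V"
    using v(1) A(3) V by (auto simp: u_def intro!: subspace_diff subspace_scale)
  have uv: "u \<bullet> v = 0"
    using nv by (simp add: u_def inner_diff_left \<mu>_def) (simp add: inner_commute)
  have uAv: "u \<bullet> A v = u \<bullet> u"
  proof -
    have "A v = u + \<mu> *\<^sub>R v" by (simp add: u_def)
    then show ?thesis using uv by (simp add: inner_add_right)
  qed
  define c where "c = u \<bullet> A u - \<mu> * (u \<bullet> u)"
  have quad: "2 * t * (u \<bullet> u) + t\<^sup>2 * c \<le> 0" for t
  proof -
    have "v + t *\<^sub>R u \<in> V" using u v(1) V by (auto intro!: subspace_add subspace_scale)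
    from le[OF this]
    have "(v + t *\<^sub>R u) \<bullet> A (v + t *\<^sub>R u) \<le> \<mu> * ((v + t *\<^sub>R u) \<bullet> (v + t *\<^sub>R u))" .
    moreover have "(v + t *\<^sub>R u) \<bullet> A (v + t *\<^sub>R u) = \<mu> + 2 * t * (u \<bullet> u) + t\<^sup>2 * (u \<bullet> A u)"
      using uAv A(2)[of v u] by (simp add: A.add A.scaleR inner_add_left inner_add_right \<mu>_def power2_eq_square inner_commute)
    moreover have "(v + t *\<^sub>R u) \<bullet> (v + t *\<^sub>R u) = 1 + t\<^sup>2 * (u \<bullet> u)"
      using uv nv by (simp add: inner_add_left inner_add_right power2_eq_square inner_commute)
    ultimately have "\<mu> + 2 * t * (u \<bullet> u) + t\<^sup>2 * (u \<bullet> A u) \<le> \<mu> * (1 + t\<^sup>2 * (u \<bullet> u))"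
      by (simp only:)
    then show ?thesis by (simp add: c_def algebra_simps)
  qed
  have "u \<bullet> u = 0"
  proof (rule ccontr)
    assume "u \<bullet> u \<noteq> 0"
    then have pos: "0 < u \<bullet> u" by simp
    \<comment> \<open>Small enough for the linear term of \<open>quad\<close> to outweigh the
      quadratic one.\<close>
    define t where "t = (u \<bullet> u) / (\<bar>c\<bar> + 1)"
    have t: "0 < t" "t * (\<bar>c\<bar> + 1) = u \<bullet> u" using pos by (auto simp: t_def)
    have "t * (2 * (u \<bullet> u) + t * c) \<le> 0" using quad[of t] by (simp add: power2_eq_square algebra_simps)
    then have "2 * (u \<bullet> u) + t * c \<le> 0" using t(1) by (simp add: mult_le_0_iff)
    moreover have "0 \<le> t * (c + \<bar>c\<bar>)" using t(1) by (intro mult_nonneg_nonneg) auto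
    ultimately show False using t pos unfolding distrib_left by linarith
  qed
  then have "A v = \<mu> *\<^sub>R v" by (simp add: u_def)
  then show thesis using v(1) nv(1) by (intro that[of v \<mu>]) auto
qed

text \<open>Stated for invariant subspaces, since the induction continues in the orthogonal
  complement of an eigenvector within \<open>V\<close>.\<close>

lemma selfadjoint_orthonormal_eigenbasis:
  fixes A :: "'a::euclidean_space \<Rightarrow> 'a"
  assumes A: "linear A" "\<And>x y. A x \<bullet> y = x \<bullet> A y"
    and V: "subspace V" "\<And>x. x \<in> V \<Longrightarrow> A x \<in> V"
  shows "\<exists>B \<subseteq> V. pairwise orthogonal B \<and> (\<forall>b\<in>B. norm b = 1 \<and> (\<exists>l. A b = l *\<^sub>R b)) \<and> span B = V"
  using V
proof (induction "dim V" arbitrary: V rule: less_induct)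
  case less
  show ?case
  proof (cases "V = {0}")
    case True
    then show ?thesis by (intro exI[of _ "{}"]) auto
  next
    case False
    obtain v l where v: "v \<in> V" "norm v = 1" "A v = l *\<^sub>R v"
      using selfadjoint_eigenvector_exists[OF less.prems(1) False A less.prems(2)] by metis
    let ?W = "V \<inter> {x. v \<bullet> x = 0}"
    have W: "subspace ?W"
      using less.prems(1) subspace_inter[OF _ subspace_hyperplane] by blast
    have vW: "v \<notin> ?W" using v by (auto simp: norm_eq_1)
    have "dim ?W \<noteq> dim V"
    proof
      assume "dim ?W = dim V"
      then have "?W = V"
        using subspace_dim_equal[OF W less.prems(1)] by simp
      then show False using v(1) vW by blast
    qed
    then have "dim ?W < dim V"
      using dim_subset[of ?W V] by simp
    moreover have "A x \<in> ?W" if "x \<in> ?W" for x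
      using that less.prems(2)[of x] A(2)[of v x] v(3) by simp
    ultimately obtain B where B: "B \<subseteq> ?W" "pairwise orthogonal B" "\<forall>b\<in>B. norm b = 1 \<and> (\<exists>l. A b = l *\<^sub>R b)" "span B = ?W"
      using less.hyps[OF _ W] by blast
    have "span (insert v B) = V"
    proof (intro equalityI subsetI)
      fix x assume "x \<in> span (insert v B)"
      moreover have "span (insert v B) \<subseteq> V"
        using B(1) v(1) less.prems(1) by (intro span_minimal) auto
      ultimately show "x \<in> V" by blast
    next
      fix x assume x: "x \<in> V"
      have "x - (v \<bullet> x) *\<^sub>R v \<in> ?W"
        using x v less.prems(1) by (auto simp: inner_diff_right norm_eq_1 intro!: subspace_diff subspace_scale)
      then have "x - (v \<bullet> x) *\<^sub>R v \<in> span B" using B(4) by simp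
      then show "x \<in> span (insert v B)"
        using span_breakdown_eq[of x v B] by blast
    qed
    moreover have "orthogonal v b \<and> orthogonal b v" if "b \<in> B" for b
      using B(1) that by (auto simp: orthogonal_def inner_commute)
    then have "pairwise orthogonal (insert v B)"
      using B(2) unfolding pairwise_insert by blast
    moreover have "\<forall>b\<in>insert v B. norm b = 1 \<and> (\<exists>l. A b = l *\<^sub>R b)"
      using B(3) v by blast
    moreover have "insert v B \<subseteq> V"
      using B(1) v(1) by blast
    ultimately show ?thesis by blast
  qed
qed

text \<open>Jensen's inequality for exp, by the tangent at the mean; \<open>w0\<close> is the weight
  of the additional value 0.\<close>

lemma exp_weighted_sum_le:
  fixes w s :: "'i \<Rightarrow> real"
  assumes "finite I" "\<And>i. i \<in> I \<Longrightarrow> 0 \<le> w i" "0 \<le> w0" "w0 + (\<Sum>i\<in>I. w i) = 1"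
  shows "exp (\<Sum>i\<in>I. w i * s i) \<le> w0 + (\<Sum>i\<in>I. w i * exp (s i))"
proof -
  define t where "t = (\<Sum>i\<in>I. w i * s i)"
  have tangent: "exp t * (1 + (r - t)) \<le> exp r" for r
  proof -
    have "exp t * (1 + (r - t)) \<le> exp t * exp (r - t)"
      by (intro mult_left_mono exp_ge_add_one_self) auto
    then show ?thesis by (simp flip: exp_add)
  qed
  have "exp t = exp t * (w0 * (1 + (0 - t)) + (\<Sum>i\<in>I. w i * (1 + (s i - t))))"
  proof -
    have "(\<Sum>i\<in>I. w i * (1 + (s i - t))) = (1 - t) * (\<Sum>i\<in>I. w i) + t"
    proof -
      have "w i * (1 + (s i - t)) = w i * (1 - t) + w i * s i" for i
        by (simp add: algebra_simps)
      then show ?thesis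
        by (simp only: sum.distrib sum_distrib_right[symmetric] t_def[symmetric] mult.commute[of "1 - t"])
    qed
    then have "w0 * (1 + (0 - t)) + (\<Sum>i\<in>I. w i * (1 + (s i - t))) = (1 - t) * (w0 + (\<Sum>i\<in>I. w i)) + t"
      by (simp add: algebra_simps)
    then show ?thesis using assms(4) by simp
  qed
  also have "\<dots> = w0 * (exp t * (1 + (0 - t))) + (\<Sum>i\<in>I. w i * (exp t * (1 + (s i - t))))"
    by (simp add: distrib_left sum_distrib_left mult_ac)
  also have "\<dots> \<le> w0 * exp 0 + (\<Sum>i\<in>I. w i * exp (s i))"
    using assms by (intro add_mono sum_mono mult_left_mono tangent) auto
  finally show ?thesis by (simp add: t_def)
qed

text \<open>Indexed by the coordinates, an orthonormal basis can serve as the columns of a square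
  matrix.\<close>

lemma orthonormal_enumeration:
  fixes B :: "(real ^ 'n) set"
  assumes B: "pairwise orthogonal B" "\<And>b. b \<in> B \<Longrightarrow> norm b = 1" "span B = UNIV"
  obtains \<beta> :: "'n \<Rightarrow> real ^ 'n" where "bij_betw \<beta> UNIV B" "\<And>i j. \<beta> i \<bullet> \<beta> j = (if i = j then 1 else 0)"
proof -
  have "0 \<notin> B" using B(2) by force
  then have ind: "independent B"
    using B(1) pairwise_orthogonal_independent by blast
  have fin: "finite B" using ind independent_imp_finite by blast
  have "card B = CARD('n)"
    using ind B(3) dim_span_eq_card_independent[OF ind] by (metis dim_UNIV dim_span DIM_cart DIM_real mult.right_neutral)
  then obtain \<beta> :: "'n \<Rightarrow> real ^ 'n" where \<beta>: "bij_betw \<beta> UNIV B"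
    using fin by (metis finite_same_card_bij finite_class.finite_UNIV)
  have mem: "\<beta> i \<in> B" for i using \<beta> by (auto simp: bij_betw_def)
  have "\<beta> i \<bullet> \<beta> j = (if i = j then 1 else 0)" for i j
  proof (cases "i = j")
    case True
    then show ?thesis using B(2)[OF mem[of i]] by (simp add: norm_eq_1)
  next
    case False
    then have "\<beta> i \<noteq> \<beta> j" using \<beta> by (auto simp: bij_betw_def inj_on_def)
    then show ?thesis using False B(1) mem by (auto simp: pairwise_def orthogonal_def)
  qed
  then show thesis using that \<beta> by blast
qed

lemma det_eq_prod_eigenvalues:
  fixes A :: "real ^ 'n \<Rightarrow> real ^ 'n" and \<beta> :: "'n \<Rightarrow> real ^ 'n"
  assumes A: "linear A" and \<beta>: "\<And>i j. \<beta> i \<bullet> \<beta> j = (if i = j then 1 else 0)" and eig: "\<And>j. A (\<beta> j) = l j *\<^sub>R \<beta> j"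
  shows "det (matrix A) = (\<Prod>j\<in>UNIV. l j)"
proof -
  define Q :: "real ^ 'n ^ 'n" where "Q = (\<chi> i j. \<beta> j $ i)"
  define D :: "real ^ 'n ^ 'n" where "D = (\<chi> i j. if i = j then l i else 0)"
  have "transpose Q ** Q = mat 1"
    using \<beta> by (simp add: vec_eq_iff matrix_matrix_mult_def transpose_def Q_def mat_def inner_vec_def)
  then have "det Q * det Q = 1"
    by (metis det_I det_mul det_transpose)
  then have Q0: "det Q \<noteq> 0" by auto
  have "matrix A ** Q = Q ** D"
  proof -
    have "(matrix A ** Q) $ i $ j = (Q ** D) $ i $ j" for i j
    proof -
      have "(matrix A ** Q) $ i $ j = (matrix A *v \<beta> j) $ i"
        by (simp add: matrix_matrix_mult_def matrix_vector_mult_def Q_def)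
      also have "\<dots> = l j * \<beta> j $ i"
        using A eig by (simp add: matrix_works)
      also have "\<dots> = (Q ** D) $ i $ j"
        by (simp add: matrix_matrix_mult_def Q_def D_def if_distrib mult.commute cong: if_cong)
      finally show ?thesis .
    qed
    then show ?thesis by (simp add: vec_eq_iff)
  qed
  then have "det (matrix A) * det Q = det Q * det D"
    by (metis det_mul)
  then have "det (matrix A) = det D" using Q0 by simp
  also have "\<dots> = (\<Prod>j\<in>UNIV. l j)"
    by (subst det_diagonal) (auto simp: D_def)
  finally show ?thesis .
qed

text \<open>The determinant inequality behind geometric Brascamp-Lieb. For an orthonormal eigenbasis
  b_j of this map, the j-th eigenvalue is |b_j - P b_j|^2 plus the sum over i of exp (s_i) * (P
  b_j)_i^2. These weights sum to 1, so Jensen bounds the eigenvalue below by the exponential of the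
  sum of s_i * (P b_j)_i^2. In the product over j, Parseval turns the sum of the (P b_j)_i^2 into |P
  e_i|^2. The identity on the complement of \<open>E\<close> allows the determinant to be taken on
  the whole space.\<close>

lemma det_orth_proj_diag_ge:
  fixes E :: "(real ^ 'n) set" and s :: "'n \<Rightarrow> real"
  assumes E: "subspace E"
  shows "exp (\<Sum>i\<in>UNIV. s i * (norm (orth_proj E (axis i 1)))\<^sup>2)
    \<le> det (matrix (\<lambda>x. (x - orth_proj E x) + orth_proj E (\<chi> i. exp (s i) * orth_proj E x $ i)))"
proof -
  let ?P = "orth_proj E"
  define A where "A x = (x - ?P x) + ?P (\<chi> i. exp (s i) * ?P x $ i)" for x
  interpret P: linear ?P by (rule orth_proj_linear[OF E])
  have lin: "linear A"
  proof (rule linearI)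
    fix x y
    have "(\<chi> i. exp (s i) * ?P (x + y) $ i) = (\<chi> i. exp (s i) * ?P x $ i) + (\<chi> i. exp (s i) * ?P y $ i)"
      by (simp add: vec_eq_iff P.add distrib_left)
    then show "A (x + y) = A x + A y" by (simp add: A_def P.add)
  next
    fix c x
    have "(\<chi> i. exp (s i) * ?P (c *\<^sub>R x) $ i) = c *\<^sub>R (\<chi> i. exp (s i) * ?P x $ i)"
      by (simp add: vec_eq_iff P.scaleR)
    then show "A (c *\<^sub>R x) = c *\<^sub>R A x" by (simp add: A_def P.scaleR scaleR_diff_right scaleR_add_right)
  qed
  have A_inner: "A x \<bullet> y = x \<bullet> y - ?P x \<bullet> ?P y + (\<Sum>i\<in>UNIV. exp (s i) * (?P x $ i * ?P y $ i))" for x y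
  proof -
    have "(x - ?P x) \<bullet> y = x \<bullet> y - ?P x \<bullet> ?P y"
      by (simp add: inner_diff_left orth_proj_inner_left[OF E, of x y])
    moreover have "?P v \<bullet> y = (\<Sum>i\<in>UNIV. v $ i * ?P y $ i)" for v
      unfolding orth_proj_selfadjoint[OF E, of v y] by (simp add: inner_vec_def)
    ultimately show ?thesis
      by (simp add: A_def inner_add_left mult.assoc)
  qed
  have sym: "A x \<bullet> y = x \<bullet> A y" for x y
    using A_inner[of x y] A_inner[of y x] by (simp add: inner_commute mult_ac)
  obtain B where B: "pairwise orthogonal B" "\<forall>b\<in>B. norm b = 1 \<and> (\<exists>l. A b = l *\<^sub>R b)" "span B = UNIV"
    using selfadjoint_orthonormal_eigenbasis[OF lin sym subspace_UNIV] by blast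
  have B1: "\<And>b. b \<in> B \<Longrightarrow> norm b = 1" using B(2) by blast
  obtain \<beta> :: "'n \<Rightarrow> real ^ 'n" where \<beta>: "bij_betw \<beta> UNIV B" "\<And>i j. \<beta> i \<bullet> \<beta> j = (if i = j then 1 else 0)"
    using orthonormal_enumeration[OF B(1) B1 B(3)] by blast
  have "\<exists>l. A (\<beta> j) = l *\<^sub>R \<beta> j" for j
    using B(2) \<beta>(1) by (auto simp: bij_betw_def)
  then obtain l where l: "\<And>j. A (\<beta> j) = l j *\<^sub>R \<beta> j" by metis
  have parseval: "(\<Sum>j\<in>UNIV. (x \<bullet> \<beta> j)\<^sup>2) = (norm x)\<^sup>2" for x
  proof -
    have fin: "finite B" using \<beta>(1) by (metis bij_betw_finite finite_class.finite_UNIV)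
    have "x = (\<Sum>b\<in>B. (x \<bullet> b) *\<^sub>R b)"
      using orthonormal_basis_expand[OF B(1) B1 _ fin, of x] B(3) by simp
    then have "x \<bullet> x = x \<bullet> (\<Sum>b\<in>B. (x \<bullet> b) *\<^sub>R b)" by simp
    also have "\<dots> = (\<Sum>b\<in>B. (x \<bullet> b)\<^sup>2)" by (simp add: inner_sum_right power2_eq_square)
    also have "\<dots> = (\<Sum>j\<in>UNIV. (x \<bullet> \<beta> j)\<^sup>2)"
      by (rule sum.reindex_bij_betw[OF \<beta>(1), symmetric])
    finally show ?thesis by (simp add: power2_norm_eq_inner)
  qed
  have comp: "?P y $ i = ?P (axis i 1) \<bullet> y" for y i
    by (simp add: orth_proj_selfadjoint[OF E] inner_axis' )
  have l_ge: "exp (\<Sum>i\<in>UNIV. (?P (\<beta> j) $ i)\<^sup>2 * s i) \<le> l j" for j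
  proof -
    have "l j = A (\<beta> j) \<bullet> \<beta> j" using \<beta>(2) by (simp add: l)
    also have "\<dots> = (1 - ?P (\<beta> j) \<bullet> ?P (\<beta> j)) + (\<Sum>i\<in>UNIV. (?P (\<beta> j) $ i)\<^sup>2 * exp (s i))"
      using \<beta>(2) by (simp add: A_inner power2_eq_square mult_ac)
    also have "\<dots> \<ge> exp (\<Sum>i\<in>UNIV. (?P (\<beta> j) $ i)\<^sup>2 * s i)"
    proof (rule exp_weighted_sum_le)
      have "norm (\<beta> j) = 1"
        using \<beta>(2)[of j j] by (simp add: norm_eq_1)
      then have "norm (?P (\<beta> j)) \<le> 1"
        using norm_orth_proj_le[OF E, of "\<beta> j"] by simp
      then have "(norm (?P (\<beta> j)))\<^sup>2 \<le> 1"
        by (intro power_le_one) auto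
      then show "0 \<le> 1 - ?P (\<beta> j) \<bullet> ?P (\<beta> j)"
        by (simp add: power2_norm_eq_inner)
      show "1 - ?P (\<beta> j) \<bullet> ?P (\<beta> j) + (\<Sum>i\<in>UNIV. (?P (\<beta> j) $ i)\<^sup>2) = 1"
        by (simp add: inner_vec_def power2_eq_square)
    qed auto
    finally show ?thesis .
  qed
  have "exp (\<Sum>i\<in>UNIV. s i * (norm (?P (axis i 1)))\<^sup>2) = exp (\<Sum>j\<in>UNIV. \<Sum>i\<in>UNIV. (?P (\<beta> j) $ i)\<^sup>2 * s i)"
  proof -
    have "(\<Sum>j\<in>UNIV. \<Sum>i\<in>UNIV. (?P (\<beta> j) $ i)\<^sup>2 * s i) = (\<Sum>i\<in>UNIV. \<Sum>j\<in>UNIV. (?P (axis i 1) \<bullet> \<beta> j)\<^sup>2 * s i)"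
      unfolding comp by (rule sum.swap)
    also have "\<dots> = (\<Sum>i\<in>UNIV. s i * (norm (?P (axis i 1)))\<^sup>2)"
      by (simp only: parseval sum_distrib_right[symmetric] mult.commute[of "s i" for i])
    finally show ?thesis by simp
  qed
  also have "\<dots> = (\<Prod>j\<in>UNIV. exp (\<Sum>i\<in>UNIV. (?P (\<beta> j) $ i)\<^sup>2 * s i))"
    by (simp add: exp_sum)
  also have "\<dots> \<le> (\<Prod>j\<in>UNIV. l j)"
    by (intro prod_mono conjI l_ge) auto
  also have "\<dots> = det (matrix A)"
    by (rule det_eq_prod_eigenvalues[OF lin \<beta>(2) l, symmetric])
  finally show ?thesis
    unfolding A_def .
qed

section \<open>The geometric Brascamp-Lieb inequality by transport\<close>

text \<open>An inequality is enough, because the integral of \<open>f\<close> over the range of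
  \<open>g\<close> is at most the full one; surjectivity of the transport map is never at
  issue.\<close>

lemma nn_integral_change_of_variables_le:
  fixes g :: "real ^ 'm::{finite,wellorder} \<Rightarrow> real ^ 'm::_" and f :: "real ^ 'm::_ \<Rightarrow> real"
  assumes der: "\<And>x. (g has_derivative g' x) (at x)" and inj: "inj g"
    and f: "integrable lborel f" "\<And>x. 0 \<le> f x"
  shows "(\<integral>\<^sup>+x. ennreal (\<bar>det (matrix (g' x))\<bar> * f (g x)) \<partial>lebesgue) \<le> (\<integral>\<^sup>+x. ennreal (f x) \<partial>lborel)"
proof -
  \<comment> \<open>The change of variables theorem is about vector-valued functions.\<close>
  define F :: "real ^ 'm::_ \<Rightarrow> real ^ 1" where "F x = vec (f x)" for x
  have contg: "continuous_on S g" for S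
    using der has_derivative_continuous_on has_derivative_at_withinI by blast
  have "range g = (\<Union>n. g ` cball 0 (real n))"
  proof -
    have "(UNIV :: (real ^ 'm::_) set) = (\<Union>n. cball 0 (real n))"
      using real_arch_simple by auto
    then show ?thesis by (metis image_UN)
  qed
  moreover have "g ` cball 0 (real n) \<in> sets borel" for n
    by (intro borel_compact compact_continuous_image contg compact_cball)
  ultimately have img: "range g \<in> sets borel" by auto
  have f_abs: "f absolutely_integrable_on UNIV"
    using f(1) by (simp add: set_integrable_def integrable_completion)
  then have f_img: "f absolutely_integrable_on range g"
    using img by (intro set_integrable_subset[OF f_abs]) auto
  then have "F absolutely_integrable_on range g"
    by (simp add: absolutely_integrable_on_1_iff F_def)
  then have *: "(\<lambda>x. \<bar>det (matrix (g' x))\<bar> *\<^sub>R F (g x)) absolutely_integrable_on UNIV"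
    "integral UNIV (\<lambda>x. \<bar>det (matrix (g' x))\<bar> *\<^sub>R F (g x)) = integral (range g) F"
    using has_absolute_integral_change_of_variables[of UNIV g g' F "integral (range g) F"] der inj by auto
  let ?D = "\<lambda>x. \<bar>det (matrix (g' x))\<bar> * f (g x)"
  have D: "?D absolutely_integrable_on UNIV"
    using *(1) by (simp add: absolutely_integrable_on_1_iff F_def)
  have eq: "integral UNIV ?D = integral (range g) f"
    using *(2) by (simp add: integral_on_1_eq F_def vec_eq_iff)
  have intD: "integrable lebesgue ?D"
    using D by (simp add: set_integrable_def)
  have "(\<integral>\<^sup>+x. ennreal (?D x) \<partial>lebesgue) = ennreal (\<integral>x. ?D x \<partial>lebesgue)"
    using intD f(2) by (intro nn_integral_eq_integral) auto
  also have "(\<integral>x. ?D x \<partial>lebesgue) = integral UNIV ?D"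
    using set_lebesgue_integral_eq_integral(2)[OF D] by (simp add: set_lebesgue_integral_def)
  also have "\<dots> = integral (range g) f" by (rule eq)
  also have "\<dots> \<le> integral UNIV f"
    using f_img f_abs f(2) by (intro integral_subset_le) (auto simp: absolutely_integrable_on_def)
  also have "\<dots> = (\<integral>x. f x \<partial>lborel)"
    using set_lebesgue_integral_eq_integral(2)[OF f_abs] f(1) by (simp add: set_lebesgue_integral_def integral_completion)
  also have "ennreal \<dots> = (\<integral>\<^sup>+x. ennreal (f x) \<partial>lborel)"
    using f by (intro nn_integral_eq_integral[symmetric]) auto
  finally show ?thesis by (simp add: ennreal_leI)
qed

text \<open>\<open>\<Theta>\<close> keeps the component orthogonal to \<open>E\<close> and applies
  the one-dimensional maps between two projections. By the determinant inequality its Jacobian is at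
  least the product of the d_i^(a_i^2). Projecting does not lengthen, so |\<open>\<Theta>\<close>
  y|^2 is at most |y - P y|^2 plus the sum of the squares of the \<open>\<sigma> i\<close>. With the
  hypothesis \<open>le\<close> in each coordinate, the integrand is at most the product of the
  \<open>C i\<close> times the Gaussian pulled back along \<open>\<Theta>\<close>.\<close>

lemma brascamp_lieb_transport:
  fixes E :: "(real ^ 'm::{finite,wellorder}) set" and u \<sigma> d :: "'m::_ \<Rightarrow> real \<Rightarrow> real"
  assumes E: "subspace E"
    and u0: "\<And>i s. 0 \<le> u i s"
    and \<sigma>: "\<And>i s. (\<sigma> i has_real_derivative d i s) (at s)" and d: "\<And>i s. 0 < d i s"
    and le: "\<And>i s. u i s * exp (- s\<^sup>2 / 2)
      \<le> C i * d i s powr ((norm (orth_proj E (axis i 1)))\<^sup>2) * exp (- (\<sigma> i s)\<^sup>2 / 2)"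
    and G: "integrable lborel (\<lambda>y::real ^ 'm::_. exp (- (norm y)\<^sup>2 / 2))"
  shows "(\<integral>\<^sup>+y. ennreal ((\<Prod>i\<in>UNIV. u i (orth_proj E y $ i)) * exp (- (norm y)\<^sup>2 / 2)) \<partial>lborel)
    \<le> ennreal (\<Prod>i\<in>UNIV. C i) * (\<integral>\<^sup>+y. ennreal (exp (- (norm (y :: real ^ 'm::_))\<^sup>2 / 2)) \<partial>lborel)"
proof -
  let ?P = "orth_proj E"
  let ?a = "\<lambda>i. (norm (?P (axis i 1)))\<^sup>2"
  interpret P: linear ?P by (rule orth_proj_linear[OF E])
  have bl: "bounded_linear ?P" by (simp add: linear_conv_bounded_linear[symmetric] P.linear_axioms)
  have contP: "continuous_on UNIV ?P" using bl by (simp add: linear_continuous_on)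
  have C0: "0 \<le> C i" for i
  proof -
    have "0 \<le> u i 0 * exp (- 0\<^sup>2 / 2)" using u0 by simp
    also note le[of i 0]
    finally show ?thesis
      using d[of i 0] by (simp add: zero_le_mult_iff)
  qed
  define \<Theta> where "\<Theta> y = (y - ?P y) + ?P (\<chi> i. \<sigma> i (?P y $ i))" for y
  define \<Theta>' where "\<Theta>' y = (\<lambda>h. (h - ?P h) + ?P (\<chi> i. d i (?P y $ i) * ?P h $ i))" for y
  have der: "(\<Theta> has_derivative \<Theta>' y) (at y)" for y
  proof -
    have 1: "(?P has_derivative ?P) (at y)" by (rule bounded_linear_imp_has_derivative[OF bl])
    have comp: "((\<lambda>y. \<sigma> i (?P y $ i)) has_derivative (\<lambda>h. d i (?P y $ i) * ?P h $ i)) (at y)" for i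
    proof -
      have "((\<lambda>y. ?P y $ i) has_derivative (\<lambda>h. ?P h $ i)) (at y)"
        using bounded_linear.has_derivative[OF bounded_linear_vec_nth 1] .
      then show ?thesis
        using has_derivative_compose[OF _ \<sigma>[unfolded has_field_derivative_def]] by blast
    qed
    have "((\<lambda>y. \<chi> i. \<sigma> i (?P y $ i)) has_derivative (\<lambda>h. \<chi> i. d i (?P y $ i) * ?P h $ i)) (at y)"
      by (subst has_derivative_componentwise_within) (auto simp: Basis_vec_def inner_axis comp)
    then have "((\<lambda>y. ?P (\<chi> i. \<sigma> i (?P y $ i))) has_derivative (\<lambda>h. ?P (\<chi> i. d i (?P y $ i) * ?P h $ i))) (at y)"
      by (rule bounded_linear.has_derivative[OF bl])
    then show ?thesis
      unfolding \<Theta>_def[abs_def] \<Theta>'_def using 1 by (intro has_derivative_add has_derivative_diff has_derivative_ident)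
  qed
  have P\<Theta>: "?P (\<Theta> y) = ?P (\<chi> i. \<sigma> i (?P y $ i))" "\<Theta> y - ?P (\<Theta> y) = y - ?P y" for y
    using orth_proj_fixed[OF E orth_proj_in[OF E]] by (simp_all add: \<Theta>_def P.add P.diff)
  have inj: "inj \<Theta>"
  proof (rule injI)
    fix x y assume eq: "\<Theta> x = \<Theta> y"
    define X Y where "X = ?P x" and "Y = ?P y"
    have perp: "x - X = y - Y" using P\<Theta>(2)[of x] P\<Theta>(2)[of y] eq by (simp add: X_def Y_def)
    have "?P ((\<chi> i. \<sigma> i (X $ i)) - (\<chi> i. \<sigma> i (Y $ i))) = 0"
      using P\<Theta>(1)[of x] P\<Theta>(1)[of y] eq by (simp add: X_def Y_def P.diff)
    \<comment> \<open>Pairing with X - Y, which lies in \<open>E\<close>, removes the outer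
      projection. What remains is a sum of nonnegative terms, because every
      \<open>\<sigma> i\<close> is increasing.\<close>
    then have "0 = ?P ((\<chi> i. \<sigma> i (X $ i)) - (\<chi> i. \<sigma> i (Y $ i))) \<bullet> (X - Y)" by simp
    also have "\<dots> = ((\<chi> i. \<sigma> i (X $ i)) - (\<chi> i. \<sigma> i (Y $ i))) \<bullet> ?P (X - Y)"
      by (rule orth_proj_selfadjoint[OF E])
    also have "?P (X - Y) = X - Y"
      using orth_proj_fixed[OF E orth_proj_in[OF E]] by (simp add: X_def Y_def P.diff)
    finally have sum0: "(\<Sum>i\<in>UNIV. (\<sigma> i (X $ i) - \<sigma> i (Y $ i)) * (X $ i - Y $ i)) = 0"
      by (simp add: inner_vec_def)
    have mono: "strict_mono (\<sigma> i)" for i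
    proof (rule strict_monoI)
      fix s t :: real assume "s < t"
      then show "\<sigma> i s < \<sigma> i t"
        using \<sigma>[of i] d[of i] by (meson DERIV_pos_imp_increasing)
    qed
    have pos: "0 \<le> (\<sigma> i s - \<sigma> i t) * (s - t)" "(\<sigma> i s - \<sigma> i t) * (s - t) = 0 \<Longrightarrow> s = t" for i s t
      using strict_mono_less[OF mono[of i], of s t] strict_mono_less[OF mono[of i], of t s] strict_mono_eq[OF mono[of i], of s t]
      by (auto simp: zero_le_mult_iff not_less le_less intro: mult_neg_neg)
    have "(\<sigma> i (X $ i) - \<sigma> i (Y $ i)) * (X $ i - Y $ i) = 0" for i
      by (rule sum_nonneg_0[OF _ _ sum0]) (simp_all only: pos(1) finite_class.finite_UNIV UNIV_I)
    then have "X $ i = Y $ i" for i by (rule pos(2))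
    then have "X = Y" by (simp add: vec_eq_iff)
    then show "x = y" using perp by simp
  qed
  have pt: "(\<Prod>i\<in>UNIV. u i (?P y $ i)) * exp (- (norm y)\<^sup>2 / 2)
     \<le> (\<Prod>i\<in>UNIV. C i) * (\<bar>det (matrix (\<Theta>' y))\<bar> * exp (- (norm (\<Theta> y))\<^sup>2 / 2))" for y
  proof -
    define s where "s = ?P y"
    define r where "r = (norm (y - s))\<^sup>2"
    have norm2: "(norm v)\<^sup>2 = (\<Sum>i\<in>UNIV. (v $ i)\<^sup>2)" for v :: "real ^ 'm::_"
      unfolding power2_norm_eq_inner by (simp add: inner_vec_def power2_eq_square)
    have "(norm y)\<^sup>2 = (\<Sum>i\<in>UNIV. (s $ i)\<^sup>2) + r"
      using norm_orth_proj_decomp[OF E, of y] by (simp add: s_def r_def norm2)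
    then have "exp (- (norm y)\<^sup>2 / 2) = exp (- r / 2) * (\<Prod>i\<in>UNIV. exp (- (s $ i)\<^sup>2 / 2))"
      by (simp flip: exp_sum exp_add add: sum_negf sum_divide_distrib[symmetric] diff_divide_distrib)
    then have "(\<Prod>i\<in>UNIV. u i (s $ i)) * exp (- (norm y)\<^sup>2 / 2) = exp (- r / 2) * (\<Prod>i\<in>UNIV. u i (s $ i) * exp (- (s $ i)\<^sup>2 / 2))"
      by (simp add: prod.distrib)
    also have "\<dots> \<le> exp (- r / 2) * (\<Prod>i\<in>UNIV. C i * d i (s $ i) powr ?a i * exp (- (\<sigma> i (s $ i))\<^sup>2 / 2))"
      using u0 le by (intro mult_left_mono prod_mono) auto
    also have "\<dots> = (\<Prod>i\<in>UNIV. C i) * ((\<Prod>i\<in>UNIV. d i (s $ i) powr ?a i) * (exp (- r / 2) * (\<Prod>i\<in>UNIV. exp (- (\<sigma> i (s $ i))\<^sup>2 / 2))))"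
      by (simp add: prod.distrib)
    also have "\<dots> \<le> (\<Prod>i\<in>UNIV. C i) * (\<bar>det (matrix (\<Theta>' y))\<bar> * exp (- (norm (\<Theta> y))\<^sup>2 / 2))"
    proof (intro mult_left_mono mult_mono)
      have "(\<Prod>i\<in>UNIV. d i (s $ i) powr ?a i) = exp (\<Sum>i\<in>UNIV. ln (d i (s $ i)) * ?a i)"
        using d by (simp add: powr_def exp_sum mult.commute less_imp_neq[THEN not_sym])
      also have "\<dots> \<le> det (matrix (\<lambda>x. (x - ?P x) + ?P (\<chi> i. exp (ln (d i (s $ i))) * ?P x $ i)))"
        by (rule det_orth_proj_diag_ge[OF E])
      also have "\<dots> = det (matrix (\<Theta>' y))"
        using d by (simp add: \<Theta>'_def s_def)
      finally show "(\<Prod>i\<in>UNIV. d i (s $ i) powr ?a i) \<le> \<bar>det (matrix (\<Theta>' y))\<bar>" by linarith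
      have "(norm (\<Theta> y))\<^sup>2 = (norm (?P (\<Theta> y)))\<^sup>2 + (norm (\<Theta> y - ?P (\<Theta> y)))\<^sup>2"
        by (rule norm_orth_proj_decomp[OF E])
      also have "\<dots> = (norm (?P (\<chi> i. \<sigma> i (s $ i))))\<^sup>2 + r"
        unfolding P\<Theta>(2) unfolding P\<Theta>(1) s_def r_def ..
      also have "\<dots> \<le> (norm (\<chi> i. \<sigma> i (s $ i)))\<^sup>2 + r"
        using norm_orth_proj_le[OF E] by (intro add_mono power_mono) auto
      also have "\<dots> = (\<Sum>i\<in>UNIV. (\<sigma> i (s $ i))\<^sup>2) + r"
        by (simp add: norm2)
      finally have "(norm (\<Theta> y))\<^sup>2 \<le> (\<Sum>i\<in>UNIV. (\<sigma> i (s $ i))\<^sup>2) + r" .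
      then have "exp (- r / 2 + (\<Sum>i\<in>UNIV. - (\<sigma> i (s $ i))\<^sup>2 / 2)) \<le> exp (- (norm (\<Theta> y))\<^sup>2 / 2)"
        by (simp add: sum_negf sum_divide_distrib[symmetric])
      then show "exp (- r / 2) * (\<Prod>i\<in>UNIV. exp (- (\<sigma> i (s $ i))\<^sup>2 / 2)) \<le> exp (- (norm (\<Theta> y))\<^sup>2 / 2)"
        unfolding exp_add exp_sum[OF finite_class.finite_UNIV] .
    qed (use C0 in \<open>auto intro!: prod_nonneg mult_nonneg_nonneg\<close>)
    finally show ?thesis by (simp add: s_def)
  qed
  have "(\<integral>\<^sup>+y. ennreal ((\<Prod>i\<in>UNIV. u i (?P y $ i)) * exp (- (norm y)\<^sup>2 / 2)) \<partial>lborel)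
     = (\<integral>\<^sup>+y. ennreal ((\<Prod>i\<in>UNIV. u i (?P y $ i)) * exp (- (norm y)\<^sup>2 / 2)) \<partial>lebesgue)"
    by (rule nn_integral_completion[symmetric])
  also have "\<dots> \<le> (\<integral>\<^sup>+y. ennreal (\<bar>det (matrix (\<Theta>' y))\<bar> * ((\<Prod>i\<in>UNIV. C i) * exp (- (norm (\<Theta> y))\<^sup>2 / 2))) \<partial>lebesgue)"
    using pt by (intro nn_integral_mono ennreal_leI) (simp add: mult_ac)
  also have "\<dots> \<le> (\<integral>\<^sup>+y. ennreal ((\<Prod>i\<in>UNIV. C i) * exp (- (norm (y :: real ^ 'm::_))\<^sup>2 / 2)) \<partial>lborel)"
    using C0 G by (intro nn_integral_change_of_variables_le der inj integrable_mult_right mult_nonneg_nonneg prod_nonneg) auto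
  also have "\<dots> = (\<integral>\<^sup>+y. ennreal (\<Prod>i\<in>UNIV. C i) * ennreal (exp (- (norm (y :: real ^ 'm::_))\<^sup>2 / 2)) \<partial>lborel)"
    using C0 by (intro nn_integral_cong ennreal_mult prod_nonneg) auto
  also have "\<dots> = ennreal (\<Prod>i\<in>UNIV. C i) * (\<integral>\<^sup>+y. ennreal (exp (- (norm (y :: real ^ 'm::_))\<^sup>2 / 2)) \<partial>lborel)"
    by (rule nn_integral_cmult) measurable
  finally show ?thesis .
qed

section \<open>One-dimensional transport maps\<close>

lemma continuous_antiderivative_exists:
  fixes g :: "real \<Rightarrow> real"
  assumes "\<And>x. isCont g x"
  obtains F where "\<And>x. (F has_real_derivative g x) (at x)"
proof -
  have "\<exists>F. \<forall>x :: real. -\<infinity> < ereal x \<longrightarrow> ereal x < \<infinity> \<longrightarrow> (F has_vector_derivative g x) (at x)"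
    by (rule einterval_antiderivative) (use assms in auto)
  then show thesis
    using that by (auto simp: has_real_derivative_iff_has_vector_derivative)
qed

text \<open>The distribution function is a differentiable bijection onto the open unit interval; its
  derivative comes from comparing its increments with those of an antiderivative of
  \<open>g\<close>.\<close>

lemma cdf_density_properties:
  fixes g :: "real \<Rightarrow> real"
  assumes cont: "\<And>x. isCont g x" and pos: "\<And>x. 0 < g x" and int: "(\<integral>\<^sup>+x. ennreal (g x) \<partial>lborel) = 1"
  defines "G \<equiv> cdf (density lborel (\<lambda>x. ennreal (g x)))"
  shows "(G has_real_derivative g x) (at x)" and "strict_mono G" and "0 < G x" and "G x < 1"
    and "0 < y \<Longrightarrow> y < 1 \<Longrightarrow> \<exists>x. G x = y"
proof -
  have [measurable]: "g \<in> borel_measurable borel"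
    using cont by (intro borel_measurable_continuous_onI continuous_at_imp_continuous_on) auto
  let ?M = "density lborel (\<lambda>x. ennreal (g x))"
  interpret prob_space ?M
    by standard (simp add: emeasure_density int)
  interpret real_distribution ?M
    by standard simp
  obtain F where F: "\<And>x. (F has_real_derivative g x) (at x)"
    using continuous_antiderivative_exists[OF cont] by metis
  have diff: "G y - G x = F y - F x" if "x < y" for x y
  proof -
    have "F x \<le> F y"
      using that F pos by (intro DERIV_nonneg_imp_nondecreasing[of x y F]) (auto intro: less_imp_le)
    have "emeasure ?M {x<..y} = (\<integral>\<^sup>+t. ennreal (g t) * indicator {x<..y} t \<partial>lborel)"
      by (subst emeasure_density) auto
    also have "\<dots> = (\<integral>\<^sup>+t. ennreal (g t) * indicator {x..y} t \<partial>lborel)"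
      by (rule nn_integral_cong_AE) (use AE_lborel_singleton[of x] in \<open>eventually_elim; auto split: split_indicator\<close>)
    also have "\<dots> = ennreal (F y - F x)"
      using F pos that by (intro nn_integral_FTC_Icc) (auto intro: less_imp_le)
    finally have "measure ?M {x<..y} = F y - F x"
      using \<open>F x \<le> F y\<close> by (simp add: measure_def)
    then show ?thesis using cdf_diff_eq[OF that] by (simp add: G_def)
  qed
  have GF: "G = (\<lambda>x. F x + (G 0 - F 0))"
  proof
    fix x show "G x = F x + (G 0 - F 0)"
      using diff[of 0 x] diff[of x 0] by (cases x "0 :: real" rule: linorder_cases) auto
  qed
  show der: "(G has_real_derivative g x) (at x)" for x
    by (subst GF) (auto intro!: derivative_eq_intros F)
  show mono: "strict_mono G"
    by (rule strict_monoI) (use der pos in \<open>meson DERIV_pos_imp_increasing\<close>)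
  have "0 \<le> G (x - 1)" "G (x + 1) \<le> 1"
    by (simp_all add: G_def cdf_nonneg cdf_bounded_prob)
  moreover have "G (x - 1) < G x" "G x < G (x + 1)"
    using mono by (auto simp: strict_mono_def)
  ultimately show "0 < G x" "G x < 1" by linarith+
  assume y: "0 < y" "y < 1"
  have "\<forall>\<^sub>F x in at_bot. G x < y"
    using cdf_lim_at_bot y(1) unfolding G_def by (rule order_tendstoD)
  then obtain a where a: "G a < y" by (auto simp: eventually_at_bot_linorder)
  have "\<forall>\<^sub>F x in at_top. y < G x"
    using cdf_lim_at_top_prob y(2) unfolding G_def by (rule order_tendstoD)
  then obtain b where b: "y < G b" by (auto simp: eventually_at_top_linorder)
  have "a \<le> b"
    using a b mono by (metis less_trans not_le order_less_asym strict_mono_less)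
  then show "\<exists>x. G x = y"
    using IVT[of G a y b] a b DERIV_isCont[OF der] by auto
qed

text \<open>The map is the inverse distribution function of \<open>g\<close> applied after the
  distribution function of \<open>f\<close>; the derivative expresses that it carries one measure to
  the other.\<close>

lemma monotone_transport_exists:
  fixes f g :: "real \<Rightarrow> real"
  assumes f: "\<And>x. isCont f x" "\<And>x. 0 < f x" "(\<integral>\<^sup>+x. ennreal (f x) \<partial>lborel) = 1"
    and g: "\<And>x. isCont g x" "\<And>x. 0 < g x" "(\<integral>\<^sup>+x. ennreal (g x) \<partial>lborel) = 1"
  obtains S where "\<And>x. (S has_real_derivative f x / g (S x)) (at x)"
proof -
  define F where "F = cdf (density lborel (\<lambda>x. ennreal (f x)))"
  define G where "G = cdf (density lborel (\<lambda>x. ennreal (g x)))"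
  note F = cdf_density_properties[OF f, folded F_def]
  note G = cdf_density_properties[OF g, folded G_def]
  define H where "H = inv G"
  have inj: "inj G" using G(2) by (rule strict_mono_imp_inj_on)
  have HG: "H (G x) = x" for x by (simp add: H_def inj)
  have GH: "G (H y) = y" if "0 < y" "y < 1" for y
    using G(5)[OF that] HG by metis
  have derH: "(H has_real_derivative inverse (g (H y))) (at y)" if y: "0 < y" "y < 1" for y
  proof (rule DERIV_inverse_function[where a=0 and b=1])
    show "(G has_real_derivative g (H y)) (at (H y))" by (rule G(1))
    show "g (H y) \<noteq> 0" using g(2)[of "H y"] by simp
    have "isCont H (G (H y))"
      by (rule isCont_inverse_function2[of "H y - 1" "H y" "H y + 1"]) (use HG DERIV_isCont[OF G(1)] in auto)
    then show "isCont H y" using GH y by simp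
  qed (use y GH in auto)
  have "((\<lambda>x. H (F x)) has_real_derivative inverse (g (H (F x))) * f x) (at x)" for x
    by (rule DERIV_chain2[OF derH F(1)]) (rule F(3), rule F(4))
  then show thesis
    by (intro that[of "\<lambda>x. H (F x)"]) (simp add: divide_inverse mult.commute)
qed

text \<open>\<open>h / F\<close> is transported to the standard Gaussian and the map then stretched
  by \<open>a\<close>. The target is thus the Gaussian of deviation a, whose exponential factor
  becomes exp (- \<sigma>^2 / 2) when raised to the power a^2.\<close>

lemma gaussian_transport_exists:
  fixes h :: "real \<Rightarrow> real"
  assumes h: "\<And>x. isCont h x" "\<And>x. 0 < h x" "(\<integral>\<^sup>+x. ennreal (h x) \<partial>lborel) = ennreal F" and F: "0 < F" and a: "0 < a"
  obtains \<sigma> d where "\<And>s. (\<sigma> has_real_derivative d s) (at s)" "\<And>s. 0 < d s"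
    "\<And>s. h s = F * d s / a * std_normal_density (\<sigma> s / a)"
proof -
  have [measurable]: "h \<in> borel_measurable borel"
    using h(1) by (intro borel_measurable_continuous_onI continuous_at_imp_continuous_on) auto
  have cont: "isCont (\<lambda>x. h x / F) x" for x
    using h(1) F by (intro continuous_intros) auto
  have "(\<integral>\<^sup>+x. ennreal (h x / F) \<partial>lborel) = (\<integral>\<^sup>+x. ennreal (1 / F) * ennreal (h x) \<partial>lborel)"
    using F h(2) by (intro nn_integral_cong) (simp flip: ennreal_mult add: less_imp_le)
  also have "\<dots> = ennreal (1 / F) * ennreal F"
    by (subst nn_integral_cmult) (auto simp: h(3))
  also have "\<dots> = 1"
    using F by (simp flip: ennreal_mult)
  finally have int1: "(\<integral>\<^sup>+x. ennreal (h x / F) \<partial>lborel) = 1" .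
  have cont2: "isCont std_normal_density x" for x
    unfolding std_normal_density_def by (intro continuous_intros) auto
  have int2: "(\<integral>\<^sup>+x. ennreal (std_normal_density x) \<partial>lborel) = 1"
    by (subst nn_integral_eq_integral) auto
  have hF: "0 < h x / F" for x using h(2) F by simp
  obtain S where S: "\<And>x. (S has_real_derivative (h x / F) / std_normal_density (S x)) (at x)"
    using monotone_transport_exists[OF cont hF int1 cont2 normal_density_pos[OF zero_less_one] int2] by metis
  have n: "0 < std_normal_density x" for x by (simp add: normal_density_pos)
  show thesis
  proof (rule that[of "\<lambda>s. a * S s" "\<lambda>s. a * ((h s / F) / std_normal_density (S s))"])
    show "((\<lambda>s. a * S s) has_real_derivative a * ((h s / F) / std_normal_density (S s))) (at s)" for s
      by (rule DERIV_cmult[OF S])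
    show "0 < a * ((h s / F) / std_normal_density (S s))" for s
      by (intro mult_pos_pos divide_pos_pos a n h(2) F)
    show "h s = F * (a * ((h s / F) / std_normal_density (S s))) / a * std_normal_density (a * S s / a)" for s
      using a F n[of "S s"] by simp
  qed
qed

text \<open>The a^2-th power of a transport identity, with p = 1 / a^2. The mass to be transported
  is at most k * (2 / c) * pi * sqrt (2 / p) = 2 * sqrt pi / c; Ball's inequality enters here and
  needs p \<ge> 2. Since \<open>sinc\<close> has zeros, a small Gaussian is added to make the
  density positive, and \<eta> is the room for its mass.\<close>

lemma sinc_coordinate_transport:
  fixes a c \<eta> :: real
  assumes a: "0 < a" "a\<^sup>2 \<le> 1 / 2" and c: "0 < c" and \<eta>: "0 < \<eta>"
  obtains \<sigma> d where "\<And>s. (\<sigma> has_real_derivative d s) (at s)" "\<And>s. 0 < d s"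
    "\<And>s. \<bar>sinc (c * s / 2)\<bar> * exp (- s\<^sup>2 / 2)
      \<le> (2 * sqrt pi / c + \<eta>) powr a\<^sup>2 * d s powr a\<^sup>2 * exp (- (\<sigma> s)\<^sup>2 / 2)"
proof -
  define p where "p = 1 / a\<^sup>2"
  have p: "2 \<le> p" using a by (simp add: p_def field_simps)
  \<comment> \<open>The leading factor of the Gaussian density of deviation a, so that it cancels
    from the transport identity.\<close>
  define k where "k = 1 / (sqrt (2 * pi) * a)"
  have k: "0 < k" using a by (simp add: k_def)
  define u where "u s = \<bar>sinc (c * s / 2)\<bar>" for s
  have u: "0 \<le> u s" for s by (simp add: u_def)
  have contu: "isCont u s" for s
  proof -
    have "isCont (\<lambda>s. c * s / 2) s" by (intro continuous_intros) simp
    then have "isCont (\<lambda>s. sinc (c * s / 2)) s"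
      using isCont_o2[OF _ isCont_sinc] by blast
    then show ?thesis unfolding u_def[abs_def] by (intro continuous_rabs)
  qed
  have [measurable]: "u \<in> borel_measurable borel"
    using contu by (intro borel_measurable_continuous_onI continuous_at_imp_continuous_on) auto
  define h0 where "h0 s = k * (u s powr p * exp (- s\<^sup>2 * p / 2))" for s
  \<comment> \<open>Any positive, continuous and integrable function would serve; the integral of
    this one is known from \<open>nn_integral_gaussian_half\<close>.\<close>
  define g where "g s = exp (- p * s\<^sup>2 / 6)" for s :: real
  have conth0: "isCont h0 s" for s
  proof -
    have "isCont (\<lambda>s. u s powr p) s"
      unfolding isCont_def using contu[of s, unfolded isCont_def] p u by (intro tendsto_powr') auto
    moreover have "isCont (\<lambda>s. exp (- s\<^sup>2 * p / 2)) s"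
      by (intro continuous_intros) simp_all
    ultimately show ?thesis
      unfolding h0_def[abs_def] by (intro isCont_mult continuous_const)
  qed
  have [measurable]: "h0 \<in> borel_measurable borel"
    using conth0 by (intro borel_measurable_continuous_onI continuous_at_imp_continuous_on) auto
  have h0: "0 \<le> h0 s" for s using k by (simp add: h0_def)
  define I where "I = (\<integral>\<^sup>+s. ennreal (h0 s) \<partial>lborel)"
  have I_le: "I \<le> ennreal (2 * sqrt pi / c)"
  proof -
    \<comment> \<open>The Gaussian factor of \<open>h0\<close> is at most 1 and is dropped.\<close>
    have "I \<le> (\<integral>\<^sup>+s. ennreal k * ennreal (u s powr p) \<partial>lborel)"
      unfolding I_def h0_def using k u p
      by (intro nn_integral_mono) (simp flip: ennreal_mult add: mult_left_le ennreal_leI)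
    also have "\<dots> = ennreal k * (\<integral>\<^sup>+s. ennreal (u s powr p) \<partial>lborel)"
      by (rule nn_integral_cmult) measurable
    also have "(\<integral>\<^sup>+s. ennreal (u s powr p) \<partial>lborel) = \<bar>2 / c\<bar> * (\<integral>\<^sup>+s. ennreal (u (0 + (2 / c) * s) powr p) \<partial>lborel)"
      using c by (intro nn_integral_real_affine) auto
    also have "(\<integral>\<^sup>+s. ennreal (u (0 + (2 / c) * s) powr p) \<partial>lborel) = (\<integral>\<^sup>+s. ennreal (\<bar>sinc s\<bar> powr p) \<partial>lborel)"
    proof (rule nn_integral_cong)
      fix s
      have "c * (0 + (2 / c) * s) / 2 = s" using c by simp
      then show "ennreal (u (0 + (2 / c) * s) powr p) = ennreal (\<bar>sinc s\<bar> powr p)"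
        unfolding u_def by (simp only:)
    qed
    also have "ennreal k * (ennreal \<bar>2 / c\<bar> * (\<integral>\<^sup>+s. ennreal (\<bar>sinc s\<bar> powr p) \<partial>lborel))
      \<le> ennreal k * (ennreal \<bar>2 / c\<bar> * ennreal (pi * sqrt (2 / p)))"
      by (intro mult_left_mono nn_integral_sinc_powr p) auto
    also have "\<dots> = ennreal (k * (\<bar>2 / c\<bar> * (pi * sqrt (2 / p))))"
    proof -
      have "ennreal x * (ennreal y * ennreal z) = ennreal (x * (y * z))" if "0 \<le> x" "0 \<le> y" "0 \<le> z" for x y z
        using that by (simp add: ennreal_mult)
      then show ?thesis by this (use k p in auto)
    qed
    also have "k * (\<bar>2 / c\<bar> * (pi * sqrt (2 / p))) = 2 * sqrt pi / c"
    proof -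
      have "sqrt (2 / p) = sqrt 2 * a"
        using a by (simp add: p_def real_sqrt_mult)
      then have "k * (\<bar>2 / c\<bar> * (pi * sqrt (2 / p))) = 2 / c * (pi / sqrt pi)"
        using a c by (simp add: k_def real_sqrt_mult)
      also have "pi / sqrt pi = sqrt pi"
        by (simp add: real_div_sqrt)
      finally show ?thesis by simp
    qed
    finally show ?thesis .
  qed
  define r where "r = enn2real I"
  have r: "I = ennreal r" "0 \<le> r" "r \<le> 2 * sqrt pi / c"
  proof -
    show 1: "I = ennreal r"
      unfolding r_def using I_le by (intro ennreal_enn2real[symmetric]) (auto simp: top_unique less_top[symmetric])
    show 2: "0 \<le> r" by (simp add: r_def)
    show "r \<le> 2 * sqrt pi / c" using I_le unfolding 1 using c by (subst (asm) ennreal_le_iff) auto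
  qed
  define F where "F = 2 * sqrt pi / c + \<eta>"
  have F: "0 < F" "r < F" using r(3) \<eta> c by (auto simp: F_def add_pos_pos)
  define m where "m = sqrt (6 * pi / p)"
  have m: "0 < m" using p by (simp add: m_def)
  have Ig: "(\<integral>\<^sup>+s. ennreal (g s) \<partial>lborel) = ennreal m"
  proof (rule antisym)
    have half: "(\<integral>\<^sup>+s. ennreal (g s) * indicator {0..} s \<partial>lborel) = ennreal (m / 2)"
      unfolding g_def m_def using p by (intro nn_integral_gaussian_half) simp
    have "(\<integral>\<^sup>+s. ennreal (g s) \<partial>lborel) \<le> 2 * (\<integral>\<^sup>+s. ennreal (g s) * indicator {0..} s \<partial>lborel)"
      by (rule nn_integral_even_le) (auto simp: g_def)
    also have "\<dots> = ennreal (2 * (m / 2))" unfolding half using m by (subst ennreal_mult) auto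
    finally show "(\<integral>\<^sup>+s. ennreal (g s) \<partial>lborel) \<le> ennreal m" by simp
    have "ennreal m = ennreal (m / 2) + ennreal (m / 2)" using m by (simp flip: ennreal_plus)
    also have "\<dots> = (\<integral>\<^sup>+s. ennreal (g s) * indicator {0..} s \<partial>lborel) + (\<integral>\<^sup>+s. ennreal (g (0 + (-1) * s)) * indicator {0..} (0 + (-1) * s) \<partial>lborel)"
      using half nn_integral_real_affine[of "\<lambda>s. ennreal (g s) * indicator {0..} s" "-1" 0] by (simp add: g_def)
    also have "\<dots> = (\<integral>\<^sup>+s. ennreal (g s) * indicator {0..} s + ennreal (g (0 + (-1) * s)) * indicator {0..} (0 + (-1) * s) \<partial>lborel)"
      by (rule nn_integral_add[symmetric]) (auto simp: g_def)
    also have "\<dots> \<le> (\<integral>\<^sup>+s. ennreal (g s) \<partial>lborel)"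
      by (rule nn_integral_mono_AE) (use AE_lborel_singleton[of 0] in \<open>eventually_elim; auto simp: g_def split: split_indicator\<close>)
    finally show "ennreal m \<le> (\<integral>\<^sup>+s. ennreal (g s) \<partial>lborel)" .
  qed
  \<comment> \<open>Brings the total mass of \<open>h\<close> to exactly \<open>F\<close>.\<close>
  define \<delta> where "\<delta> = (F - r) / m"
  have \<delta>: "0 < \<delta>" using F m by (simp add: \<delta>_def)
  define h where "h s = h0 s + \<delta> * g s" for s
  have conth: "isCont h s" for s
    unfolding h_def[abs_def] g_def using conth0 by (intro continuous_intros) auto
  have hpos: "0 < h s" for s
    using h0[of s] \<delta> by (simp add: h_def g_def add_nonneg_pos)
  have [measurable]: "g \<in> borel_measurable borel"
    unfolding g_def[abs_def] by measurable
  have "(\<integral>\<^sup>+s. ennreal (h s) \<partial>lborel) = (\<integral>\<^sup>+s. ennreal (h0 s) + ennreal \<delta> * ennreal (g s) \<partial>lborel)"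
    using h0 \<delta> by (intro nn_integral_cong) (simp add: h_def g_def ennreal_mult)
  also have "\<dots> = ennreal r + ennreal \<delta> * ennreal m"
    by (simp add: nn_integral_add nn_integral_cmult Ig I_def[symmetric] r(1))
  also have "\<dots> = ennreal (r + \<delta> * m)"
    using r(2) \<delta> m by (simp add: ennreal_mult)
  also have "r + \<delta> * m = F"
    using m by (simp add: \<delta>_def)
  finally have Ih: "(\<integral>\<^sup>+s. ennreal (h s) \<partial>lborel) = ennreal F" .
  obtain \<sigma> d where \<sigma>: "\<And>s. (\<sigma> has_real_derivative d s) (at s)" "\<And>s. 0 < d s"
    "\<And>s. h s = F * d s / a * std_normal_density (\<sigma> s / a)"
    using gaussian_transport_exists[OF conth hpos Ih F(1) a(1)] by metis
  show thesis
  proof (rule that[of \<sigma> d, OF \<sigma>(1) \<sigma>(2)])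
    fix s
    have *: "u s powr p * exp (- s\<^sup>2 * p / 2) \<le> F * d s * exp (- (\<sigma> s)\<^sup>2 * p / 2)"
    proof -
      have "k * (u s powr p * exp (- s\<^sup>2 * p / 2)) \<le> h s"
        using \<delta> by (simp add: h_def h0_def g_def)
      also have "\<dots> = k * (F * d s * exp (- (\<sigma> s)\<^sup>2 * p / 2))"
        unfolding \<sigma>(3) std_normal_density_def using a
        by (simp add: k_def p_def power_divide)
      finally show ?thesis using k by simp
    qed
    have "(u s powr p * exp (- s\<^sup>2 * p / 2)) powr a\<^sup>2 \<le> (F * d s * exp (- (\<sigma> s)\<^sup>2 * p / 2)) powr a\<^sup>2"
      by (rule powr_mono2[OF _ _ *]) auto
    moreover have "(u s powr p * exp (- s\<^sup>2 * p / 2)) powr a\<^sup>2 = u s * exp (- s\<^sup>2 / 2)"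
      using a u[of s] by (simp add: powr_mult powr_powr exp_powr_real p_def)
    moreover have "(F * d s * exp (- (\<sigma> s)\<^sup>2 * p / 2)) powr a\<^sup>2 = F powr a\<^sup>2 * d s powr a\<^sup>2 * exp (- (\<sigma> s)\<^sup>2 / 2)"
      using a by (simp add: powr_mult powr_powr exp_powr_real p_def)
    ultimately show "\<bar>sinc (c * s / 2)\<bar> * exp (- s\<^sup>2 / 2)
      \<le> (2 * sqrt pi / c + \<eta>) powr a\<^sup>2 * d s powr a\<^sup>2 * exp (- (\<sigma> s)\<^sup>2 / 2)"
      unfolding F_def u_def by (simp only:)
  qed
qed

section \<open>The Laplace transform of the projected cube\<close>

lemma
  fixes f :: "'n::finite \<Rightarrow> real \<Rightarrow> complex"
  assumes f: "\<And>i. integrable lborel (f i)"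
  shows integrable_lborel_vec_prod: "integrable lborel (\<lambda>x::real ^ 'n. \<Prod>i\<in>UNIV. f i (x $ i))"
    and integral_lborel_vec_prod: "(\<integral>x. (\<Prod>i\<in>UNIV. f i (x $ i)) \<partial>(lborel :: (real ^ 'n) measure)) = (\<Prod>i\<in>UNIV. \<integral>x. f i x \<partial>lborel)"
proof -
  interpret product_sigma_finite "\<lambda>_::'n. lborel :: real measure" ..
  have [measurable]: "f i \<in> borel_measurable borel" for i
    using borel_measurable_integrable[OF f[of i]] by simp
  have "integrable (PiM UNIV (\<lambda>_::'n. lborel)) (\<lambda>x. \<Prod>i\<in>UNIV. f i (x i))"
    using f by (intro product_integrable_prod) auto
  then show "integrable lborel (\<lambda>x::real ^ 'n. \<Prod>i\<in>UNIV. f i (x $ i))"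
    by (subst lborel_vec_eq_distr_PiM, subst integrable_distr_eq) auto
  have "(\<integral>x. (\<Prod>i\<in>UNIV. f i (x $ i)) \<partial>(lborel :: (real ^ 'n) measure)) = (\<integral>x. (\<Prod>i\<in>UNIV. f i (x i)) \<partial>PiM UNIV (\<lambda>_::'n. lborel))"
    by (subst lborel_vec_eq_distr_PiM, subst integral_distr) auto
  also have "\<dots> = (\<Prod>i\<in>UNIV. \<integral>x. f i x \<partial>lborel)"
    using f by (intro product_integral_prod) auto
  finally show "(\<integral>x. (\<Prod>i\<in>UNIV. f i (x $ i)) \<partial>(lborel :: (real ^ 'n) measure)) = (\<Prod>i\<in>UNIV. \<integral>x. f i x \<partial>lborel)" .
qed

lemma iexp_inner_vec: "iexp (w \<bullet> x) = (\<Prod>i\<in>UNIV. iexp (w $ i * x $ i))" for w x :: "real ^ 'n"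
proof -
  have "\<i> * complex_of_real (w \<bullet> x) = (\<Sum>i\<in>UNIV. \<i> * complex_of_real (w $ i * x $ i))"
    by (simp add: inner_vec_def sum_distrib_left)
  then show ?thesis
    by (simp only: exp_sum finite_class.finite_UNIV)
qed

definition gauss_density :: "real ^ 'n::finite \<Rightarrow> real" where
  "gauss_density x = (\<Prod>i\<in>UNIV. std_normal_density (x $ i))"

lemma gauss_density_pos: "0 < gauss_density x"
  by (simp add: gauss_density_def prod_pos normal_density_pos)

lemma gauss_density_measurable [measurable]: "gauss_density \<in> borel_measurable borel"
  unfolding gauss_density_def[abs_def] by measurable

lemma gauss_density_eq: "gauss_density (x :: real ^ 'n) = (1 / sqrt (2 * pi)) ^ CARD('n) * exp (- (norm x)\<^sup>2 / 2)"
proof -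
  have "(norm x)\<^sup>2 = (\<Sum>i\<in>UNIV. (x $ i)\<^sup>2)"
    unfolding power2_norm_eq_inner by (simp add: inner_vec_def power2_eq_square)
  then have "exp (- (norm x)\<^sup>2 / 2) = (\<Prod>i\<in>UNIV. exp (- (x $ i)\<^sup>2 / 2))"
    by (simp flip: exp_sum add: sum_negf sum_divide_distrib[symmetric])
  then show ?thesis
    unfolding gauss_density_def std_normal_density_def prod.distrib by simp
qed

lemma nn_integral_gauss_density: "(\<integral>\<^sup>+x. ennreal (gauss_density (x :: real ^ 'n)) \<partial>lborel) = 1"
proof -
  interpret product_sigma_finite "\<lambda>_::'n. lborel :: real measure" ..
  have "(\<integral>\<^sup>+x. ennreal (gauss_density (x :: real ^ 'n)) \<partial>lborel) = (\<integral>\<^sup>+g. (\<Prod>i\<in>UNIV. ennreal (std_normal_density (g i))) \<partial>PiM UNIV (\<lambda>_::'n. lborel))"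
    by (subst nn_integral_lborel_vec) (auto simp: gauss_density_def prod_ennreal)
  also have "\<dots> = (\<Prod>i\<in>(UNIV :: 'n set). \<integral>\<^sup>+x. ennreal (std_normal_density x) \<partial>lborel)"
    by (rule product_nn_integral_prod) auto
  also have "(\<integral>\<^sup>+x. ennreal (std_normal_density x) \<partial>lborel) = 1"
    by (subst nn_integral_eq_integral) auto
  finally show ?thesis by simp
qed

lemma integrable_gauss_density: "integrable lborel (gauss_density :: real ^ 'n \<Rightarrow> real)"
proof (rule integrableI_nonneg)
  show "(\<integral>\<^sup>+x. ennreal (gauss_density (x :: real ^ 'n)) \<partial>lborel) < \<infinity>"
    by (simp add: nn_integral_gauss_density)
  show "AE x in lborel. 0 \<le> gauss_density (x :: real ^ 'n)"
    by (simp add: gauss_density_pos less_imp_le)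
qed simp

text \<open>Read from right to left, it replaces a Gaussian of a vector by an average of characters,
  in which the coordinates of the cube separate.\<close>

lemma integral_gauss_iexp:
  fixes w :: "real ^ 'n"
  shows "(\<integral>x. complex_of_real (gauss_density x) * iexp (w \<bullet> x) \<partial>lborel) = complex_of_real (exp (- (norm w)\<^sup>2 / 2))"
proof -
  let ?f = "\<lambda>i x. complex_of_real (std_normal_density x) * iexp (w $ i * x)"
  have int: "integrable lborel (?f i)" for i
  proof (rule Bochner_Integration.integrable_bound)
    show "integrable lborel std_normal_density" by simp
  qed (auto simp: norm_mult)
  have char: "(\<integral>x. ?f i x \<partial>lborel) = complex_of_real (exp (- (w $ i)\<^sup>2 / 2))" for i
  proof -
    have "complex_of_real (exp (- (w $ i)\<^sup>2 / 2)) = char std_normal_distribution (w $ i)"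
      by (simp add: char_std_normal_distribution)
    also have "\<dots> = (\<integral>x. std_normal_density x *\<^sub>R iexp (w $ i * x) \<partial>lborel)"
      unfolding char_def by (subst integral_density) auto
    finally show ?thesis by (simp add: scaleR_conv_of_real)
  qed
  have "(\<integral>x. complex_of_real (gauss_density x) * iexp (w \<bullet> x) \<partial>lborel) = (\<integral>x. (\<Prod>i\<in>UNIV. ?f i (x $ i)) \<partial>(lborel :: (real ^ 'n) measure))"
    unfolding iexp_inner_vec gauss_density_def by (simp add: prod.distrib)
  also have "\<dots> = (\<Prod>i\<in>UNIV. complex_of_real (exp (- (w $ i)\<^sup>2 / 2)))"
    by (subst integral_lborel_vec_prod[OF int]) (simp only: char)
  also have "\<dots> = complex_of_real (exp (- (norm w)\<^sup>2 / 2))"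
  proof -
    have "(norm w)\<^sup>2 = (\<Sum>i\<in>UNIV. (w $ i)\<^sup>2)"
      unfolding power2_norm_eq_inner by (simp add: inner_vec_def power2_eq_square)
    then show ?thesis
      by (simp flip: exp_sum of_real_prod add: sum_negf sum_divide_distrib[symmetric])
  qed
  finally show ?thesis .
qed

lemma integral_iexp_half_interval:
  "(\<integral>x. indicator {- 1 / 2 .. 1 / 2} x *\<^sub>R iexp (r * x) \<partial>lborel) = complex_of_real (sinc (r / 2))"
proof (cases "r = 0")
  case True
  then show ?thesis by (simp add: one_complex_def)
next
  case False
  let ?F = "\<lambda>x. iexp (r * x) / (\<i> * r)"
  have "(\<integral>x. indicator {- 1 / 2 .. 1 / 2} x *\<^sub>R iexp (r * x) \<partial>lborel) = ?F (1 / 2) - ?F (- 1 / 2)"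
  proof (rule integral_FTC_Icc)
    fix x :: real
    have "((\<lambda>x. r * x) has_vector_derivative r) (at x within {- 1 / 2 .. 1 / 2})"
      by (auto intro!: derivative_eq_intros)
    from vector_diff_chain_within[OF this has_vector_derivative_iexp]
    have "((\<lambda>x. iexp (r * x)) has_vector_derivative r *\<^sub>R (\<i> * iexp (r * x))) (at x within {- 1 / 2 .. 1 / 2})"
      by (simp only: o_def)
    from has_vector_derivative_mult_right[OF this, of "1 / (\<i> * r)"]
    show "(?F has_vector_derivative iexp (r * x)) (at x within {- 1 / 2 .. 1 / 2})"
      using False by (simp add: scaleR_conv_of_real)
  next
    show "continuous_on {- 1 / 2 .. 1 / 2} (\<lambda>x. iexp (r * x))"
      by (intro continuous_intros)
  qed simp
  also have "\<dots> = complex_of_real (sinc (r / 2))"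
    using False by (simp add: complex_eq_iff Re_exp Im_exp Re_divide Im_divide power2_eq_square field_simps)
  finally show ?thesis .
qed

lemma integral_unit_cube_iexp:
  fixes r :: "real ^ 'n"
  shows "(\<integral>z. complex_of_real (indicator unit_cube z) * iexp (r \<bullet> z) \<partial>lborel) = complex_of_real (\<Prod>i\<in>UNIV. sinc (r $ i / 2))"
proof -
  let ?f = "\<lambda>i x. indicator {- 1 / 2 .. 1 / 2} x *\<^sub>R iexp (r $ i * x)"
  have int: "integrable lborel (?f i)" for i
  proof (rule Bochner_Integration.integrable_bound)
    show "integrable lborel (indicator {- 1 / 2 .. 1 / 2 :: real} :: real \<Rightarrow> real)" by simp
  qed (auto split: split_indicator)
  have "complex_of_real (indicator unit_cube z) * iexp (r \<bullet> z) = (\<Prod>i\<in>UNIV. ?f i (z $ i))" for z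
  proof (cases "z \<in> unit_cube")
    case True
    then show ?thesis by (simp add: iexp_inner_vec unit_cube_def)
  next
    case False
    then obtain i where "z $ i \<notin> {- 1 / 2 .. 1 / 2}" by (auto simp: unit_cube_def)
    then have "?f i (z $ i) = 0" by simp
    then have "(\<Prod>i\<in>UNIV. ?f i (z $ i)) = 0" by (intro prod_zero) auto
    then show ?thesis using False by simp
  qed
  then have "(\<integral>z. complex_of_real (indicator unit_cube z) * iexp (r \<bullet> z) \<partial>lborel) = (\<Prod>i\<in>UNIV. \<integral>x. ?f i x \<partial>lborel)"
    by (simp only: integral_lborel_vec_prod[OF int])
  also have "\<dots> = complex_of_real (\<Prod>i\<in>UNIV. sinc (r $ i / 2))"
    by (simp only: integral_iexp_half_interval of_real_prod)
  finally show ?thesis .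
qed

section \<open>From the cube to a product of sinc functions\<close>

text \<open>The Laplace transform at t of the squared length of the projection of a uniform point of
  the cube.\<close>

definition cube_laplace :: "(real ^ 'n::finite) set \<Rightarrow> real \<Rightarrow> ennreal" where
  "cube_laplace E t = (\<integral>\<^sup>+z. ennreal (exp (- t * (norm (orth_proj E z))\<^sup>2)) * indicator unit_cube z \<partial>lborel)"

lemma orth_proj_borel: "subspace E \<Longrightarrow> orth_proj E \<in> borel_measurable borel"
  by (intro borel_measurable_continuous_onI linear_continuous_on)
    (simp add: linear_conv_bounded_linear[symmetric] orth_proj_linear)

text \<open>For a standard Gaussian g, exp (- c^2 * |P z|^2 / 2) is the mean of exp (i * c * (P z
  \<bullet> g)). Since P is selfadjoint, P z \<bullet> g = z \<bullet> P g, so after Fubini the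
  integral over z is the Fourier transform of the cube at c * P g, a product of \<open>sinc\<close>
  values. Absolute values give the bound.\<close>

lemma cube_laplace_le_sinc:
  fixes E :: "(real ^ 'n) set"
  assumes E: "subspace E" and c: "0 < c"
  shows "cube_laplace E (c\<^sup>2 / 2) \<le>
    (\<integral>\<^sup>+g. ennreal ((\<Prod>i\<in>UNIV. \<bar>sinc (c * orth_proj E g $ i / 2)\<bar>) * gauss_density g) \<partial>lborel)"
proof -
  let ?P = "orth_proj E"
  let ?L = "lborel :: (real ^ 'n) measure"
  note orth_proj_borel[OF E, measurable]
  interpret P: linear ?P by (rule orth_proj_linear[OF E])
  define q :: "real ^ 'n \<Rightarrow> real" where "q = indicator unit_cube"
  have [measurable]: "q \<in> borel_measurable borel" by (simp add: q_def)
  have q: "0 \<le> q z" for z by (simp add: q_def)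
  define f :: "real ^ 'n \<Rightarrow> real ^ 'n \<Rightarrow> complex" where
    "f z g = complex_of_real (q z) * (complex_of_real (gauss_density g) * iexp ((c *\<^sub>R ?P z) \<bullet> g))" for z g
  have fnorm: "norm (f z g) = q z * gauss_density g" for z g
    using q gauss_density_pos[of g] by (simp add: f_def norm_mult less_imp_le)
  have [measurable]: "case_prod f \<in> borel_measurable (?L \<Otimes>\<^sub>M ?L)"
    unfolding f_def[abs_def] by measurable
  have q1: "(\<integral>\<^sup>+z. ennreal (q z) \<partial>lborel) = 1"
    by (simp add: q_def emeasure_unit_cube ennreal_indicator)
  have int: "integrable (?L \<Otimes>\<^sub>M ?L) (case_prod f)"
  proof (rule integrableI_bounded)
    have "(\<integral>\<^sup>+x. ennreal (norm (case_prod f x)) \<partial>(?L \<Otimes>\<^sub>M ?L)) = (\<integral>\<^sup>+z. \<integral>\<^sup>+g. ennreal (q z) * ennreal (gauss_density (g :: real ^ 'n)) \<partial>lborel \<partial>lborel)"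
      using q by (subst lborel.nn_integral_fst[symmetric]) (auto simp: fnorm ennreal_mult gauss_density_pos less_imp_le)
    also have "\<dots> = 1"
      by (simp add: nn_integral_cmult nn_integral_gauss_density q1)
    finally show "(\<integral>\<^sup>+x. ennreal (norm (case_prod f x)) \<partial>(?L \<Otimes>\<^sub>M ?L)) < \<infinity>" by simp
  qed simp
  have "(\<integral>z. \<integral>g. f z g \<partial>lborel \<partial>lborel) = (\<integral>z. complex_of_real (exp (- (c\<^sup>2 / 2) * (norm (?P z))\<^sup>2) * q z) \<partial>lborel)"
  proof (rule Bochner_Integration.integral_cong[OF refl])
    fix z
    have "(\<integral>g. f z g \<partial>lborel) = complex_of_real (q z) * complex_of_real (exp (- (norm (c *\<^sub>R ?P z))\<^sup>2 / 2))"
      unfolding f_def by (subst integral_mult_right_zero) (simp only: integral_gauss_iexp)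
    also have "- (norm (c *\<^sub>R ?P z))\<^sup>2 / 2 = - (c\<^sup>2 / 2) * (norm (?P z))\<^sup>2"
      by (simp add: power_mult_distrib)
    finally show "(\<integral>g. f z g \<partial>lborel) = complex_of_real (exp (- (c\<^sup>2 / 2) * (norm (?P z))\<^sup>2) * q z)"
      by (simp add: mult.commute)
  qed
  also have "\<dots> = complex_of_real (\<integral>z. exp (- (c\<^sup>2 / 2) * (norm (?P z))\<^sup>2) * q z \<partial>lborel)"
    by (rule integral_complex_of_real)
  finally have 1: "(\<integral>z. \<integral>g. f z g \<partial>lborel \<partial>lborel) = complex_of_real (\<integral>z. exp (- (c\<^sup>2 / 2) * (norm (?P z))\<^sup>2) * q z \<partial>lborel)" .
  have 2: "(\<integral>z. \<integral>g. f z g \<partial>lborel \<partial>lborel) = (\<integral>g. \<integral>z. f z g \<partial>lborel \<partial>lborel)"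
    by (rule lborel_pair.Fubini_integral[OF int, symmetric])
  have "(\<integral>z. f z g \<partial>lborel) = complex_of_real (gauss_density g * (\<Prod>i\<in>UNIV. sinc ((c *\<^sub>R ?P g) $ i / 2)))" for g
  proof -
    have "(\<integral>z. f z g \<partial>lborel) = (\<integral>z. complex_of_real (gauss_density g) * (complex_of_real (indicator unit_cube z) * iexp ((c *\<^sub>R ?P g) \<bullet> z)) \<partial>lborel)"
    proof (rule Bochner_Integration.integral_cong[OF refl])
      fix z :: "real ^ 'n"
      have "(c *\<^sub>R ?P z) \<bullet> g = (c *\<^sub>R ?P g) \<bullet> z"
        using orth_proj_selfadjoint[OF E, of z g] by (simp add: inner_commute)
      then show "f z g = complex_of_real (gauss_density g) * (complex_of_real (indicator unit_cube z) * iexp ((c *\<^sub>R ?P g) \<bullet> z))"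
        unfolding f_def q_def by (simp only: mult_ac)
    qed
    also have "\<dots> = complex_of_real (gauss_density g) * complex_of_real (\<Prod>i\<in>UNIV. sinc ((c *\<^sub>R ?P g) $ i / 2))"
      by (subst integral_mult_right_zero) (simp only: integral_unit_cube_iexp)
    finally show ?thesis by (simp only: of_real_mult)
  qed
  then have "norm (\<integral>z. f z g \<partial>lborel) = (\<Prod>i\<in>UNIV. \<bar>sinc (c * ?P g $ i / 2)\<bar>) * gauss_density g" for g
    using gauss_density_pos[of g] by (simp only: norm_of_real abs_mult abs_prod abs_of_pos vector_scaleR_component real_scaleR_def mult.commute[of "gauss_density g"])
  moreover have "integrable lborel (\<lambda>g. \<integral>z. f z g \<partial>lborel)"
    using lborel_pair.integrable_snd[OF int] .
  ultimately have "ennreal (norm (\<integral>g. \<integral>z. f z g \<partial>lborel \<partial>lborel)) \<le>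
    (\<integral>\<^sup>+g. ennreal ((\<Prod>i\<in>UNIV. \<bar>sinc (c * ?P g $ i / 2)\<bar>) * gauss_density g) \<partial>lborel)"
    using integral_norm_bound_ennreal[of lborel "\<lambda>g. \<integral>z. f z g \<partial>lborel"] by (simp only:)
  moreover have "cube_laplace E (c\<^sup>2 / 2) \<le> ennreal (norm (\<integral>g. \<integral>z. f z g \<partial>lborel \<partial>lborel))"
  proof -
    have "integrable lborel (\<lambda>z. exp (- (c\<^sup>2 / 2) * (norm (?P z))\<^sup>2) * q z)"
    proof (rule Bochner_Integration.integrable_bound)
      show "integrable lborel q"
        by (rule integrableI_nonneg) (auto simp: q q1)
    qed (auto simp: abs_mult q mult_left_le_one_le)
    then have "(\<integral>\<^sup>+z. ennreal (exp (- (c\<^sup>2 / 2) * (norm (?P z))\<^sup>2) * q z) \<partial>lborel)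
       = ennreal (\<integral>z. exp (- (c\<^sup>2 / 2) * (norm (?P z))\<^sup>2) * q z \<partial>lborel)"
      using q by (intro nn_integral_eq_integral) auto
    moreover have "cube_laplace E (c\<^sup>2 / 2) = (\<integral>\<^sup>+z. ennreal (exp (- (c\<^sup>2 / 2) * (norm (?P z))\<^sup>2) * q z) \<partial>lborel)"
      unfolding cube_laplace_def by (intro nn_integral_cong) (auto simp: q_def split: split_indicator)
    ultimately show ?thesis
      unfolding 2[symmetric] 1 norm_of_real by (simp add: ennreal_leI)
  qed
  ultimately show ?thesis by (rule order_trans[rotated])
qed

lemma sum_norm_orth_proj_axis:
  fixes E :: "(real ^ 'n) set"
  assumes "subspace E"
  shows "(\<Sum>i\<in>UNIV. (norm (orth_proj E (axis i 1)))\<^sup>2) = real (dim E)"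
  using sum_norm_orth_proj_Basis[OF assms] unfolding Basis_eq_range_axis
  by (subst (asm) sum.reindex[OF inj_axis_1]) auto

text \<open>Coordinate i contributes (2 * sqrt pi / c + \<eta>)^(a_i^2), and the a_i^2 add up to the
  dimension of \<open>E\<close>. The bound 1 / 2 on a_i^2 is the condition p \<ge> 2 of Ball's
  inequality, and \<eta> tends to 0 at the end.\<close>

lemma cube_laplace_le_balanced:
  fixes E :: "(real ^ 'm::{finite,wellorder}) set"
  assumes E: "subspace E" and c: "0 < c" and bal: "\<And>i. (norm (orth_proj E (axis i 1)))\<^sup>2 \<le> 1 / 2"
  shows "cube_laplace E (c\<^sup>2 / 2) \<le> ennreal ((2 * sqrt pi / c) ^ dim E)"
proof -
  let ?P = "orth_proj E"
  let ?a = "\<lambda>i. norm (?P (axis i 1))"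
  let ?F = "2 * sqrt pi / c"
  have step: "cube_laplace E (c\<^sup>2 / 2) \<le> ennreal ((?F + \<eta>) ^ dim E)" if \<eta>: "0 < \<eta>" for \<eta>
  proof -
    have Fpos: "0 < ?F + \<eta>" using c \<eta> by (simp add: add_pos_pos)
    have "\<exists>\<sigma> d. (\<forall>s. (\<sigma> has_real_derivative d s) (at s)) \<and> (\<forall>s. 0 < d s) \<and>
      (\<forall>s. \<bar>sinc (c * s / 2)\<bar> * exp (- s\<^sup>2 / 2) \<le> (?F + \<eta>) powr (?a i)\<^sup>2 * d s powr (?a i)\<^sup>2 * exp (- (\<sigma> s)\<^sup>2 / 2))" for i
    proof (cases "?a i = 0")
      \<comment> \<open>There is no exponent 1 / a^2 here, but |sinc| is at most 1 and both powers
        have exponent 0, so the identity map will do.\<close>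
      case True
      have "\<bar>sinc (c * s / 2)\<bar> * exp (- s\<^sup>2 / 2) \<le> 1 * exp (- s\<^sup>2 / 2)" for s
        by (intro mult_right_mono abs_sinc_le_1) simp
      then show ?thesis
        using Fpos unfolding True
        by (intro exI[of _ "\<lambda>s. s"] exI[of _ "\<lambda>s. 1"] conjI allI) (auto simp del: if_split)
    next
      case False
      then have "0 < ?a i" by simp
      from sinc_coordinate_transport[OF this bal c \<eta>] show ?thesis by metis
    qed
    then obtain \<sigma> d where \<sigma>: "\<And>i s. (\<sigma> i has_real_derivative d i s) (at s)" "\<And>i s. 0 < d i s"
      "\<And>i s. \<bar>sinc (c * s / 2)\<bar> * exp (- s\<^sup>2 / 2) \<le> (?F + \<eta>) powr (?a i)\<^sup>2 * d i s powr (?a i)\<^sup>2 * exp (- (\<sigma> i s)\<^sup>2 / 2)"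
      by metis
    define K :: real where "K = (1 / sqrt (2 * pi)) ^ CARD('m)"
    have K: "0 < K" by (simp add: K_def)
    have gd: "gauss_density x = K * exp (- (norm x)\<^sup>2 / 2)" for x :: "real ^ 'm::_"
      by (simp add: gauss_density_eq K_def)
    have G: "integrable lborel (\<lambda>y::real ^ 'm::_. exp (- (norm y)\<^sup>2 / 2))"
      using integrable_mult_right[OF integrable_gauss_density[where 'n='m], of "1 / K"] K by (simp add: gd)
    have "cube_laplace E (c\<^sup>2 / 2) \<le> (\<integral>\<^sup>+g. ennreal ((\<Prod>i\<in>UNIV. \<bar>sinc (c * ?P g $ i / 2)\<bar>) * gauss_density g) \<partial>lborel)"
      by (rule cube_laplace_le_sinc[OF E c])
    also have "\<dots> = (\<integral>\<^sup>+g. ennreal K * ennreal ((\<Prod>i\<in>UNIV. \<bar>sinc (c * ?P g $ i / 2)\<bar>) * exp (- (norm g)\<^sup>2 / 2)) \<partial>lborel)"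
    proof (rule nn_integral_cong)
      fix g :: "real ^ 'm::_"
      have "ennreal (A * (K * B)) = ennreal K * ennreal (A * B)" if "0 \<le> A" "0 \<le> B" for A B
        using K that by (simp add: mult_ac flip: ennreal_mult)
      then show "ennreal ((\<Prod>i\<in>UNIV. \<bar>sinc (c * ?P g $ i / 2)\<bar>) * gauss_density g)
         = ennreal K * ennreal ((\<Prod>i\<in>UNIV. \<bar>sinc (c * ?P g $ i / 2)\<bar>) * exp (- (norm g)\<^sup>2 / 2))"
        unfolding gd by this (intro prod_nonneg ballI abs_ge_zero exp_ge_zero)+
    qed
    also have "\<dots> = ennreal K * (\<integral>\<^sup>+g. ennreal ((\<Prod>i\<in>UNIV. \<bar>sinc (c * ?P g $ i / 2)\<bar>) * exp (- (norm g)\<^sup>2 / 2)) \<partial>lborel)"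
    proof (rule nn_integral_cmult)
      note orth_proj_borel[OF E, measurable]
      have "(\<lambda>g. ennreal ((\<Prod>i\<in>UNIV. \<bar>S (c * ?P g $ i / 2)\<bar>) * exp (- (norm g)\<^sup>2 / 2))) \<in> borel_measurable lborel"
        if [measurable]: "S \<in> borel_measurable borel" for S :: "real \<Rightarrow> real"
        by measurable
      from this[OF borel_measurable_sinc]
      show "(\<lambda>g. ennreal ((\<Prod>i\<in>UNIV. \<bar>sinc (c * ?P g $ i / 2)\<bar>) * exp (- (norm g)\<^sup>2 / 2))) \<in> borel_measurable lborel" .
    qed
    also have "\<dots> \<le> ennreal K * (ennreal (\<Prod>i\<in>UNIV. (?F + \<eta>) powr (?a i)\<^sup>2) * (\<integral>\<^sup>+y. ennreal (exp (- (norm (y :: real ^ 'm::_))\<^sup>2 / 2)) \<partial>lborel))"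
      using brascamp_lieb_transport[OF E _ \<sigma>(1) \<sigma>(2) \<sigma>(3) G] by (intro mult_left_mono) auto
    also have "\<dots> = ennreal (\<Prod>i\<in>UNIV. (?F + \<eta>) powr (?a i)\<^sup>2) * (ennreal K * (\<integral>\<^sup>+y. ennreal (exp (- (norm (y :: real ^ 'm::_))\<^sup>2 / 2)) \<partial>lborel))"
      by (simp only: mult_ac)
    also have "ennreal K * (\<integral>\<^sup>+y. ennreal (exp (- (norm (y :: real ^ 'm::_))\<^sup>2 / 2)) \<partial>lborel) = 1"
      unfolding nn_integral_gauss_density[symmetric, where 'n='m] gd using K
      by (subst nn_integral_cmult[symmetric]) (auto simp: ennreal_mult)
    also have "(\<Prod>i\<in>UNIV. (?F + \<eta>) powr (?a i)\<^sup>2) = (?F + \<eta>) powr (real (dim E))"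
      using Fpos unfolding sum_norm_orth_proj_axis[OF E, symmetric] by (subst powr_sum) auto
    finally show ?thesis
      using Fpos by (simp add: powr_realpow)
  qed
  have "((\<lambda>\<eta>. ennreal ((?F + \<eta>) ^ dim E)) \<longlongrightarrow> ennreal ((?F + 0) ^ dim E)) (at_right 0)"
    by (intro tendsto_ennrealI tendsto_power tendsto_add tendsto_const tendsto_ident_at)
  then show ?thesis
    using step by (intro tendsto_lowerbound[where F="at_right (0::real)"])
      (auto simp: eventually_at_right_field intro!: exI[of _ 1])
qed

section \<open>Removing basis vectors with a long projection\<close>

lemma nn_integral_gaussian_affine:
  fixes a b t :: real
  assumes "0 < t" "0 < a"
  shows "(\<integral>\<^sup>+y. ennreal (exp (- t * (a * y + b)\<^sup>2)) \<partial>lborel) = ennreal (sqrt (pi / (t * a\<^sup>2)))"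
proof -
  define \<sigma> where "\<sigma> = sqrt (1 / (2 * t * a\<^sup>2))"
  have \<sigma>: "0 < \<sigma>" "\<sigma>\<^sup>2 = 1 / (2 * t * a\<^sup>2)"
    using assms by (auto simp: \<sigma>_def)
  have "exp (- t * (a * y + b)\<^sup>2) = sqrt (pi / (t * a\<^sup>2)) * normal_density (- b / a) \<sigma> y" for y
  proof -
    have "- (y - (- b / a))\<^sup>2 / (2 * \<sigma>\<^sup>2) = - t * (a * y + b)\<^sup>2"
      using assms unfolding \<sigma>(2) by (simp add: field_simps power2_eq_square)
    moreover have "2 * pi * \<sigma>\<^sup>2 = pi / (t * a\<^sup>2)"
      unfolding \<sigma>(2) by simp
    ultimately show ?thesis
      using assms unfolding normal_density_def by simp
  qed
  then have "(\<integral>\<^sup>+y. ennreal (exp (- t * (a * y + b)\<^sup>2)) \<partial>lborel)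
     = (\<integral>\<^sup>+y. ennreal (sqrt (pi / (t * a\<^sup>2))) * ennreal (normal_density (- b / a) \<sigma> y) \<partial>lborel)"
    using assms by (simp add: ennreal_mult)
  also have "\<dots> = ennreal (sqrt (pi / (t * a\<^sup>2))) * (\<integral>\<^sup>+y. ennreal (normal_density (- b / a) \<sigma> y) \<partial>lborel)"
    by (rule nn_integral_cmult) measurable
  also have "(\<integral>\<^sup>+y. ennreal (normal_density (- b / a) \<sigma> y) \<partial>lborel) = 1"
    using \<sigma>(1) by (subst nn_integral_eq_integral) auto
  finally show ?thesis by simp
qed

text \<open>Splits \<open>E\<close> orthogonally into the line of \<open>u\<close> and
  \<open>E'\<close>, so that the Gaussian of the projection factors.\<close>

lemma orth_proj_hyperplane_section:
  fixes E :: "'a::euclidean_space set"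
  assumes E: "subspace E" and u: "u \<in> E" "norm u = 1"
  defines "E' \<equiv> E \<inter> {x. u \<bullet> x = 0}"
  shows "subspace E'" "dim E = Suc (dim E')"
    "(norm (orth_proj E z))\<^sup>2 = (norm (orth_proj E' z))\<^sup>2 + (z \<bullet> u)\<^sup>2"
proof -
  show E': "subspace E'"
    using E subspace_inter[OF _ subspace_hyperplane] unfolding E'_def by blast
  have uu: "u \<bullet> u = 1" using u by (simp add: norm_eq_1)
  have "span E' = E'"
    using E' by (simp only: span_eq_iff)
  moreover have "u \<notin> E'"
    using uu by (simp add: E'_def)
  ultimately have notin: "u \<notin> span E'"
    by (simp only: not_False_eq_True)
  have "span (insert u E') = E"
  proof (intro equalityI subsetI)
    fix x assume "x \<in> span (insert u E')"
    moreover have "span (insert u E') \<subseteq> E"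
      using E u(1) by (intro span_minimal) (auto simp: E'_def)
    ultimately show "x \<in> E" by blast
  next
    fix x assume x: "x \<in> E"
    have "x - (u \<bullet> x) *\<^sub>R u \<in> E'"
      using x u(1) uu E by (auto simp: E'_def inner_diff_right intro!: subspace_diff subspace_scale)
    then have "x - (u \<bullet> x) *\<^sub>R u \<in> span E'" by (rule span_base)
    then show "x \<in> span (insert u E')"
      using span_breakdown_eq[of x u E'] by blast
  qed
  then show "dim E = Suc (dim E')"
    using dim_insert[of u E'] notin by (metis Suc_eq_plus1 dim_span)
  have Pu: "u \<bullet> orth_proj E z = z \<bullet> u"
    using orth_proj_selfadjoint[OF E, of u z] orth_proj_fixed[OF E u(1)] by (simp add: inner_commute)
  have "orth_proj E' z = orth_proj E z - (z \<bullet> u) *\<^sub>R u"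
  proof (rule orth_proj_unique[OF E'])
    show "orth_proj E z - (z \<bullet> u) *\<^sub>R u \<in> E'"
      using E u(1) orth_proj_in[OF E, of z] Pu uu
      by (auto simp: E'_def inner_diff_right intro!: subspace_diff subspace_scale)
    fix e assume e: "e \<in> E'"
    then have "(z - orth_proj E z) \<bullet> e = 0" "u \<bullet> e = 0"
      using inner_orth_proj_diff[OF E, of e z] by (auto simp: E'_def)
    then show "(z - (orth_proj E z - (z \<bullet> u) *\<^sub>R u)) \<bullet> e = 0"
      by (simp add: inner_diff_left)
  qed
  then have eq: "orth_proj E z = orth_proj E' z + (z \<bullet> u) *\<^sub>R u" by simp
  have "u \<bullet> orth_proj E' z = 0"
    using orth_proj_in[OF E', of z] by (simp add: E'_def)
  then show "(norm (orth_proj E z))\<^sup>2 = (norm (orth_proj E' z))\<^sup>2 + (z \<bullet> u)\<^sup>2"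
    unfolding eq power2_norm_eq_inner using uu
    by (simp add: inner_add_left inner_add_right inner_commute power2_eq_square)
qed

text \<open>\<open>E'\<close> is the orthogonal complement in \<open>E\<close> of the projection of the \<open>j\<close>-th basis vector. It is orthogonal to
  that basis vector, so the integral over \<open>z $ j\<close> is Gaussian once it is extended from the cube to the line.\<close>

lemma cube_laplace_le_hyperplane_section:
  fixes E :: "(real ^ 'n) set"
  assumes E: "subspace E" and c: "0 < c" and j: "1 / 2 < (norm (orth_proj E (axis j 1)))\<^sup>2"
  shows "\<exists>E' :: (real ^ 'n) set. subspace E' \<and> dim E = Suc (dim E') \<and>
    cube_laplace E (c\<^sup>2 / 2) \<le> ennreal (2 * sqrt pi / c) * cube_laplace E' (c\<^sup>2 / 2)"
proof -
  define a where "a = norm (orth_proj E (axis j 1))"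
  have a2: "1 / 2 < a\<^sup>2" using j by (simp add: a_def)
  then have a: "0 < a" unfolding a_def by (metis norm_ge_zero less_le power_zero_numeral half_gt_zero_iff not_less zero_less_one)
  define u where "u = (1 / a) *\<^sub>R orth_proj E (axis j 1)"
  have u: "u \<in> E" "norm u = 1"
    using E a orth_proj_in[OF E] by (auto simp: u_def a_def subspace_scale)
  define E' where "E' = E \<inter> {x. u \<bullet> x = 0}"
  note sec = orth_proj_hyperplane_section[OF E u, folded E'_def]
  let ?P = "orth_proj E'"
  interpret P: linear ?P by (rule orth_proj_linear[OF sec(1)])
  define t where "t = c\<^sup>2 / 2"
  have t: "0 < t" using c by (simp add: t_def)
  have "?P (axis j 1) = 0"
  proof (rule orth_proj_unique[OF sec(1)])
    show "0 \<in> E'" by (rule subspace_0[OF sec(1)])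
    fix e assume "e \<in> E'"
    then have e: "e \<in> E" "u \<bullet> e = 0" by (auto simp: E'_def)
    have "axis j 1 \<bullet> e = orth_proj E (axis j 1) \<bullet> e"
      using orth_proj_selfadjoint[OF E, of "axis j 1" e] orth_proj_fixed[OF E e(1)] by simp
    also have "\<dots> = a * (u \<bullet> e)" using a by (simp add: u_def)
    finally show "(axis j 1 - 0) \<bullet> e = 0" using e(2) by simp
  qed
  then have Pj: "?P (z + y *\<^sub>R axis j 1) = ?P z" for z y
    by (simp add: P.add P.scaleR)
  have uj: "axis j 1 \<bullet> u = a"
  proof -
    have "axis j 1 \<bullet> orth_proj E (axis j 1) = a\<^sup>2"
      using orth_proj_inner_left[OF E, of "axis j 1" "axis j 1"] by (simp add: a_def power2_norm_eq_inner inner_commute)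
    then show ?thesis using a by (simp add: u_def power2_eq_square)
  qed
  let ?I = "{- 1 / 2 .. 1 / 2 :: real}"
  let ?v = "\<lambda>x y. vec_lambda (x(j := y)) :: real ^ 'n"
  have v: "?v x y = ?v x 0 + y *\<^sub>R axis j 1" for x y
    by (simp add: vec_eq_iff axis_def)
  let ?M = "PiM (UNIV - {j}) (\<lambda>_. lborel :: real measure)"
  interpret product_sigma_finite "\<lambda>_::'n. lborel :: real measure" ..
  define k :: "('n \<Rightarrow> real) \<Rightarrow> ennreal" where "k x = (if \<forall>i. i \<noteq> j \<longrightarrow> x i \<in> ?I then 1 else 0)" for x
  have cube: "indicator unit_cube (?v x y) = k x * indicator ?I y" for x y
    by (auto simp: unit_cube_def k_def indicator_def split: if_splits)
  have split: "(\<integral>\<^sup>+z. f z \<partial>lborel) = (\<integral>\<^sup>+x. \<integral>\<^sup>+y. f (?v x y) \<partial>lborel \<partial>?M)"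
    if [measurable]: "f \<in> borel_measurable borel" for f :: "real ^ 'n \<Rightarrow> ennreal"
  proof -
    have ins: "insert j (UNIV - {j}) = (UNIV :: 'n set)" by auto
    have "(\<integral>\<^sup>+z. f z \<partial>lborel) = (\<integral>\<^sup>+g. f (vec_lambda g) \<partial>PiM (insert j (UNIV - {j})) (\<lambda>_::'n. lborel))"
      unfolding ins by (rule nn_integral_lborel_vec) fact
    also have "\<dots> = (\<integral>\<^sup>+x. \<integral>\<^sup>+y. f (?v x y) \<partial>lborel \<partial>?M)"
      by (rule product_nn_integral_insert) (auto simp: ins)
    finally show ?thesis .
  qed
  note orth_proj_borel[OF E, measurable] orth_proj_borel[OF sec(1), measurable]
  define w :: "('n \<Rightarrow> real) \<Rightarrow> ennreal" where "w x = ennreal (exp (- t * (norm (?P (?v x 0)))\<^sup>2)) * k x" for x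
  have "cube_laplace E t = (\<integral>\<^sup>+x. \<integral>\<^sup>+y. ennreal (exp (- t * (norm (orth_proj E (?v x y)))\<^sup>2)) * indicator unit_cube (?v x y) \<partial>lborel \<partial>?M)"
    unfolding cube_laplace_def by (rule split) measurable
  also have "\<dots> \<le> (\<integral>\<^sup>+x. \<integral>\<^sup>+y. w x * ennreal (exp (- t * (a * y + ?v x 0 \<bullet> u)\<^sup>2)) \<partial>lborel \<partial>?M)"
  proof (intro nn_integral_mono)
    fix x y
    have "(norm (orth_proj E (?v x y)))\<^sup>2 = (norm (?P (?v x 0)))\<^sup>2 + (a * y + ?v x 0 \<bullet> u)\<^sup>2"
      unfolding sec(3) by (subst (1 2) v) (simp add: Pj inner_add_left uj algebra_simps)
    then have "ennreal (exp (- t * (norm (orth_proj E (?v x y)))\<^sup>2))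
       = ennreal (exp (- t * (norm (?P (?v x 0)))\<^sup>2)) * ennreal (exp (- t * (a * y + ?v x 0 \<bullet> u)\<^sup>2))"
      by (simp add: distrib_left mult_exp_exp flip: ennreal_mult)
    then show "ennreal (exp (- t * (norm (orth_proj E (?v x y)))\<^sup>2)) * indicator unit_cube (?v x y)
       \<le> w x * ennreal (exp (- t * (a * y + ?v x 0 \<bullet> u)\<^sup>2))"
      unfolding cube w_def by (auto split: split_indicator simp: mult_ac)
  qed
  also have "\<dots> = (\<integral>\<^sup>+x. w x * ennreal (sqrt (pi / (t * a\<^sup>2))) \<partial>?M)"
    by (subst nn_integral_cmult) (auto simp only: nn_integral_gaussian_affine[OF t a], measurable)
  also have "\<dots> \<le> (\<integral>\<^sup>+x. ennreal (2 * sqrt pi / c) * w x \<partial>?M)"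
  proof -
    \<comment> \<open>a^2 > 1 / 2 is used here: the Gaussian integral is at most sqrt (2 * pi / t) =
      2 * sqrt pi / c, the factor that the balanced case gives for one dimension.\<close>
    have "pi / (t * a\<^sup>2) \<le> pi / (t * (1 / 2))"
      using a2 t a by (intro divide_left_mono mult_left_mono) auto
    then have "sqrt (pi / (t * a\<^sup>2)) \<le> sqrt (pi / (t * (1 / 2)))"
      by (rule real_sqrt_le_mono)
    also have "pi / (t * (1 / 2)) = (2 * sqrt pi / c)\<^sup>2"
      using c by (simp add: t_def power_divide power_mult_distrib)
    also have "sqrt \<dots> = 2 * sqrt pi / c"
      using c by simp
    finally show ?thesis
      by (intro nn_integral_mono) (simp add: mult.commute mult_left_mono ennreal_leI)
  qed
  also have "\<dots> = ennreal (2 * sqrt pi / c) * (\<integral>\<^sup>+x. w x \<partial>?M)"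
  proof (rule nn_integral_cmult)
    have upd: "(\<lambda>x. x(j := 0)) \<in> measurable ?M (PiM UNIV (\<lambda>_. lborel))"
    proof (rule measurable_PiM_single')
      show "(\<lambda>x. (x(j := 0)) i) \<in> measurable ?M lborel" for i
        by (cases "i = j") auto
    qed (auto simp: space_PiM)
    have [measurable]: "(\<lambda>x. ?v x 0) \<in> measurable ?M borel"
      by (rule measurable_compose[OF upd measurable_vec_lambda])
    have "k x = (\<Prod>i\<in>UNIV - {j}. indicator ?I (x i))" for x
      by (auto simp: k_def indicator_def intro!: prod.neutral[symmetric] prod_zero)
    then have [measurable]: "k \<in> borel_measurable ?M"
      by (subst measurable_cong[where g="\<lambda>x. \<Prod>i\<in>UNIV - {j}. indicator ?I (x i)"]) auto
    show "w \<in> borel_measurable ?M"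
      unfolding w_def[abs_def] by measurable
  qed
  \<comment> \<open>The projection to \<open>E'\<close> ignores coordinate \<open>j\<close>, and the
    cube has length 1 in that direction.\<close>
  also have "(\<integral>\<^sup>+x. w x \<partial>?M) = cube_laplace E' t"
  proof -
    have "cube_laplace E' t = (\<integral>\<^sup>+x. \<integral>\<^sup>+y. ennreal (exp (- t * (norm (?P (?v x y)))\<^sup>2)) * indicator unit_cube (?v x y) \<partial>lborel \<partial>?M)"
      unfolding cube_laplace_def by (rule split) measurable
    also have "\<dots> = (\<integral>\<^sup>+x. \<integral>\<^sup>+y. w x * indicator ?I y \<partial>lborel \<partial>?M)"
      unfolding cube w_def by (subst v) (simp add: Pj mult.assoc)
    also have "\<dots> = (\<integral>\<^sup>+x. w x \<partial>?M)"
      by (subst nn_integral_cmult_indicator) auto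
    finally show ?thesis ..
  qed
  finally show ?thesis
    using sec(1,2) unfolding t_def by blast
qed

text \<open>\<open>E'\<close> may again have a basis vector with a long projection, so sections are
  taken until none is left. Each lowers the dimension by one at the price of one factor; the ambient
  space stays the same.\<close>

lemma cube_laplace_le_wellorder:
  fixes E :: "(real ^ 'm::{finite,wellorder}) set"
  assumes "subspace E" and c: "0 < c"
  shows "cube_laplace E (c\<^sup>2 / 2) \<le> ennreal ((2 * sqrt pi / c) ^ dim E)"
  using assms(1)
proof (induction "dim E" arbitrary: E rule: less_induct)
  case less
  show ?case
  proof (cases "\<forall>i. (norm (orth_proj E (axis i 1)))\<^sup>2 \<le> 1 / 2")
    case True
    then show ?thesis using less.prems c by (intro cube_laplace_le_balanced) auto
  next
    case False
    then obtain j where "1 / 2 < (norm (orth_proj E (axis j 1)))\<^sup>2" by (auto simp: not_le)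
    then obtain E' :: "(real ^ 'm::_) set" where E': "subspace E'" "dim E = Suc (dim E')"
      "cube_laplace E (c\<^sup>2 / 2) \<le> ennreal (2 * sqrt pi / c) * cube_laplace E' (c\<^sup>2 / 2)"
      using cube_laplace_le_hyperplane_section[OF less.prems c] by blast
    have "cube_laplace E' (c\<^sup>2 / 2) \<le> ennreal ((2 * sqrt pi / c) ^ dim E')"
      using E'(2) by (intro less.hyps E'(1)) simp
    then have "cube_laplace E (c\<^sup>2 / 2) \<le> ennreal (2 * sqrt pi / c) * ennreal ((2 * sqrt pi / c) ^ dim E')"
      using E'(3) by (meson mult_left_mono order_trans zero_le)
    also have "\<dots> = ennreal ((2 * sqrt pi / c) ^ dim E)"
      using c E'(2) by (simp flip: ennreal_mult)
    finally show ?thesis .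
  qed
qed

section \<open>Arbitrary index types\<close>

text \<open>The change of variables formula of the library asks for a well-ordered index type. A finite type carries
  no order, so it is replaced by a copy that is ordered by an arbitrary enumeration.\<close>

typedef 'a wellordered = "UNIV :: 'a set" morphisms of_wellordered to_wellordered
  by simp

instance wellordered :: (finite) finite
proof
  have "(UNIV :: 'a::finite wellordered set) = range to_wellordered"
    by (metis of_wellordered_inverse surjI)
  then show "finite (UNIV :: 'a wellordered set)"
    by (metis finite finite_imageI)
qed

definition enumeration :: "'a::finite \<Rightarrow> nat" where
  "enumeration = (SOME f. inj f)"

lemma inj_enumeration: "inj (enumeration :: 'a::finite \<Rightarrow> nat)"
proof -
  have "\<exists>f :: 'a \<Rightarrow> nat. inj f"
    using finite_imp_inj_to_nat_seg[of "UNIV :: 'a set"] by auto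
  then show ?thesis
    unfolding enumeration_def by (rule someI_ex)
qed

instantiation wellordered :: (finite) wellorder
begin

definition "x \<le> y \<longleftrightarrow> enumeration (of_wellordered x) \<le> enumeration (of_wellordered y)"
definition "x < y \<longleftrightarrow> enumeration (of_wellordered x) < enumeration (of_wellordered y)"

instance
proof
  fix x y z :: "'a wellordered" and P :: "'a wellordered \<Rightarrow> bool"
  show "x \<le> y \<Longrightarrow> y \<le> x \<Longrightarrow> x = y"
    using inj_enumeration by (auto simp: less_eq_wellordered_def of_wellordered_inject dest!: antisym injD)
  assume *: "\<And>x. (\<And>y. y < x \<Longrightarrow> P y) \<Longrightarrow> P x"
  show "P x"
    by (induction x rule: measure_induct_rule[of "\<lambda>x. enumeration (of_wellordered x)"])
      (auto intro: * simp: less_wellordered_def)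
qed (auto simp: less_eq_wellordered_def less_wellordered_def)

end

definition relabel :: "real ^ 'n \<Rightarrow> real ^ 'n wellordered" where
  "relabel x = (\<chi> i. x $ of_wellordered i)"

definition unlabel :: "real ^ 'n wellordered \<Rightarrow> real ^ 'n" where
  "unlabel y = (\<chi> i. y $ to_wellordered i)"

lemma relabel_unlabel [simp]: "relabel (unlabel y) = y" and unlabel_relabel [simp]: "unlabel (relabel x) = x"
  by (simp_all add: relabel_def unlabel_def vec_eq_iff of_wellordered_inverse to_wellordered_inverse)

lemma bij_to_wellordered: "bij to_wellordered"
  by (rule o_bij[of of_wellordered]) (auto simp: fun_eq_iff of_wellordered_inverse to_wellordered_inverse)

lemma relabel_linear: "linear relabel"
  by (rule linearI) (simp_all add: relabel_def vec_eq_iff)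

lemma relabel_inner: "relabel x \<bullet> relabel y = x \<bullet> y" for x y :: "real ^ 'n"
  unfolding relabel_def inner_vec_def
  by (simp add: sum.reindex_bij_betw[OF bij_to_wellordered, of "\<lambda>i. x $ of_wellordered i * y $ of_wellordered i", symmetric]
      to_wellordered_inverse)

lemma norm_relabel: "norm (relabel x) = norm x"
  by (simp add: norm_eq_sqrt_inner relabel_inner)

lemma relabel_orth_proj:
  fixes E :: "(real ^ 'n) set"
  assumes E: "subspace E"
  shows "subspace (relabel ` E)" "dim (relabel ` E) = dim E" "orth_proj (relabel ` E) (relabel z) = relabel (orth_proj E z)"
proof -
  interpret linear "relabel :: real ^ 'n \<Rightarrow> _" by (rule relabel_linear)
  show sub: "subspace (relabel ` E)"
    by (rule linear_subspace_image[OF relabel_linear E])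
  have "inj (relabel :: real ^ 'n \<Rightarrow> _)"
    by (metis injI unlabel_relabel)
  then show "dim (relabel ` E) = dim E"
    by (intro dim_image_eq relabel_linear) (auto intro: inj_on_subset)
  show "orth_proj (relabel ` E) (relabel z) = relabel (orth_proj E z)"
  proof (rule orth_proj_unique[OF sub])
    fix e assume "e \<in> relabel ` E"
    then obtain e' where "e' \<in> E" "e = relabel e'" by auto
    then show "(relabel z - relabel (orth_proj E z)) \<bullet> e = 0"
      using inner_orth_proj_diff[OF E, of e' z] by (simp add: relabel_inner flip: diff)
  qed (use orth_proj_in[OF E] in simp)
qed

lemma unlabel_borel [measurable]: "unlabel \<in> borel_measurable borel"
  by (subst borel_measurable_euclidean_space) (auto simp: Basis_vec_def inner_axis unlabel_def)

lemma lborel_distr_unlabel: "(lborel :: (real ^ 'n) measure) = distr lborel borel unlabel"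
proof (rule lborel_eqI)
  fix l u :: "real ^ 'n"
  assume lu: "\<And>b. b \<in> Basis \<Longrightarrow> l \<bullet> b \<le> u \<bullet> b"
  have le: "l $ i \<le> u $ i" for i
    using lu[of "axis i 1"] by (auto simp: inner_axis axis_in_Basis_iff)
  have all: "(\<forall>i. P (to_wellordered i)) \<longleftrightarrow> (\<forall>i. P i)" for P :: "'n wellordered \<Rightarrow> bool"
    by (metis of_wellordered_inverse)
  have "unlabel -` box l u = box (relabel l) (relabel u)"
    unfolding vimage_def mem_box_cart unlabel_def relabel_def set_eq_iff
    by (auto simp: to_wellordered_inverse all[symmetric])
  then have "emeasure (distr lborel borel unlabel) (box l u) = emeasure lborel (box (relabel l) (relabel u))"
    by (subst emeasure_distr) auto
  also have "\<dots> = (\<Prod>b\<in>Basis. (relabel u - relabel l) \<bullet> b)"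
    by (rule emeasure_lborel_box) (auto simp: Basis_vec_def inner_axis relabel_def le)
  also have "(\<Prod>b\<in>Basis. (relabel u - relabel l) \<bullet> b) = (\<Prod>b\<in>Basis. (u - l) \<bullet> b)"
    unfolding prod_Basis_vec
    by (simp add: relabel_def to_wellordered_inverse
        prod.reindex_bij_betw[OF bij_to_wellordered, of "\<lambda>i. u $ of_wellordered i - l $ of_wellordered i", symmetric])
  finally show "emeasure (distr lborel borel unlabel) (box l u) = ennreal (\<Prod>b\<in>Basis. (u - l) \<bullet> b)" .
qed simp

lemma cube_laplace_relabel:
  fixes E :: "(real ^ 'n) set"
  assumes E: "subspace E"
  shows "cube_laplace E t = cube_laplace (relabel ` E) t"
proof -
  note orth_proj_borel[OF E, measurable]
  have "cube_laplace E t = (\<integral>\<^sup>+y. ennreal (exp (- t * (norm (orth_proj E (unlabel y)))\<^sup>2)) * indicator unit_cube (unlabel y) \<partial>lborel)"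
    unfolding cube_laplace_def by (subst lborel_distr_unlabel, subst nn_integral_distr) auto
  also have "\<dots> = cube_laplace (relabel ` E) t"
    unfolding cube_laplace_def
  proof (rule nn_integral_cong)
    fix y :: "real ^ 'n wellordered"
    have "norm (orth_proj (relabel ` E) y) = norm (orth_proj E (unlabel y))"
      using relabel_orth_proj(3)[OF E, of "unlabel y"] by (simp add: norm_relabel)
    moreover have "unlabel y \<in> unit_cube \<longleftrightarrow> y \<in> unit_cube"
      unfolding unit_cube_def unlabel_def by (auto; metis of_wellordered_inverse)
    ultimately show "ennreal (exp (- t * (norm (orth_proj E (unlabel y)))\<^sup>2)) * indicator unit_cube (unlabel y)
       = ennreal (exp (- t * (norm (orth_proj (relabel ` E) y))\<^sup>2)) * indicator unit_cube y"
      by (simp add: indicator_def)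
  qed
  finally show ?thesis .
qed

lemma cube_laplace_le:
  fixes E :: "(real ^ 'n) set"
  assumes "subspace E" "0 < c"
  shows "cube_laplace E (c\<^sup>2 / 2) \<le> ennreal ((2 * sqrt pi / c) ^ dim E)"
  using cube_laplace_le_wellorder[OF relabel_orth_proj(1)[OF assms(1)] assms(2)] relabel_orth_proj(2)[OF assms(1)]
  by (simp add: cube_laplace_relabel[OF assms(1)])

section \<open>Markov's inequality and the conclusion\<close>

lemma unit_cube_small_projection_le:
  fixes E :: "(real ^ 'n) set"
  assumes E: "subspace E" and e: "0 < e"
  shows "emeasure lborel ({z. norm (orth_proj E z) \<le> e * sqrt (real (dim E))} \<inter> unit_cube)
    \<le> ennreal ((2 * sqrt (pi * exp 1) * e) ^ dim E)"
proof -
  define k where "k = dim E"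
  \<comment> \<open>This t minimizes exp (t * e^2 * k) * (2 * pi / t)^(k / 2), which is Markov's
    bound combined with \<open>cube_laplace_le\<close> for c = 1 / e. The minimum is the claimed
    right-hand side, and its factor exp (k / 2) is the source of \<open>exp 1\<close> under the
    root.\<close>
  define t where "t = (1 / e)\<^sup>2 / 2"
  have t: "0 < t" "t * (e\<^sup>2 * real k) = real k / 2"
    using e by (auto simp: t_def power_divide)
  note orth_proj_borel[OF E, measurable]
  let ?A = "{z. norm (orth_proj E z) \<le> e * sqrt (real k)} \<inter> unit_cube"
  have "emeasure lborel ?A = (\<integral>\<^sup>+z. indicator ?A z \<partial>lborel)"
    by simp
  also have "\<dots> \<le> (\<integral>\<^sup>+z. ennreal (exp (real k / 2)) * (ennreal (exp (- t * (norm (orth_proj E z))\<^sup>2)) * indicator unit_cube z) \<partial>lborel)"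
  proof (rule nn_integral_mono)
    fix z
    show "indicator ?A z \<le> ennreal (exp (real k / 2)) * (ennreal (exp (- t * (norm (orth_proj E z))\<^sup>2)) * indicator unit_cube z)"
    proof (cases "z \<in> ?A")
      case True
      then have "(norm (orth_proj E z))\<^sup>2 \<le> (e * sqrt (real k))\<^sup>2"
        by (intro power_mono) auto
      then have "t * (norm (orth_proj E z))\<^sup>2 \<le> t * (e\<^sup>2 * real k)"
        using t(1) by (intro mult_left_mono) (auto simp: power_mult_distrib)
      then have "1 \<le> exp (real k / 2 + (- t * (norm (orth_proj E z))\<^sup>2))"
        using t(2) by simp
      also have "\<dots> = exp (real k / 2) * exp (- t * (norm (orth_proj E z))\<^sup>2)"
        by (rule exp_add)
      finally have "1 \<le> ennreal (exp (real k / 2) * exp (- t * (norm (orth_proj E z))\<^sup>2))"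
        by (simp add: ennreal_leI flip: ennreal_1)
      then show ?thesis
        using True by (simp add: ennreal_mult)
    qed simp
  qed
  also have "\<dots> = ennreal (exp (real k / 2)) * cube_laplace E t"
    unfolding cube_laplace_def by (rule nn_integral_cmult) measurable
  also have "\<dots> \<le> ennreal (exp (real k / 2)) * ennreal ((2 * sqrt pi / (1 / e)) ^ k)"
    unfolding t_def k_def using e by (intro mult_left_mono cube_laplace_le E) auto
  also have "\<dots> = ennreal (exp (real k / 2) * (2 * sqrt pi / (1 / e)) ^ k)"
    using e by (intro ennreal_mult[symmetric]) auto
  also have "exp (real k / 2) * (2 * sqrt pi / (1 / e)) ^ k = (2 * sqrt (pi * exp 1) * e) ^ k"
  proof -
    have "sqrt (exp 1) = exp (1 / 2)"
      by (rule real_sqrt_unique) (auto simp flip: exp_double)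
    moreover have "exp (real k / 2) = exp (1 / 2) ^ k"
      by (simp flip: exp_of_nat_mult)
    ultimately show ?thesis
      by (simp add: real_sqrt_mult power_mult_distrib)
  qed
  finally show ?thesis by (simp add: k_def)
qed

lemma is_seminorm_norm_orth_proj:
  assumes E: "subspace E"
  shows "is_seminorm (\<lambda>x. norm (orth_proj E x))"
  unfolding is_seminorm_def
  using linear_add[OF orth_proj_linear[OF E]] linear_scale[OF orth_proj_linear[OF E]] by (auto intro: norm_triangle_ineq)

theorem mainTheorem5:
  fixes M :: "'a measure" and M' :: "'b measure"
    and X :: "'a \<Rightarrow> real ^ 'n" and Z :: "'b \<Rightarrow> real ^ 'n"
    and f :: "'n::finite \<Rightarrow> real \<Rightarrow> real"
  assumes "prob_space M" and "prob_space M'"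
    and "\<And>i. probability_density (f i)"
    and "\<And>i. Linfty_norm (f i) \<le> 1"
    and "distributed M lborel X (\<lambda>v. ennreal (\<Prod>i\<in>UNIV. f i (v $ i)))"
    and "distributed M' lborel Z (\<lambda>v. ennreal (indicator unit_cube v / measure lborel (unit_cube :: (real ^ 'n) set)))"
  shows "(\<forall>(p :: real ^ 'n \<Rightarrow> real) (\<epsilon> :: real). is_seminorm p \<longrightarrow> \<epsilon> > 0 \<longrightarrow>
            \<P>(\<omega> in M. p (X \<omega>) \<le> \<epsilon>) \<le> \<P>(\<omega> in M'. p (Z \<omega>) \<le> \<epsilon>)) \<and>
         (\<forall>(E :: (real ^ 'n) set) (k :: nat) (\<epsilon> :: real).
            subspace E \<longrightarrow> dim E = k \<longrightarrow> 1 \<le> k \<longrightarrow> k \<le> CARD('n) \<longrightarrow> \<epsilon> > 0 \<longrightarrow>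
            \<P>(\<omega> in M. norm (orth_proj E (X \<omega>)) \<le> \<epsilon> * sqrt (real k))
              \<le> \<P>(\<omega> in M'. norm (orth_proj E (Z \<omega>)) \<le> \<epsilon> * sqrt (real k)) \<and>
            \<P>(\<omega> in M'. norm (orth_proj E (Z \<omega>)) \<le> \<epsilon> * sqrt (real k))
              \<le> (2 * sqrt (pi * exp 1) * \<epsilon>) ^ k)"
proof (intro conjI allI impI)
  fix p :: "real ^ 'n \<Rightarrow> real" and \<epsilon> :: real
  assume "is_seminorm p"
  then show "\<P>(\<omega> in M. p (X \<omega>) \<le> \<epsilon>) \<le> \<P>(\<omega> in M'. p (Z \<omega>) \<le> \<epsilon>)"
    by (rule prob_seminorm_le_unit_cube[OF assms])
next
  fix E :: "(real ^ 'n) set" and k :: nat and \<epsilon> :: real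
  assume "subspace E"
  then show "\<P>(\<omega> in M. norm (orth_proj E (X \<omega>)) \<le> \<epsilon> * sqrt (real k))
      \<le> \<P>(\<omega> in M'. norm (orth_proj E (Z \<omega>)) \<le> \<epsilon> * sqrt (real k))"
    by (intro prob_seminorm_le_unit_cube[OF assms] is_seminorm_norm_orth_proj)
next
  fix E :: "(real ^ 'n) set" and k :: nat and \<epsilon> :: real
  assume E: "subspace E" and k: "dim E = k" and \<epsilon>: "\<epsilon> > 0"
  interpret M': prob_space M' by fact
  let ?A = "{z. norm (orth_proj E z) \<le> \<epsilon> * sqrt (real k)}"
  have [measurable]: "?A \<in> sets borel"
    using orth_proj_borel[OF E] by measurable
  have "emeasure M' {\<omega> \<in> space M'. Z \<omega> \<in> ?A} = emeasure lborel (?A \<inter> unit_cube)"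
    using assms(6) by (rule prob_unit_cube_density) measurable
  also have "\<dots> \<le> ennreal ((2 * sqrt (pi * exp 1) * \<epsilon>) ^ k)"
    using unit_cube_small_projection_le[OF E \<epsilon>] by (simp add: k)
  finally show "\<P>(\<omega> in M'. norm (orth_proj E (Z \<omega>)) \<le> \<epsilon> * sqrt (real k)) \<le> (2 * sqrt (pi * exp 1) * \<epsilon>) ^ k"
    using \<epsilon> by (simp add: M'.emeasure_eq_measure)
qed

end
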